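(* Let $\Gamma$ be a planar network of order $n$ whose edges carry indeterminate weights, and let $W=(w_{i,j})$ be its $n\times n$ weight matrix. Let $k\geq 1$ and let $A=\{a_1<\cdots<a_k\}$ and $B=\{b_1<\cdots<b_k\}$ be subsets of $\{0,1,\ldots,n-1\}$, each of cardinality $k$. Let $T=(t_{i,j})$ be the $(A,B)$-minor matrix of $W$, i.e. $t_{i,j}=\det W[i+A,\,j+B]$ for $1\le i\le n-a_k$, $1\le j\le n-b_k$. Then every $2\times 2$ minor of $T$ is a polynomial in the edge weights of $\Gamma$ having no negative coefficients (i.e. it is a subtraction-free expression in the weights).
   Context: A planar network of order $n$ is a finite directed acyclic planar graph with exactly $n$ sources $s_1,\ldots,s_n$ and $n$ sinks $t_1,\ldots,t_n$, all lying on the boundary, arranged so that in counterclockwise order around the boundary they read $s_1,\ldots,s_n,t_n,\ldots,t_1$ (drawn with sources on the left, sinks on the right, all edges directed left to right). Each edge is assigned an indeterminate weight. A path is a directed path from some source $s_i$ to some sink $t_j$; its weight $\omega(\pi)$ is the product of the weights of its edges. The weight matrix $W=(w_{i,j})$ has $w_{i,j}=\sum_{\pi}\omega(\pi)$, the sum over all paths from $s_i$ to $t_j$ (empty sum $=0$). For index sets $I=\{i_1<\cdots<i_k\}$, $J=\{j_1<\cdots<j_k\}$, $W[I,J]$ denotes the $k\times k$ submatrix with rows in $I$ and columns in $J$. For a set $A$ and integer $i$, $i+A=\{i+a: a\in A\}$. *)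

theory Defs
  imports
    "HOL-Analysis.Path_Connected"
    "HOL-Library.Poly_Mapping"
    "Graph_Theory.Arc_Walk"
    "Jordan_Normal_Form.Determinant"
    "Jordan_Normal_Form.DL_Submatrix"
begin

(* Drawings live in the closed unit square.  Arcs may share points only at common vertices,
   and no vertex lies in the relative interior of an arc. *)

definition plane_drawing ::
  "('v, 'e) pre_digraph \<Rightarrow> ('v \<Rightarrow> real \<times> real) \<Rightarrow> ('e \<Rightarrow> real \<Rightarrow> real \<times> real) \<Rightarrow> bool" where
  "plane_drawing G pos curve \<longleftrightarrow>
     inj_on pos (verts G) \<and>
     pos ` verts G \<subseteq> {0..1} \<times> {0..1} \<and>
     (\<forall>e\<in>arcs G. arc (curve e) \<and>
        pathstart (curve e) = pos (tail G e) \<and>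
        pathfinish (curve e) = pos (head G e) \<and>
        path_image (curve e) \<subseteq> {0..1} \<times> {0..1} \<and>
        curve e ` {0<..<1} \<inter> pos ` verts G = {}) \<and>
     (\<forall>e\<in>arcs G. \<forall>f\<in>arcs G. e \<noteq> f \<longrightarrow> curve e ` {0<..<1} \<inter> curve f ` {0<..<1} = {})"

(* The order-n terminals are indexed by 0, ..., n - 1.  Sources lie on the left side and sinks on
   the right side of the square, both listed from top to bottom, so that counterclockwise along
   the boundary one reads s 0, ..., s (n - 1), t (n - 1), ..., t 0. *)

definition boundary_order ::
  "nat \<Rightarrow> (nat \<Rightarrow> 'v) \<Rightarrow> (nat \<Rightarrow> 'v) \<Rightarrow> ('v \<Rightarrow> real \<times> real) \<Rightarrow> bool" where
  "boundary_order n s t pos \<longleftrightarrow>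
     (\<forall>i<n. fst (pos (s i)) = 0 \<and> fst (pos (t i)) = 1) \<and>
     (\<forall>i<n. \<forall>j<n. i < j \<longrightarrow>
        snd (pos (s j)) < snd (pos (s i)) \<and> snd (pos (t j)) < snd (pos (t i)))"

locale planar_network = fin_digraph G
  for G :: "('v, 'e) pre_digraph" +
  fixes n :: nat and s t :: "nat \<Rightarrow> 'v"
  assumes acyclic: "\<nexists>p. cycle p"
    and sources: "bij_betw s {..<n} {v \<in> verts G. in_arcs G v = {}}"
    and sinks: "bij_betw t {..<n} {v \<in> verts G. out_arcs G v = {}}"
    and planar: "\<exists>pos curve. plane_drawing G pos curve \<and> boundary_order n s t pos"

(* The polynomial ring over the integers with one indeterminate for each element of the type:
   finitely supported maps from monomials (finitely supported exponent maps) to coefficients. *)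

type_synonym 'e int_mpoly = "('e \<Rightarrow>\<^sub>0 nat) \<Rightarrow>\<^sub>0 int"

definition indet :: "'e \<Rightarrow> 'e int_mpoly" where
  "indet e = Poly_Mapping.single (Poly_Mapping.single e 1) 1"

definition nonneg_polynomial_in :: "'e set \<Rightarrow> 'e int_mpoly \<Rightarrow> bool" where
  "nonneg_polynomial_in E p \<longleftrightarrow>
     (\<forall>m \<in> Poly_Mapping.keys p. Poly_Mapping.keys m \<subseteq> E) \<and>
     (\<forall>m. 0 \<le> Poly_Mapping.lookup p m)"

definition path_weight :: "'e awalk \<Rightarrow> 'e int_mpoly" where
  "path_weight p = prod_list (map indet p)"

definition weight_matrix ::
  "('v, 'e) pre_digraph \<Rightarrow> nat \<Rightarrow> (nat \<Rightarrow> 'v) \<Rightarrow> (nat \<Rightarrow> 'v) \<Rightarrow> 'e int_mpoly mat" where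
  "weight_matrix G n s t =
     mat n n (\<lambda>(i, j). \<Sum>p | pre_digraph.apath G (s i) p (t j). path_weight p)"

(* Matrix indices start at 0, so entry (i, j) here is the entry in row i + 1 and column j + 1
   in one-based numbering; the sets A and B themselves are unaffected. *)

definition minor_matrix :: "'a :: comm_ring_1 mat \<Rightarrow> nat set \<Rightarrow> nat set \<Rightarrow> 'a mat" where
  "minor_matrix W A B =
     mat (dim_row W - Max A) (dim_col W - Max B)
       (\<lambda>(i, j). Determinant.det (submatrix W ((+) i ` A) ((+) j ` B)))"

end

theory Submission
  imports Defs "HOL-Complex_Analysis.Winding_Numbers"
begin

text \<open>
  By the Lindstroem--Gessel--Viennot lemma a minor of the weight matrix is the sum of the weights of
  all vertex-disjoint path families with the given ends; such a family is the same thing as its arc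
  set, a unit-capacity flow. For rows \<^term>\<open>i < i'\<close> and columns \<^term>\<open>j < j'\<close> the two products in the
  minor of \<^term>\<open>T\<close> become sums over pairs of flows \<^term>\<open>(E, F)\<close>, and the monomial of a pair
  determines \<^term>\<open>E \<union> F\<close> and \<^term>\<open>E \<inter> F\<close>. The pairs with a fixed monomial and fixed ends, if there
  are any, form an affine space over the two-element field: the symmetric difference with a fixed arc
  set carries one kind of ends to the other. So it suffices to find, for one pair of families \<open>P, Q\<close>
  of the negative kind, one pair of the positive kind with the same monomial. Since \<open>P\<^sub>a\<close> starts
  above and ends below \<open>Q\<^sub>a\<close>, the upper and lower envelopes of \<open>P\<^sub>a\<close> and \<open>Q\<^sub>a\<close> have the right ends,
  and they are again vertex-disjoint by planarity.

  Being above a path means having winding number 1 around the loop formed by the path and a roof over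
  the square. Between two consecutive common vertices of two paths each is above the other or below
  it, never both: exchanging the two segments changes the winding number by that of the simple closed
  curve they form, which is 1 or -1.
\<close>

section \<open>Curves crossing the unit square\<close>

text \<open>Edges are arbitrary arcs, not graphs over the horizontal coordinate, so heights of two
  paths cannot be compared pointwise; winding numbers replace the comparison. Two families may also
  meet in a tangled way: exchanging tails of some \<open>P a\<close> and \<open>Q b\<close> can
  destroy disjointness inside a family, so cancelling pairs one by one is awkward. A comparison of
  cardinalities by translation needs only one geometric witness per monomial. The translation works
  because two arcs of \<open>E \<union> F\<close> with the same tail (or the same head) cannot
  belong to one flow, so each flow takes exactly one of them: a parity condition, stable under sums
  of three solutions. Flows are preferred to families because they are recognised vertex by vertex;
  which source is joined to which sink is recovered afterwards, since disjoint paths in the drawing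
  keep the order of their ends. The same fact removes all permutations but the identity from the
  determinant.\<close>

definition unit_square :: "complex set" where
  "unit_square = {z. 0 \<le> Re z \<and> Re z \<le> 1 \<and> 0 \<le> Im z \<and> Im z \<le> 1}"

definition crossing :: "(real \<Rightarrow> complex) \<Rightarrow> bool" where
  "crossing \<gamma> \<longleftrightarrow> arc \<gamma> \<and> path_image \<gamma> \<subseteq> unit_square \<and>
     Re (pathstart \<gamma>) = 0 \<and> Re (pathfinish \<gamma>) = 1"

text \<open>
  A curve may run along the boundary of the square, so it is closed up through points outside.
\<close>

abbreviation west :: complex where "west \<equiv> Complex (-1) 0"
abbreviation east :: complex where "east \<equiv> Complex 2 0"

text \<open>The right, top and left sides of the rectangle with opposite corners \<open>west\<close>
  and \<open>Complex 2 2\<close>. After a base from \<open>west\<close> to \<open>east\<close> they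
  run counterclockwise, so enclosed points get winding number 1 rather than -1. Height 2 leaves a
  free strip above the square.\<close>

definition roof :: "real \<Rightarrow> complex" where
  "roof = linepath east (Complex 2 2) +++ linepath (Complex 2 2) (Complex (-1) 2) +++
          linepath (Complex (-1) 2) west"

definition floor_of :: "(real \<Rightarrow> complex) \<Rightarrow> real \<Rightarrow> complex" where
  "floor_of \<gamma> = linepath west (pathstart \<gamma>) +++ \<gamma> +++ linepath (pathfinish \<gamma>) east"

definition loop_of :: "(real \<Rightarrow> complex) \<Rightarrow> real \<Rightarrow> complex" where
  "loop_of \<gamma> = floor_of \<gamma> +++ roof"

text \<open>The region enclosed lies between the curve and the roof. The value is meaningful only
  off the loop.\<close>

definition above :: "(real \<Rightarrow> complex) \<Rightarrow> complex \<Rightarrow> bool" where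
  "above \<gamma> z \<longleftrightarrow> winding_number (loop_of \<gamma>) z = 1"

lemma west_segment_iff:
  assumes "Re w = 0"
  shows "z \<in> closed_segment west w \<longleftrightarrow> -1 \<le> Re z \<and> Re z \<le> 0 \<and> Im z = (Re z + 1) * Im w"
proof
  assume "z \<in> closed_segment west w"
  then show "-1 \<le> Re z \<and> Re z \<le> 0 \<and> Im z = (Re z + 1) * Im w"
    using assms by (auto simp: in_segment)
next
  assume "-1 \<le> Re z \<and> Re z \<le> 0 \<and> Im z = (Re z + 1) * Im w"
  then show "z \<in> closed_segment west w"
    using assms unfolding in_segment
    by (intro exI[of _ "Re z + 1"]) (auto simp: complex_eq_iff)
qed

lemma east_segment_iff:
  assumes "Re w = 1"
  shows "z \<in> closed_segment w east \<longleftrightarrow> 1 \<le> Re z \<and> Re z \<le> 2 \<and> Im z = (2 - Re z) * Im w"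
proof
  assume "z \<in> closed_segment w east"
  then show "1 \<le> Re z \<and> Re z \<le> 2 \<and> Im z = (2 - Re z) * Im w"
    using assms by (auto simp: in_segment)
next
  assume "1 \<le> Re z \<and> Re z \<le> 2 \<and> Im z = (2 - Re z) * Im w"
  then show "z \<in> closed_segment w east"
    using assms unfolding in_segment
    by (intro exI[of _ "Re z - 1"]) (auto simp: complex_eq_iff algebra_simps)
qed

lemma path_image_roof:
  "path_image roof = {z. Re z = 2 \<and> 0 \<le> Im z \<and> Im z \<le> 2} \<union> {z. Im z = 2 \<and> -1 \<le> Re z \<and> Re z \<le> 2}
     \<union> {z. Re z = -1 \<and> 0 \<le> Im z \<and> Im z \<le> 2}"
  by (auto simp: roof_def path_image_join closed_segment_same_Re closed_segment_same_Im
      closed_segment_eq_real_ivl)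

lemma arc_roof: "arc roof"
  unfolding roof_def
  by (intro arc_join arc_linepath)
     (auto simp: path_image_join closed_segment_same_Re closed_segment_same_Im
       closed_segment_eq_real_ivl complex_eq_iff)

lemma roof_ends [simp]: "pathstart roof = east" "pathfinish roof = west"
  by (simp_all add: roof_def)

lemma floor_of_ends [simp]: "pathstart (floor_of \<gamma>) = west" "pathfinish (floor_of \<gamma>) = east"
  by (simp_all add: floor_of_def)

lemma loop_of_ends [simp]: "pathstart (loop_of \<gamma>) = west" "pathfinish (loop_of \<gamma>) = west"
  by (simp_all add: loop_of_def)

lemma path_image_floor_of:
  "path_image (floor_of \<gamma>) = closed_segment west (pathstart \<gamma>) \<union> path_image \<gamma>
     \<union> closed_segment (pathfinish \<gamma>) east"
  by (simp add: floor_of_def path_image_join Un_assoc)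

lemma path_image_loop_of: "path_image (loop_of \<gamma>) = path_image (floor_of \<gamma>) \<union> path_image roof"
  by (simp add: loop_of_def path_image_join)

context
  fixes \<gamma> :: "real \<Rightarrow> complex"
  assumes cr: "crossing \<gamma>"
begin

lemma crossing_arc: "arc \<gamma>" and crossing_path: "path \<gamma>"
  using cr by (auto simp: crossing_def arc_imp_path)

lemma crossing_ends:
  "Re (pathstart \<gamma>) = 0" "Re (pathfinish \<gamma>) = 1" "pathstart \<gamma> \<in> unit_square" "pathfinish \<gamma> \<in> unit_square"
  using cr by (auto simp: crossing_def)

text \<open>The connecting segments meet the square only in the two ends of the curve, even where
  the curve runs along a side, because \<open>west\<close> and \<open>east\<close> lie strictly
  outside.\<close>

lemma arc_floor_of: "arc (floor_of \<gamma>)"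
proof -
  note e = crossing_ends
  have img: "path_image \<gamma> \<subseteq> unit_square" using cr by (simp add: crossing_def)
  have "arc (\<gamma> +++ linepath (pathfinish \<gamma>) east)"
  proof (rule arc_join)
    show "arc \<gamma>" by (rule crossing_arc)
    show "arc (linepath (pathfinish \<gamma>) east)"
      using e by (intro arc_linepath) auto
    show "path_image \<gamma> \<inter> path_image (linepath (pathfinish \<gamma>) east)
      \<subseteq> {pathstart (linepath (pathfinish \<gamma>) east)}"
      using img e by (auto simp: east_segment_iff unit_square_def complex_eq_iff)
  qed auto
  then show ?thesis
    unfolding floor_of_def
  proof (intro arc_join[of "linepath west (pathstart \<gamma>)"])
    show "arc (linepath west (pathstart \<gamma>))"
      using e by (intro arc_linepath) (auto simp: complex_eq_iff)
    show "path_image (linepath west (pathstart \<gamma>)) \<inter> path_image (\<gamma> +++ linepath (pathfinish \<gamma>) east)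
      \<subseteq> {pathstart (\<gamma> +++ linepath (pathfinish \<gamma>) east)}"
      using img e by (auto simp: path_image_join east_segment_iff west_segment_iff unit_square_def complex_eq_iff)
  qed auto
qed

lemma path_image_floor_of_Im: "z \<in> path_image (floor_of \<gamma>) \<Longrightarrow> 0 \<le> Im z \<and> Im z \<le> 1"
proof -
  assume z: "z \<in> path_image (floor_of \<gamma>)"
  have "convex {z. 0 \<le> Im z \<and> Im z \<le> 1}"
    using convex_halfspace_Im_ge[of 0] convex_halfspace_Im_le[of 1]
    by (auto simp: Collect_conj_eq intro!: convex_Int)
  then have "closed_segment west (pathstart \<gamma>) \<subseteq> {z. 0 \<le> Im z \<and> Im z \<le> 1}"
    "closed_segment (pathfinish \<gamma>) east \<subseteq> {z. 0 \<le> Im z \<and> Im z \<le> 1}"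
    using crossing_ends by (intro closed_segment_subset; simp add: unit_square_def)+
  then show ?thesis
    using z cr by (auto simp: path_image_floor_of crossing_def unit_square_def)
qed

lemma simple_path_loop_of: "simple_path (loop_of \<gamma>)"
  unfolding loop_of_def
proof (rule simple_path_join_loop)
  show "path_image (floor_of \<gamma>) \<inter> path_image roof \<subseteq> {pathstart (floor_of \<gamma>), pathstart roof}"
  proof
    fix z assume z: "z \<in> path_image (floor_of \<gamma>) \<inter> path_image roof"
    have "Im z \<noteq> 2" using path_image_floor_of_Im[of z] z by auto
    then have "Re z = -1 \<or> Re z = 2" using z by (auto simp: path_image_roof)
    then show "z \<in> {pathstart (floor_of \<gamma>), pathstart roof}"
      using z cr crossing_ends
      by (auto simp: path_image_floor_of west_segment_iff east_segment_iff crossing_def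
          unit_square_def complex_eq_iff)
  qed
qed (auto simp: arc_floor_of arc_roof)

lemma path_loop_of: "path (loop_of \<gamma>)"
  using simple_path_loop_of by (rule simple_path_imp_path)

text \<open>Inside the square the closing pieces add no points, so a point of the square avoids the
  loop as soon as it avoids the curve.\<close>

lemma unit_square_loop_of: "unit_square \<inter> path_image (loop_of \<gamma>) = path_image \<gamma>"
proof -
  have "z \<in> path_image \<gamma>" if "z \<in> unit_square" "z \<in> path_image (loop_of \<gamma>)" for z
  proof -
    have "z \<notin> path_image roof" using that by (auto simp: unit_square_def path_image_roof)
    moreover have "z = pathstart \<gamma>" if "z \<in> closed_segment west (pathstart \<gamma>)"
      using that \<open>z \<in> unit_square\<close> crossing_ends
      by (auto simp: west_segment_iff unit_square_def complex_eq_iff)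
    moreover have "z = pathfinish \<gamma>" if "z \<in> closed_segment (pathfinish \<gamma>) east"
      using that \<open>z \<in> unit_square\<close> crossing_ends
      by (auto simp: east_segment_iff unit_square_def complex_eq_iff)
    ultimately show ?thesis
      using that by (auto simp: path_image_loop_of path_image_floor_of)
  qed
  then show ?thesis
    using cr by (auto simp: path_image_loop_of path_image_floor_of crossing_def)
qed

lemma winding_number_loop_of:
  assumes "z \<notin> path_image (loop_of \<gamma>)"
  shows "winding_number (loop_of \<gamma>) z = winding_number (linepath west (pathstart \<gamma>)) z +
    winding_number \<gamma> z + winding_number (linepath (pathfinish \<gamma>) east) z + winding_number roof z"
  using assms crossing_path arc_imp_path[OF arc_roof]
  by (simp add: loop_of_def floor_of_def winding_number_join path_image_join)

text \<open>The floor followed by the reversed base is a closed curve in the half-plane below height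
  1, hence does not wind around \<open>z\<close>. The floor may thus be replaced by the straight
  base, which turns the loop into the boundary of a rectangle.\<close>

lemma winding_number_loop_of_top:
  assumes "Im z > 1" "Im z < 2" "Re z > -1" "Re z < 2"
  shows "winding_number (loop_of \<gamma>) z = 1"
proof -
  let ?l = "linepath west east"
  have floor: "z \<notin> path_image (floor_of \<gamma>)" using path_image_floor_of_Im[of z] assms by auto
  have line: "z \<notin> path_image ?l" using assms by (auto simp: closed_segment_same_Im)
  have roof: "z \<notin> path_image roof" using assms by (auto simp: path_image_roof)
  have "path_image (floor_of \<gamma> +++ reversepath ?l) \<subseteq> {z. Im z \<le> 1}"
    using path_image_floor_of_Im by (auto simp: path_image_join closed_segment_same_Im)
  then have "winding_number (floor_of \<gamma> +++ reversepath ?l) z = 0"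
    using assms arc_floor_of
    by (intro winding_number_zero_outside[OF _ convex_halfspace_Im_le]) (auto simp: arc_imp_path)
  then have "winding_number (floor_of \<gamma>) z = winding_number ?l z"
    using floor line arc_imp_path[OF arc_floor_of]
    by (simp add: winding_number_join winding_number_reversepath del: reversepath_linepath)
  then have "winding_number (loop_of \<gamma>) z = winding_number (?l +++ roof) z"
    using floor line roof arc_imp_path[OF arc_floor_of] arc_imp_path[OF arc_roof]
    by (simp add: loop_of_def winding_number_join)
  also have "?l +++ roof = rectpath west (Complex 2 2)"
    by (simp add: rectpath_def roof_def Let_def)
  also have "winding_number \<dots> z = 1"
    using assms by (intro winding_number_rectpath) (auto simp: in_box_complex_iff)
  finally show ?thesis .
qed

text \<open>Inside a simple closed curve the winding number is constantly 1 or constantly -1. One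
  point between the square and the roof decides for 1.\<close>

lemma winding_number_loop_of_cases:
  assumes "z \<notin> path_image (loop_of \<gamma>)"
  shows "winding_number (loop_of \<gamma>) z = 0 \<or> winding_number (loop_of \<gamma>) z = 1"
proof -
  let ?z0 = "Complex (1/2) (3/2)"
  have "winding_number (loop_of \<gamma>) ?z0 = 1" by (rule winding_number_loop_of_top) auto
  moreover have "?z0 \<notin> path_image (loop_of \<gamma>)"
    using path_image_floor_of_Im[of ?z0] by (auto simp: path_image_loop_of path_image_roof)
  ultimately have z0: "?z0 \<in> inside (path_image (loop_of \<gamma>))"
    using winding_number_zero_in_outside[OF path_loop_of, of ?z0]
    by (metis ComplI UnE inside_Un_outside loop_of_ends zero_neq_one)
  have "winding_number (loop_of \<gamma>) z = 1" if "z \<in> inside (path_image (loop_of \<gamma>))"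
    using simple_closed_path_winding_number_inside[OF simple_path_loop_of] z0 that
      \<open>winding_number (loop_of \<gamma>) ?z0 = 1\<close>
    by (metis one_neq_neg_one)
  moreover have "winding_number (loop_of \<gamma>) z = 0" if "z \<in> outside (path_image (loop_of \<gamma>))"
    using winding_number_zero_in_outside[OF path_loop_of] that by simp
  ultimately show ?thesis
    using assms inside_Un_outside[of "path_image (loop_of \<gamma>)"] by blast
qed

lemma above_connected:
  assumes "connected S" "S \<subseteq> unit_square" "S \<inter> path_image \<gamma> = {}" "x \<in> S" "y \<in> S"
  shows "above \<gamma> x \<longleftrightarrow> above \<gamma> y"
proof -
  have "S \<inter> path_image (loop_of \<gamma>) = {}"
    using assms unit_square_loop_of by blast
  then show ?thesis
    using winding_number_eq[OF path_loop_of _ assms(4,5,1)] by (simp add: above_def)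
qed

text \<open>From \<open>z\<close> one leaves the square towards \<open>west\<close> or
  \<open>east\<close>, without touching the curve, to a point \<open>m\<close>. From there a
  vertical segment away from the floor leads up into the strip under the roof, with winding number
  1, or down below everything, with winding number 0.\<close>

lemma above_side:
  assumes z: "z \<in> unit_square" "Re z = 0 \<or> Re z = 1" "z \<notin> path_image \<gamma>"
  defines "w \<equiv> (if Re z = 0 then pathstart \<gamma> else pathfinish \<gamma>)"
  shows "above \<gamma> z \<longleftrightarrow> Im w < Im z"
proof -
  note e = crossing_ends
  have img: "path_image \<gamma> \<subseteq> unit_square" using cr by (simp add: crossing_def)
  have ne: "Im z \<noteq> Im w"
    using z e pathstart_in_path_image[of \<gamma>] pathfinish_in_path_image[of \<gamma>]
    by (auto simp: w_def) (metis complex_eqI)+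
  \<comment> \<open>\<open>m\<close> is the midpoint of the segment from \<open>z\<close> to
    \<open>west\<close> or \<open>east\<close>. On the way the heights of \<open>z\<close> and of
    the end \<open>w\<close> of the curve shrink by the same factor \<open>1 - r / 2\<close>, so the
    two segments stay apart.\<close>
  define x where "x = (if Re z = 0 then -1/2 else 3/2 :: real)"
  define m where "m = Complex x (Im z / 2)"
  have off: "u \<notin> path_image (floor_of \<gamma>)" if u: "u \<in> closed_segment z m" for u
  proof -
    obtain r where r: "0 \<le> r" "r \<le> 1" "u = (1 - r) *\<^sub>R z + r *\<^sub>R m"
      using u by (auto simp: in_segment)
    show ?thesis
    proof (cases "r = 0")
      case True
      then show ?thesis
        using r z e ne by (auto simp: path_image_floor_of west_segment_iff east_segment_iff w_def)
    next
      case False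
      have Imu: "Im u = (1 - r / 2) * Im z" unfolding r(3) m_def by (simp add: algebra_simps)
      have nz: "1 - r / 2 \<noteq> 0" using r by auto
      show ?thesis
      proof (cases "Re z = 0")
        case t: True
        have Reu: "Re u = - r / 2" using r t by (simp add: m_def x_def)
        have "u \<notin> unit_square" using Reu False r by (auto simp: unit_square_def)
        moreover have eq: "Re u + 1 = 1 - r / 2" using Reu by simp
        have "Im u \<noteq> (Re u + 1) * Im w"
          unfolding eq Imu using ne nz by simp
        ultimately show ?thesis
          using img e Reu r t by (auto simp: path_image_floor_of west_segment_iff east_segment_iff w_def)
      next
        case f: False
        then have f': "Re z = 1" using z by auto
        have Reu: "Re u = 1 + r / 2" using f f' unfolding r(3) m_def x_def by (simp add: algebra_simps)
        have "u \<notin> unit_square" using Reu False r by (auto simp: unit_square_def)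
        moreover have eq: "2 - Re u = 1 - r / 2" using Reu by simp
        have "Im u \<noteq> (2 - Re u) * Im w"
          unfolding eq Imu using ne nz by simp
        ultimately show ?thesis
          using img e Reu r f by (auto simp: path_image_floor_of west_segment_iff east_segment_iff w_def)
      qed
    qed
  qed
  have segroof: "closed_segment z m \<inter> path_image roof = {}"
  proof -
    have "convex {u. -1 < Re u \<and> Re u < 2 \<and> Im u < 2}"
      by (intro convex_Int[of "{u. -1 < Re u}" "{u. Re u < 2} \<inter> {u. Im u < 2}", simplified Int_def, simplified] convex_halfspace_Re_gt
          convex_halfspace_Re_lt convex_halfspace_Im_lt convex_Int)
         (use convex_Int[OF convex_halfspace_Re_lt[of 2] convex_halfspace_Im_lt[of 2]] in \<open>auto simp: Int_def\<close>)
    then have "closed_segment z m \<subseteq> {u. -1 < Re u \<and> Re u < 2 \<and> Im u < 2}"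
      by (rule closed_segment_subset[rotated 2]) (use z in \<open>auto simp: m_def x_def unit_square_def\<close>)
    then show ?thesis by (auto simp: path_image_roof)
  qed
  have zm: "winding_number (loop_of \<gamma>) z = winding_number (loop_of \<gamma>) m"
    by (rule winding_number_eq[OF path_loop_of, of _ "closed_segment z m"])
       (use off segroof in \<open>auto simp: path_image_loop_of\<close>)
  \<comment> \<open>The vertical line through \<open>m\<close> meets the floor in one point only,
    the midpoint of the connecting segment at \<open>w\<close>.\<close>
  have mfl: "u \<in> path_image (floor_of \<gamma>) \<longleftrightarrow> Im u = Im w / 2" if "Re u = x" for u
    using that e img z(2)
    by (auto simp: path_image_floor_of west_segment_iff east_segment_iff w_def x_def unit_square_def split: if_splits)
  show ?thesis
  proof (cases "Im w < Im z")
    case True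
    let ?n = "Complex x (3/2)"
    have "closed_segment m ?n \<inter> path_image (loop_of \<gamma>) = {}"
    proof -
      have "u \<notin> path_image (loop_of \<gamma>)" if "u \<in> closed_segment m ?n" for u
      proof -
        have "Re u = x" "Im z / 2 \<le> Im u" "Im u \<le> 3/2"
          using that z(1) by (auto simp: closed_segment_same_Re m_def closed_segment_eq_real_ivl unit_square_def split: if_splits)
        then show ?thesis using True mfl[of u] by (auto simp: path_image_loop_of path_image_roof x_def split: if_splits)
      qed
      then show ?thesis by blast
    qed
    then have "winding_number (loop_of \<gamma>) m = winding_number (loop_of \<gamma>) ?n"
      by (intro winding_number_eq[OF path_loop_of, of _ "closed_segment m ?n"]) auto
    also have "\<dots> = 1" by (rule winding_number_loop_of_top) (auto simp: x_def)
    finally show ?thesis using True zm by (simp add: above_def)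
  next
    case False
    then have lt: "Im z < Im w" using ne by simp
    let ?n = "Complex x (-1)"
    have "closed_segment m ?n \<inter> path_image (loop_of \<gamma>) = {}"
    proof -
      have "u \<notin> path_image (loop_of \<gamma>)" if "u \<in> closed_segment m ?n" for u
      proof -
        have "Re u = x" "Im u \<le> Im z / 2" "Im z / 2 \<le> 1/2"
          using that z(1) by (auto simp: closed_segment_same_Re m_def closed_segment_eq_real_ivl unit_square_def split: if_splits)
        then show ?thesis using lt mfl[of u] by (auto simp: path_image_loop_of path_image_roof x_def split: if_splits)
      qed
      then show ?thesis by blast
    qed
    then have "winding_number (loop_of \<gamma>) m = winding_number (loop_of \<gamma>) ?n"
      by (intro winding_number_eq[OF path_loop_of, of _ "closed_segment m ?n"]) auto
    also have "\<dots> = 0"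
      using path_image_floor_of_Im
      by (intro winding_number_zero_outside[OF path_loop_of convex_halfspace_Im_ge[of 0]])
         (auto simp: path_image_loop_of path_image_roof)
    finally show ?thesis using False zm by (simp add: above_def)
  qed
qed

end

text \<open>
  Here \<open>\<gamma>'\<close> is \<open>\<gamma>\<close> with the piece \<open>q\<close> replaced by \<open>p\<close>. Points inside the simple closed curve formed by
  \<open>q\<close> and \<open>p\<close> come arbitrarily close to \<open>x\<close>; at such a point the winding numbers of the two loops lie
  in \<open>{0, 1}\<close> and differ by 1 or -1, so the sign of the difference determines both.
\<close>

lemma above_detour:
  fixes \<gamma> \<gamma>' p q :: "real \<Rightarrow> complex"
  assumes \<gamma>: "crossing \<gamma>" and \<gamma>': "crossing \<gamma>'"
    and ends: "pathstart \<gamma>' = pathstart \<gamma>" "pathfinish \<gamma>' = pathfinish \<gamma>"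
    and p: "arc p" and q: "arc q" and pq: "pathstart p = pathstart q" "pathfinish p = pathfinish q"
    and meet: "path_image p \<inter> path_image q \<subseteq> {pathstart q, pathfinish q}"
    and sub: "path_image q \<subseteq> path_image \<gamma>" "path_image \<gamma>' \<subseteq> path_image \<gamma> \<union> path_image p"
      "path_image p \<subseteq> unit_square"
    and wn: "\<And>z. z \<notin> path_image \<gamma> \<union> path_image p \<Longrightarrow>
      winding_number \<gamma> z - winding_number \<gamma>' z = winding_number q z - winding_number p z"
    and x: "x \<in> path_image p" "x \<notin> path_image \<gamma>"
    and z: "z \<in> inside (path_image q \<union> path_image p)"
  shows "above \<gamma> x \<longleftrightarrow> winding_number q z - winding_number p z = 1"
    and "\<not> above \<gamma> x \<longleftrightarrow> winding_number q z - winding_number p z = -1"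
proof -
  define K where "K = q +++ reversepath p"
  have K: "simple_path K" "pathfinish K = pathstart K"
    unfolding K_def using p q pq meet
    by (auto intro!: simple_path_join_loop arc_reversepath)
  have Kimg: "path_image K = path_image q \<union> path_image p"
    using pq by (simp add: K_def path_image_join)
  have wnK: "winding_number K y = winding_number q y - winding_number p y" if "y \<notin> path_image K" for y
    using that p q pq unfolding Kimg
    by (simp add: K_def winding_number_join winding_number_reversepath arc_imp_path)
  have "x \<notin> path_image (loop_of \<gamma>)"
    using x sub unit_square_loop_of[OF \<gamma>] by blast
  then obtain e where e: "e > 0" "ball x e \<inter> path_image (loop_of \<gamma>) = {}"
    using closed_path_image[OF path_loop_of[OF \<gamma>]]
    by (metis open_Compl open_contains_ball ComplI disjoint_eq_subset_Compl)
  have "x \<in> frontier (inside (path_image K))"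
    using Jordan_inside_outside[OF K] x Kimg by auto
  then obtain y where y: "y \<in> inside (path_image K)" "y \<in> ball x e"
    using e(1) by (auto simp: frontier_straddle)
  have yK: "y \<notin> path_image K" using y(1) by (simp add: inside_def)
  have y\<gamma>: "y \<notin> path_image (loop_of \<gamma>)" using y e by blast
  have y\<gamma>': "y \<notin> path_image (loop_of \<gamma>')"
    using y\<gamma> yK sub ends unfolding Kimg path_image_loop_of path_image_floor_of by auto
  have "y \<notin> path_image \<gamma> \<union> path_image p"
    using y\<gamma> yK unfolding Kimg path_image_loop_of path_image_floor_of by auto
  \<comment> \<open>Both loops have the same connecting segments and the same roof, so these cancel
    in the difference.\<close>
  then have diff: "winding_number (loop_of \<gamma>) y - winding_number (loop_of \<gamma>') y = winding_number K y"
    using winding_number_loop_of[OF \<gamma> y\<gamma>] winding_number_loop_of[OF \<gamma>' y\<gamma>'] wn[of y] wnK[OF yK] ends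
    by simp
  have xy: "above \<gamma> x \<longleftrightarrow> winding_number (loop_of \<gamma>) y = 1"
    unfolding above_def
    using winding_number_eq[OF path_loop_of[OF \<gamma>] _ _ y(2), of x] e by simp
  have zK: "z \<in> inside (path_image K)" using z by (simp add: Kimg)
  then have "z \<notin> path_image K" by (simp add: inside_def)
  have const: "winding_number K y = winding_number q z - winding_number p z"
      "winding_number K y = 1 \<or> winding_number K y = -1"
    using simple_closed_path_winding_number_inside[OF K(1)] y(1) zK wnK[OF \<open>z \<notin> path_image K\<close>] by metis+
  have cases: "winding_number (loop_of \<gamma>) y = 0 \<or> winding_number (loop_of \<gamma>) y = 1"
     "winding_number (loop_of \<gamma>') y = 0 \<or> winding_number (loop_of \<gamma>') y = 1"
    using winding_number_loop_of_cases[OF \<gamma> y\<gamma>] winding_number_loop_of_cases[OF \<gamma>' y\<gamma>'] .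
  show "above \<gamma> x \<longleftrightarrow> winding_number q z - winding_number p z = 1"
    using xy diff const cases by auto
  show "\<not> above \<gamma> x \<longleftrightarrow> winding_number q z - winding_number p z = -1"
    using xy diff const cases by auto
qed

section \<open>Paths in a drawn network\<close>

context planar_network
begin

section \<open>Walks in an acyclic network\<close>

lemma closed_awalk_Nil: "awalk u p u \<Longrightarrow> p = []"
  using closed_w_imp_cycle acyclic by (auto simp: closed_w_def)

lemma awalk_antisym:
  assumes "awalk u p v" "awalk v q u"
  shows "u = v"
proof -
  have "p @ q = []"
    using assms by (intro closed_awalk_Nil[of u]) auto
  then show ?thesis using assms by (auto simp: awalk_Nil_iff)
qed

lemma awalk_iff_apath: "awalk u p v \<longleftrightarrow> apath u p v"
proof
  assume p: "awalk u p v"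
  show "apath u p v"
  proof (rule ccontr)
    assume "\<not> apath u p v"
    then obtain r w where "r \<noteq> []" "awalk w r w"
      using awalk_not_distinct_decomp[OF p] p by (auto simp: apath_def)
    then show False using closed_awalk_Nil by blast
  qed
qed (simp add: apath_def)

lemma awalk_distinct:
  assumes "awalk u p v"
  shows "distinct (awalk_verts u p)" "distinct p"
proof -
  have "apath u p v" using assms awalk_iff_apath by blast
  then show "distinct (awalk_verts u p)" by (simp add: apath_def)
  then show "distinct p" by (rule distinct_verts_imp_distinct[OF assms])
qed

lemma source_props:
  assumes "i < n"
  shows "s i \<in> verts G" "in_arcs G (s i) = {}"
  using assms sources by (auto simp: bij_betw_def)

lemma sink_props:
  assumes "i < n"
  shows "t i \<in> verts G" "out_arcs G (t i) = {}"
  using assms sinks by (auto simp: bij_betw_def)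

lemma s_eq_iff: "i < n \<Longrightarrow> j < n \<Longrightarrow> s i = s j \<longleftrightarrow> i = j"
  using sources by (auto simp: bij_betw_def inj_on_def)

lemma t_eq_iff: "i < n \<Longrightarrow> j < n \<Longrightarrow> t i = t j \<longleftrightarrow> i = j"
  using sinks by (auto simp: bij_betw_def inj_on_def)

lemma head_ne_source: "e \<in> arcs G \<Longrightarrow> i < n \<Longrightarrow> head G e \<noteq> s i"
  using source_props(2)[of i] by (auto simp: in_arcs_def)

lemma tail_ne_sink: "e \<in> arcs G \<Longrightarrow> i < n \<Longrightarrow> tail G e \<noteq> t i"
  using sink_props(2)[of i] by (auto simp: out_arcs_def)

lemma awalk_arcs: "awalk u p v \<Longrightarrow> e \<in> set p \<Longrightarrow> e \<in> arcs G"
  by (auto simp: awalk_def)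

lemma awalk_arc_ends:
  assumes "awalk u p v" "e \<in> set p"
  shows "tail G e \<in> set (awalk_verts u p)" "head G e \<in> set (awalk_verts u p)"
  using awalk_verts_arc1[OF assms(2)] awalk_verts_arc2[OF assms(1,2)] by auto

lemma awalk_verts_ends:
  assumes "awalk u p v"
  shows "u \<in> set (awalk_verts u p)" "v \<in> set (awalk_verts u p)"
  using assms by (auto intro: hd_in_awalk_verts)

text \<open>No arc enters a source, so the part of the walk up to \<open>s a\<close> is
  empty.\<close>

lemma source_on_awalk:
  assumes "awalk (s i) p v" "s a \<in> set (awalk_verts (s i) p)" "i < n" "a < n"
  shows "a = i"
proof -
  obtain q r where q: "awalk (s i) q (s a)"
    using awalk_decomp[OF assms(1,2)] by blast
  have "q = []"
  proof (cases q rule: rev_cases)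
    case (snoc q' e)
    then have "e \<in> arcs G" "head G e = s a" using q by (auto simp: awalk_simps)
    then show ?thesis using head_ne_source assms by blast
  qed auto
  then show ?thesis using q s_eq_iff assms by (auto simp: awalk_Nil_iff)
qed

lemma sink_on_awalk:
  assumes "awalk u p (t j)" "t b \<in> set (awalk_verts u p)" "j < n" "b < n"
  shows "b = j"
proof -
  obtain q r where q: "awalk (t b) r (t j)"
    using awalk_decomp[OF assms(1,2)] by blast
  have "r = []"
  proof (cases r)
    case (Cons e q')
    then have "e \<in> arcs G" "tail G e = t b" using q by (auto simp: awalk_simps)
    then show ?thesis using tail_ne_sink assms by blast
  qed auto
  then show ?thesis using q t_eq_iff assms by (auto simp: awalk_Nil_iff)
qed

text \<open>Leaving a vertex by two different arcs would require returning to it, which acyclicity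
  forbids.\<close>

lemma awalk_same_tail:
  assumes "awalk u p v" "e \<in> set p" "f \<in> set p" "tail G e = tail G f"
  shows "e = f"
proof -
  obtain p1 p2 where p: "p = p1 @ e # p2" using assms by (auto simp: in_set_conv_decomp)
  have w: "awalk u p1 (tail G e)" "awalk (tail G e) (e # p2) v"
    using assms(1) by (auto simp: p awalk_simps)
  have d: "distinct (awalk_verts (tail G e) (e # p2))" by (rule awalk_distinct[OF w(2)])
  have "f \<notin> set p2"
    using d assms(4) awalk_verts_arc1[of f p2 "head G e"] by auto
  moreover have "f \<notin> set p1"
  proof
    assume "f \<in> set p1"
    then obtain a b where "p1 = a @ f # b" by (auto simp: in_set_conv_decomp)
    then have "awalk (tail G f) (f # b) (tail G e)" using w(1) by (auto simp: awalk_simps)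
    then show False using assms(4) closed_awalk_Nil by auto
  qed
  ultimately show ?thesis using assms(3) p by auto
qed

lemma awalk_same_head:
  assumes "awalk u p v" "e \<in> set p" "f \<in> set p" "head G e = head G f"
  shows "e = f"
proof (rule ccontr)
  assume ne: "e \<noteq> f"
  have False if p: "p = p1 @ e # p2" and f: "f \<in> set p2" and h: "head G e = head G f" for p1 p2 e f
  proof -
    obtain a b where "p2 = a @ f # b" using f by (auto simp: in_set_conv_decomp)
    then have "awalk (head G e) (a @ [f]) (head G f)" using assms(1) by (auto simp: p awalk_simps)
    then show False using h closed_awalk_Nil by (metis Nil_is_append_conv not_Cons_self2)
  qed
  note * = this
  obtain p1 p2 where p: "p = p1 @ e # p2" using assms by (auto simp: in_set_conv_decomp)
  show False
  proof (cases "f \<in> set p2")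
    case True
    then show False using *[OF p True] assms(4) by simp
  next
    case False
    then have "f \<in> set p1" using p ne assms(3) by auto
    then obtain a b where "p1 = a @ f # b" by (auto simp: in_set_conv_decomp)
    then have "p = a @ f # (b @ e # p2)" using p by simp
    then show False using *[of a f "b @ e # p2" e] assms(4) by auto
  qed
qed

end

section \<open>Walks as curves in a fixed drawing\<close>

locale drawn_network = planar_network G n s t
  for G :: "('v, 'e) pre_digraph" and n :: nat and s t :: "nat \<Rightarrow> 'v" +
  fixes pos :: "'v \<Rightarrow> real \<times> real" and curve :: "'e \<Rightarrow> real \<Rightarrow> real \<times> real"
  assumes drawing: "plane_drawing G pos curve"
    and boundary: "boundary_order n s t pos"
begin

text \<open>The drawing is moved from \<open>real \<times> real\<close> to the complex plane, where
  winding numbers are defined.\<close>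

definition pt :: "'v \<Rightarrow> complex" where
  "pt v = Complex (fst (pos v)) (snd (pos v))"

definition cv :: "'e \<Rightarrow> real \<Rightarrow> complex" where
  "cv e = (\<lambda>x. Complex (fst (curve e x)) (snd (curve e x)))"

lemma pt_eq_iff: "v \<in> verts G \<Longrightarrow> w \<in> verts G \<Longrightarrow> pt v = pt w \<longleftrightarrow> v = w"
  using drawing by (auto simp: plane_drawing_def pt_def inj_on_def prod_eq_iff)

lemma pt_unit_square: "v \<in> verts G \<Longrightarrow> pt v \<in> unit_square"
  using drawing by (auto simp: plane_drawing_def pt_def unit_square_def mem_Times_iff)

lemma arc_cv: "e \<in> arcs G \<Longrightarrow> Path_Connected.arc (cv e)"
  using drawing
  by (auto simp: plane_drawing_def Path_Connected.arc_def path_def cv_def inj_on_def prod_eq_iff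
      intro!: continuous_intros)

lemma pathstart_cv: "e \<in> arcs G \<Longrightarrow> pathstart (cv e) = pt (tail G e)"
  and pathfinish_cv: "e \<in> arcs G \<Longrightarrow> pathfinish (cv e) = pt (head G e)"
  using drawing by (auto simp: plane_drawing_def cv_def pt_def pathstart_def pathfinish_def)

lemma path_image_cv: "e \<in> arcs G \<Longrightarrow> path_image (cv e) \<subseteq> unit_square"
proof -
  assume "e \<in> arcs G"
  then have "path_image (curve e) \<subseteq> {0..1} \<times> {0..1}"
    using drawing by (simp add: plane_drawing_def)
  note sub = this
  have "cv e x \<in> unit_square" if "x \<in> {0..1}" for x
  proof -
    have "curve e x \<in> {0..1} \<times> {0..1}"
      using sub that unfolding path_image_def by blast
    then show ?thesis by (simp add: cv_def unit_square_def mem_Times_iff)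
  qed
  then show ?thesis
    unfolding path_image_def by (rule image_subsetI)
qed

lemma cv_vertex:
  assumes "e \<in> arcs G" "v \<in> verts G" "0 \<le> x" "x \<le> 1" "cv e x = pt v"
  shows "x = 0 \<and> v = tail G e \<or> x = 1 \<and> v = head G e"
proof -
  have c: "curve e x = pos v" using assms(5) by (auto simp: cv_def pt_def prod_eq_iff)
  have "x \<notin> {0<..<1}"
    using c assms drawing unfolding plane_drawing_def by (metis disjoint_iff imageI)
  then have "x = 0 \<or> x = 1" using assms by auto
  then show ?thesis
    using assms pathstart_cv[OF assms(1)] pathfinish_cv[OF assms(1)] pt_eq_iff
    by (auto simp: pathstart_def pathfinish_def)
qed

lemma cv_cv:
  assumes "e \<in> arcs G" "f \<in> arcs G" "e \<noteq> f" "0 \<le> x" "x \<le> 1" "cv e x \<in> path_image (cv f)"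
  shows "x = 0 \<and> tail G e \<in> {tail G f, head G f} \<or> x = 1 \<and> head G e \<in> {tail G f, head G f}"
proof -
  obtain y where y: "0 \<le> y" "y \<le> 1" "cv e x = cv f y" using assms by (auto simp: path_image_def)
  have c: "curve e x = curve f y" using y by (auto simp: cv_def prod_eq_iff)
  have nn: "\<not> (x \<in> {0<..<1} \<and> y \<in> {0<..<1})"
    using c assms drawing unfolding plane_drawing_def by (metis disjoint_iff imageI)
  show ?thesis
  proof (cases "y \<in> {0<..<1}")
    case True
    then have "x = 0 \<or> x = 1" using nn assms by auto
    then have "\<exists>v\<in>verts G. cv f y = pt v"
      using y(3) pathstart_cv[OF assms(1)] pathfinish_cv[OF assms(1)] head_in_verts[OF assms(1)]
        tail_in_verts[OF assms(1)]
      unfolding pathstart_def pathfinish_def by metis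
    then show ?thesis using cv_vertex[OF assms(2) _ y(1,2)] True by auto
  next
    case False
    then have "y = 0 \<or> y = 1" using y by auto
    then obtain v where v: "v \<in> {tail G f, head G f}" "cv e x = pt v"
      using y(3) pathstart_cv[OF assms(2)] pathfinish_cv[OF assms(2)]
      by (auto simp: pathstart_def pathfinish_def)
    then have "v \<in> verts G" using assms by auto
    then show ?thesis using cv_vertex[OF assms(1) _ assms(4,5) v(2)] v by auto
  qed
qed

text \<open>A single arc has its own clause: joining it to a constant path would destroy
  injectivity. The empty list does not know its vertex and gets a dummy value.\<close>

fun walk_curve :: "'e list \<Rightarrow> real \<Rightarrow> complex" where
  "walk_curve [] = (\<lambda>_. 0)"
| "walk_curve [e] = cv e"
| "walk_curve (e # f # p) = cv e +++ walk_curve (f # p)"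

text \<open>The sum formula for winding numbers is what later makes the effect of replacing a
  segment of a walk computable: all other arcs cancel.\<close>

lemma walk_curve_props:
  assumes "awalk u p v" "p \<noteq> []"
  shows "pathstart (walk_curve p) = pt u" "pathfinish (walk_curve p) = pt v"
    "path_image (walk_curve p) = (\<Union>e\<in>set p. path_image (cv e))" "Path_Connected.arc (walk_curve p)"
    "z \<notin> path_image (walk_curve p) \<Longrightarrow>
      winding_number (walk_curve p) z = (\<Sum>e\<leftarrow>p. winding_number (cv e) z)"
proof -
  have "pathstart (walk_curve p) = pt u \<and> pathfinish (walk_curve p) = pt v \<and>
    path_image (walk_curve p) = (\<Union>e\<in>set p. path_image (cv e)) \<and> Path_Connected.arc (walk_curve p) \<and>
    (z \<notin> path_image (walk_curve p) \<longrightarrow>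
      winding_number (walk_curve p) z = (\<Sum>e\<leftarrow>p. winding_number (cv e) z))"
    using assms
  proof (induction p arbitrary: u rule: walk_curve.induct)
    case (2 e)
    then show ?case
      by (auto simp: awalk_simps pathstart_cv pathfinish_cv arc_cv)
  next
    case (3 e f p)
    let ?q = "f # p"
    have e: "e \<in> arcs G" "tail G e = u" and q: "awalk (head G e) ?q v"
      using 3(2) by (auto simp: awalk_Cons_iff)
    have d: "distinct (awalk_verts u (e # ?q))" "distinct (e # ?q)"
      using awalk_distinct[OF 3(2)] by auto
    have IH: "pathstart (walk_curve ?q) = pt (head G e)" "pathfinish (walk_curve ?q) = pt v"
      "path_image (walk_curve ?q) = (\<Union>e\<in>set ?q. path_image (cv e))" "Path_Connected.arc (walk_curve ?q)"
      "z \<notin> path_image (walk_curve ?q) \<longrightarrow>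
        winding_number (walk_curve ?q) z = (\<Sum>e\<leftarrow>?q. winding_number (cv e) z)"
      using 3(1)[OF q] by auto
    have j: "pathfinish (cv e) = pathstart (walk_curve ?q)"
      using IH(1) pathfinish_cv[OF e(1)] by simp
    have "path_image (cv e) \<inter> path_image (walk_curve ?q) \<subseteq> {pathstart (walk_curve ?q)}"
    proof
      fix y assume y: "y \<in> path_image (cv e) \<inter> path_image (walk_curve ?q)"
      then obtain g where g: "g \<in> set ?q" "y \<in> path_image (cv g)" using IH(3) by auto
      obtain x where x: "0 \<le> x" "x \<le> 1" "y = cv e x" using y by (auto simp: path_image_def)
      have "g \<in> arcs G" "g \<noteq> e" using g awalk_arcs[OF q] d(2) by auto
      \<comment> \<open>The walk never returns to its first vertex, so the first arc can touch the
        rest only at its head, parameter 1.\<close>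
      moreover have "tail G e \<notin> {tail G g, head G g}"
        using awalk_arc_ends[OF q g(1)] d(1) by auto
      ultimately have "x = 1"
        using cv_cv[OF e(1), of g x] x g by auto
      then show "y \<in> {pathstart (walk_curve ?q)}"
        using x IH(1) pathfinish_cv[OF e(1)] by (simp add: pathfinish_def)
    qed
    then have a: "Path_Connected.arc (cv e +++ walk_curve ?q)"
      using arc_join[OF arc_cv[OF e(1)] IH(4) j] by simp
    have im: "path_image (cv e +++ walk_curve ?q) = path_image (cv e) \<union> path_image (walk_curve ?q)"
      by (rule path_image_join[OF j])
    have w: "winding_number (cv e +++ walk_curve ?q) z = winding_number (cv e) z + winding_number (walk_curve ?q) z"
      if "z \<notin> path_image (cv e +++ walk_curve ?q)"
      using that unfolding im
      by (intro winding_number_join j arc_imp_path arc_cv[OF e(1)] IH(4)) auto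
    show ?case
      unfolding walk_curve.simps
      using IH(2,3,5) e pathstart_cv[OF e(1)] a w by (simp add: im)
  qed simp
  then show "pathstart (walk_curve p) = pt u" "pathfinish (walk_curve p) = pt v"
    "path_image (walk_curve p) = (\<Union>e\<in>set p. path_image (cv e))" "Path_Connected.arc (walk_curve p)"
    "z \<notin> path_image (walk_curve p) \<Longrightarrow>
      winding_number (walk_curve p) z = (\<Sum>e\<leftarrow>p. winding_number (cv e) z)"
    by auto
qed

lemma path_image_walk_curve:
  assumes "awalk u p v" "p \<noteq> []"
  shows "path_image (walk_curve p) \<subseteq> unit_square"
  unfolding walk_curve_props(3)[OF assms]
  using path_image_cv awalk_arcs[OF assms(1)] by (intro UN_least) simp

lemma arc_on_walk_curve:
  assumes "awalk u p v" "p \<noteq> []" "e \<in> arcs G" "e \<notin> set p" "0 \<le> x" "x \<le> 1"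
    "cv e x \<in> path_image (walk_curve p)"
  shows "x = 0 \<and> tail G e \<in> set (awalk_verts u p) \<or> x = 1 \<and> head G e \<in> set (awalk_verts u p)"
proof -
  obtain g where g: "g \<in> set p" "cv e x \<in> path_image (cv g)"
    using assms(7) unfolding walk_curve_props(3)[OF assms(1,2)] by blast
  then have "g \<in> arcs G" "g \<noteq> e" using assms(4) awalk_arcs[OF assms(1)] by auto
  then have "x = 0 \<and> tail G e \<in> {tail G g, head G g} \<or> x = 1 \<and> head G e \<in> {tail G g, head G g}"
    using cv_cv[OF assms(3) _ _ assms(5,6) g(2)] by blast
  then show ?thesis
    using awalk_arc_ends[OF assms(1) g(1)] by auto
qed

lemma vertex_on_walk_curve:
  assumes "awalk u p v" "p \<noteq> []" "w \<in> verts G" "pt w \<in> path_image (walk_curve p)"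
  shows "w \<in> set (awalk_verts u p)"
proof -
  obtain g where g: "g \<in> set p" "pt w \<in> path_image (cv g)"
    using assms(4) unfolding walk_curve_props(3)[OF assms(1,2)] by blast
  then obtain x where "0 \<le> x" "x \<le> 1" "cv g x = pt w"
    by (auto simp: path_image_def)
  then have "w = tail G g \<or> w = head G g"
    using cv_vertex[OF awalk_arcs[OF assms(1) g(1)] assms(3)] by blast
  then show ?thesis using awalk_arc_ends[OF assms(1) g(1)] by auto
qed

section \<open>The two sides of a route\<close>

definition route :: "nat \<Rightarrow> 'e list \<Rightarrow> nat \<Rightarrow> bool" where
  "route i p j \<longleftrightarrow> i < n \<and> j < n \<and> awalk (s i) p (t j)"

text \<open>
  Arcs need their own notion: both ends of an arc off \<^term>\<open>p\<close> may lie on \<^term>\<open>p\<close>. Any interior point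
  of the curve would do as the test point.
\<close>

definition above_vertex :: "'e list \<Rightarrow> 'v \<Rightarrow> bool" where
  "above_vertex p v \<longleftrightarrow> above (walk_curve p) (pt v)"

definition above_arc :: "'e list \<Rightarrow> 'e \<Rightarrow> bool" where
  "above_arc p e \<longleftrightarrow> above (walk_curve p) (cv e (1/2))"

lemma pt_s: "i < n \<Longrightarrow> Re (pt (s i)) = 0" and pt_t: "i < n \<Longrightarrow> Re (pt (t i)) = 1"
  using boundary by (auto simp: boundary_order_def pt_def)

lemma s_ne_t: "i < n \<Longrightarrow> j < n \<Longrightarrow> s i \<noteq> t j"
  using pt_s pt_t by (metis zero_neq_one)

lemma Im_pt_s:
  assumes "i < n" "j < n"
  shows "Im (pt (s i)) < Im (pt (s j)) \<longleftrightarrow> j < i"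
proof -
  have "snd (pos (s b)) < snd (pos (s a))" if "a < n" "b < n" "a < b" for a b
    using boundary that unfolding boundary_order_def by blast
  from this[of i j] this[of j i] show ?thesis
    using assms by (cases i j rule: linorder_cases) (auto simp: pt_def)
qed

lemma Im_pt_t:
  assumes "i < n" "j < n"
  shows "Im (pt (t i)) < Im (pt (t j)) \<longleftrightarrow> j < i"
proof -
  have "snd (pos (t b)) < snd (pos (t a))" if "a < n" "b < n" "a < b" for a b
    using boundary that unfolding boundary_order_def by blast
  from this[of i j] this[of j i] show ?thesis
    using assms by (cases i j rule: linorder_cases) (auto simp: pt_def)
qed

lemma route_nonempty: "route i p j \<Longrightarrow> p \<noteq> []"
  using s_ne_t by (auto simp: route_def awalk_Nil_iff)

lemma route_crossing:
  assumes "route i p j"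
  shows "crossing (walk_curve p)"
proof -
  have p: "awalk (s i) p (t j)" "p \<noteq> []" "i < n" "j < n"
    using assms route_nonempty by (auto simp: route_def)
  then show ?thesis
    using walk_curve_props[OF p(1,2)] path_image_walk_curve[OF p(1,2)] pt_s pt_t
    by (auto simp: crossing_def)
qed

text \<open>The half of the arc from its tail to the test point misses the path even if the head
  lies on it, and on this connected set the side cannot change.\<close>

lemma above_arc_tail:
  assumes r: "route i p j" and e: "e \<in> arcs G" and v: "tail G e \<notin> set (awalk_verts (s i) p)"
  shows "above_arc p e \<longleftrightarrow> above_vertex p (tail G e)"
proof -
  have p: "awalk (s i) p (t j)" "p \<noteq> []"
    using r route_nonempty by (auto simp: route_def)
  have ep: "e \<notin> set p" using v awalk_arc_ends[OF p(1)] by auto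
  have "cv e x \<notin> path_image (walk_curve p)" if "x \<in> {0..1/2}" for x
    using arc_on_walk_curve[OF p e ep, of x] that v by auto
  moreover have "connected (cv e ` {0..1/2})"
    using arc_imp_path[OF arc_cv[OF e]]
    by (intro connected_continuous_image) (auto simp: path_def intro: continuous_on_subset)
  moreover have "cv e ` {0..1/2} \<subseteq> unit_square"
    using path_image_cv[OF e] by (force simp: path_image_def)
  ultimately have "above (walk_curve p) (cv e (1/2)) \<longleftrightarrow> above (walk_curve p) (cv e 0)"
    by (intro above_connected[OF route_crossing[OF r], of "cv e ` {0..1/2}"]) auto
  then show ?thesis
    using pathstart_cv[OF e] by (simp add: above_arc_def above_vertex_def pathstart_def)
qed

lemma above_arc_head:
  assumes r: "route i p j" and e: "e \<in> arcs G" and v: "head G e \<notin> set (awalk_verts (s i) p)"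
  shows "above_arc p e \<longleftrightarrow> above_vertex p (head G e)"
proof -
  have p: "awalk (s i) p (t j)" "p \<noteq> []"
    using r route_nonempty by (auto simp: route_def)
  have ep: "e \<notin> set p" using v awalk_arc_ends[OF p(1)] by auto
  have "cv e x \<notin> path_image (walk_curve p)" if "x \<in> {1/2..1}" for x
    using arc_on_walk_curve[OF p e ep, of x] that v by auto
  moreover have "connected (cv e ` {1/2..1})"
    using arc_imp_path[OF arc_cv[OF e]]
    by (intro connected_continuous_image) (auto simp: path_def intro: continuous_on_subset)
  moreover have "cv e ` {1/2..1} \<subseteq> unit_square"
    using path_image_cv[OF e] by (force simp: path_image_def)
  ultimately have "above (walk_curve p) (cv e (1/2)) \<longleftrightarrow> above (walk_curve p) (cv e 1)"
    by (intro above_connected[OF route_crossing[OF r], of "cv e ` {1/2..1}"]) auto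
  then show ?thesis
    using pathfinish_cv[OF e] by (simp add: above_arc_def above_vertex_def pathfinish_def)
qed

text \<open>Terminals are numbered from top to bottom, so a smaller index means a higher point on
  the side of the square.\<close>

lemma above_vertex_s:
  assumes r: "route i p j" and a: "a < n" "a \<noteq> i"
  shows "above_vertex p (s a) \<longleftrightarrow> a < i"
proof -
  have p: "awalk (s i) p (t j)" "p \<noteq> []" "i < n"
    using r route_nonempty by (auto simp: route_def)
  have "pt (s a) \<notin> path_image (walk_curve p)"
    using vertex_on_walk_curve[OF p(1,2) source_props(1)[OF a(1)]] source_on_awalk p a by blast
  then show ?thesis
    using above_side[OF route_crossing[OF r], of "pt (s a)"] pt_unit_square[OF source_props(1)[OF a(1)]]
      pt_s[OF a(1)] walk_curve_props(1)[OF p(1,2)] Im_pt_s[of i a] p a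
    by (simp add: above_vertex_def)
qed

lemma above_vertex_t:
  assumes r: "route i p j" and b: "b < n" "b \<noteq> j"
  shows "above_vertex p (t b) \<longleftrightarrow> b < j"
proof -
  have p: "awalk (s i) p (t j)" "p \<noteq> []" "j < n"
    using r route_nonempty by (auto simp: route_def)
  have "pt (t b) \<notin> path_image (walk_curve p)"
    using vertex_on_walk_curve[OF p(1,2) sink_props(1)[OF b(1)]] sink_on_awalk p b by blast
  then show ?thesis
    using above_side[OF route_crossing[OF r], of "pt (t b)"] pt_unit_square[OF sink_props(1)[OF b(1)]]
      pt_t[OF b(1)] walk_curve_props(2)[OF p(1,2)] Im_pt_t[of j b] p b
    by (simp add: above_vertex_def)
qed

text \<open>Each arc compares its two ends through its own test point, so a walk that misses
  \<open>p\<close> stays on one side of it.\<close>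

lemma above_walk:
  assumes r: "route i p j" and q: "awalk u q v"
    and disj: "set (awalk_verts u q) \<inter> set (awalk_verts (s i) p) = {}" and w: "w \<in> set (awalk_verts u q)"
  shows "above_vertex p w \<longleftrightarrow> above_vertex p u"
  using q disj w
proof (induction q arbitrary: u)
  case Nil
  then show ?case by (auto simp: awalk_Nil_iff)
next
  case (Cons e q)
  have e: "e \<in> arcs G" "tail G e = u" and q: "awalk (head G e) q v"
    using Cons.prems(1) by (auto simp: awalk_Cons_iff)
  have "u \<notin> set (awalk_verts (s i) p)" "head G e \<notin> set (awalk_verts (s i) p)"
    using Cons.prems(2) e(2) awalk_verts_ends(1)[OF q] by auto
  then have "above_vertex p (head G e) \<longleftrightarrow> above_vertex p u"
    using above_arc_tail[OF r e(1)] above_arc_head[OF r e(1)] e(2) by simp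
  then show ?case
    using Cons.IH[OF q] Cons.prems e(2) by (cases "w = u") auto
qed

text \<open>The tail of a shared arc would be a common vertex, hence \<open>x\<close> or
  \<open>y\<close>. It is not \<open>y\<close>, where \<open>p\<close> ends; and at \<open>x\<close>
  the shared arc would be the first arc of both segments.\<close>

lemma segment_edges_disjoint:
  assumes pw: "awalk x p y" "p \<noteq> []" and q: "awalk u (q1 @ q @ q2) v" and qw: "awalk x q y" "q \<noteq> []"
    and meet: "set (awalk_verts x p) \<inter> set (awalk_verts u (q1 @ q @ q2)) \<subseteq> {x, y}"
    and hd: "hd p \<noteq> hd q"
  shows "set p \<inter> set (q1 @ q @ q2) = {}"
proof (rule ccontr)
  assume "\<not> ?thesis"
  then obtain g where g: "g \<in> set p" "g \<in> set (q1 @ q @ q2)" by blast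
  have "tail G g \<in> {x, y}"
    using meet awalk_arc_ends(1)[OF pw(1) g(1)] awalk_arc_ends(1)[OF q g(2)] by blast
  moreover have "tail G g \<noteq> y"
  proof
    assume "tail G g = y"
    moreover obtain a b where "p = a @ g # b" using g(1) by (auto simp: in_set_conv_decomp)
    ultimately have "awalk y (g # b) y" using pw(1) by (auto simp: awalk_simps)
    then show False using closed_awalk_Nil by auto
  qed
  ultimately have g_x: "tail G g = x" by auto
  have "tail G (hd p) = x" "tail G (hd q) = x"
    using pw qw by (cases p; cases q; auto simp: awalk_simps)+
  then have "g = hd p" "g = hd q"
    using awalk_same_tail[OF pw(1) g(1), of "hd p"] awalk_same_tail[OF q g(2), of "hd q"] g_x pw(2) qw(2)
    by auto
  then show False using hd by simp
qed

text \<open>The two segments bound a lens. Detouring \<open>Q\<close> through \<open>p\<close> and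
  detouring \<open>P\<close> through \<open>q\<close> give the same simple closed curve with
  opposite orientations, and \<open>above_detour\<close> reads each side off the sign of the winding
  number.\<close>

lemma above_segment_dual:
  assumes rp: "route i (p1 @ p @ p2) j" and rq: "route i' (q1 @ q @ q2) j'"
    and pw: "awalk x p y" "p \<noteq> []" and qw: "awalk x q y" "q \<noteq> []"
    and meetp: "set (awalk_verts x p) \<inter> set (awalk_verts (s i') (q1 @ q @ q2)) \<subseteq> {x, y}"
    and meetq: "set (awalk_verts x q) \<inter> set (awalk_verts (s i) (p1 @ p @ p2)) \<subseteq> {x, y}"
    and hd: "hd p \<noteq> hd q" and e: "e \<in> set p" and f: "f \<in> set q"
  shows "above_arc (q1 @ q @ q2) e \<longleftrightarrow> \<not> above_arc (p1 @ p @ p2) f"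
proof -
  define P Q where "P = p1 @ p @ p2" and "Q = q1 @ q @ q2"
  \<comment> \<open>The routes with their middle segments exchanged are the detours to be compared
    with the original ones.\<close>
  define P' Q' where "P' = p1 @ q @ p2" and "Q' = q1 @ p @ q2"
  have aP: "awalk (s i) P (t j)" and aQ: "awalk (s i') Q (t j')"
    using rp rq by (auto simp: route_def P_def Q_def)
  have mids: "awalk (s i) p1 x" "awalk y p2 (t j)" "awalk (s i') q1 x" "awalk y q2 (t j')"
  proof -
    obtain a b where ab: "awalk (s i) p1 a" "awalk a p b" "awalk b p2 (t j)"
      using aP unfolding P_def by auto
    then show "awalk (s i) p1 x" "awalk y p2 (t j)"
      using awalk_ends[OF ab(2) pw(1)] pw(2) by auto
    obtain a b where ab: "awalk (s i') q1 a" "awalk a q b" "awalk b q2 (t j')"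
      using aQ unfolding Q_def by auto
    then show "awalk (s i') q1 x" "awalk y q2 (t j')"
      using awalk_ends[OF ab(2) qw(1)] qw(2) by auto
  qed
  have rP': "route i P' j" and rQ': "route i' Q' j'"
    using mids pw qw rp rq by (auto simp: route_def P'_def Q'_def)
  have rP: "route i P j" and rQ: "route i' Q j'" using rp rq by (auto simp: P_def Q_def)
  have dp: "set p \<inter> set Q = {}"
    using segment_edges_disjoint[OF pw, of "s i'" q1 q q2 "t j'"] aQ qw meetp hd by (simp add: Q_def)
  have dq: "set q \<inter> set P = {}"
    using segment_edges_disjoint[OF qw, of "s i" p1 p p2 "t j"] aP pw meetq hd by (simp add: P_def)
  note wp = walk_curve_props[OF pw] and wq = walk_curve_props[OF qw]
  have img: "path_image (walk_curve R) = (\<Union>e\<in>set R. path_image (cv e))" if "route a R b" for a R b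
    using walk_curve_props(3)[of "s a" R "t b"] route_nonempty[OF that] that by (simp add: route_def)
  have ends: "pathstart (walk_curve R) = pt (s a)" "pathfinish (walk_curve R) = pt (t b)" if "route a R b" for a R b
    using walk_curve_props(1,2)[of "s a" R "t b"] route_nonempty[OF that] that by (simp_all add: route_def)
  have wn: "winding_number (walk_curve R) z = (\<Sum>e\<leftarrow>R. winding_number (cv e) z)"
    if "route a R b" "z \<notin> path_image (walk_curve R)" for a R b z
    using walk_curve_props(5)[of "s a" R "t b"] route_nonempty[OF that(1)] that by (simp add: route_def)
  have meet: "path_image (walk_curve p) \<inter> path_image (walk_curve q) \<subseteq> {pt x, pt y}"
  proof
    fix z assume z: "z \<in> path_image (walk_curve p) \<inter> path_image (walk_curve q)"
    then obtain g r where g: "g \<in> set p" "z = cv g r" "0 \<le> r" "r \<le> 1"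
      using wp(3) by (auto simp: path_image_def)
    have gG: "g \<in> arcs G" "g \<notin> set q" using g awalk_arcs[OF pw(1)] dp by (auto simp: Q_def)
    have Vq: "set (awalk_verts x q) \<subseteq> set (awalk_verts (s i') (q1 @ q @ q2))"
      using aQ mids(3,4) qw(1) unfolding Q_def by (auto simp: set_awalk_verts_append)
    have "r = 0 \<and> tail G g \<in> set (awalk_verts x q) \<or> r = 1 \<and> head G g \<in> set (awalk_verts x q)"
      using arc_on_walk_curve[OF qw gG g(3,4)] g z by auto
    then have "r = 0 \<and> tail G g \<in> {x, y} \<or> r = 1 \<and> head G g \<in> {x, y}"
      using awalk_arc_ends[OF pw(1) g(1)] meetp Vq by blast
    then show "z \<in> {pt x, pt y}"
      using g pathstart_cv[OF gG(1)] pathfinish_cv[OF gG(1)] by (auto simp: pathstart_def pathfinish_def)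
  qed
  have eP: "cv e (1/2) \<in> path_image (walk_curve p)" and fQ: "cv f (1/2) \<in> path_image (walk_curve q)"
  proof -
    have "1/2 \<in> {0..1::real}" by simp
    then show "cv e (1/2) \<in> path_image (walk_curve p)" "cv f (1/2) \<in> path_image (walk_curve q)"
      unfolding wp(3) wq(3) unfolding path_image_def using e f by blast+
  qed
  have eG: "e \<in> arcs G" "e \<notin> set Q" and fG: "f \<in> arcs G" "f \<notin> set P"
    using e f awalk_arcs[OF pw(1)] awalk_arcs[OF qw(1)] dp dq by auto
  have eQ: "cv e (1/2) \<notin> path_image (walk_curve Q)"
    using arc_on_walk_curve[OF aQ route_nonempty[OF rQ] eG, of "1/2"] by auto
  have fP: "cv f (1/2) \<notin> path_image (walk_curve P)"
    using arc_on_walk_curve[OF aP route_nonempty[OF rP] fG, of "1/2"] by auto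
  define K where "K = walk_curve q +++ reversepath (walk_curve p)"
  have K: "simple_path K" "pathfinish K = pathstart K"
    "path_image K = path_image (walk_curve q) \<union> path_image (walk_curve p)"
    unfolding K_def using wp wq meet
    by (auto intro!: simple_path_join_loop arc_reversepath simp: path_image_join)
  \<comment> \<open>The same reference point inside the lens serves both detours, so the two signs
    can be compared.\<close>
  obtain z where z: "z \<in> inside (path_image (walk_curve q) \<union> path_image (walk_curve p))"
    using Jordan_inside_outside[OF K(1,2)] unfolding K(3) by blast
  have "above (walk_curve Q) (cv e (1/2)) \<longleftrightarrow>
      winding_number (walk_curve q) z - winding_number (walk_curve p) z = 1"
  proof (rule above_detour(1)[OF route_crossing[OF rQ] route_crossing[OF rQ'], of "walk_curve p" "walk_curve q"])
    show "winding_number (walk_curve Q) z - winding_number (walk_curve Q') z =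
        winding_number (walk_curve q) z - winding_number (walk_curve p) z"
      if "z \<notin> path_image (walk_curve Q) \<union> path_image (walk_curve p)" for z
    proof -
      have "z \<notin> path_image (walk_curve Q')" "z \<notin> path_image (walk_curve q)"
        using that unfolding img[OF rQ'] img[OF rQ] wp(3) wq(3) by (auto simp: Q_def Q'_def)
      then show ?thesis
        using that wn[OF rQ, of z] wn[OF rQ', of z] wp(5)[of z] wq(5)[of z] by (simp add: Q_def Q'_def)
    qed
    show "path_image (walk_curve q) \<subseteq> path_image (walk_curve Q)"
      "path_image (walk_curve Q') \<subseteq> path_image (walk_curve Q) \<union> path_image (walk_curve p)"
      unfolding img[OF rQ'] img[OF rQ] wp(3) wq(3) by (auto simp: Q_def Q'_def)
    show "path_image (walk_curve p) \<inter> path_image (walk_curve q)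
        \<subseteq> {pathstart (walk_curve q), pathfinish (walk_curve q)}"
      using meet wq(1,2) by simp
  qed (use ends[OF rQ] ends[OF rQ'] wp(1,2,4) wq(1,2,4) eP eQ z path_image_walk_curve[OF pw] in simp_all)
  moreover have "\<not> above (walk_curve P) (cv f (1/2)) \<longleftrightarrow>
      winding_number (walk_curve p) z - winding_number (walk_curve q) z = -1"
  proof (rule above_detour(2)[OF route_crossing[OF rP] route_crossing[OF rP'], of "walk_curve q" "walk_curve p"])
    show "winding_number (walk_curve P) z - winding_number (walk_curve P') z =
        winding_number (walk_curve p) z - winding_number (walk_curve q) z"
      if "z \<notin> path_image (walk_curve P) \<union> path_image (walk_curve q)" for z
    proof -
      have "z \<notin> path_image (walk_curve P')" "z \<notin> path_image (walk_curve p)"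
        using that unfolding img[OF rP'] img[OF rP] wp(3) wq(3) by (auto simp: P_def P'_def)
      then show ?thesis
        using that wn[OF rP, of z] wn[OF rP', of z] wp(5)[of z] wq(5)[of z] by (simp add: P_def P'_def)
    qed
    show "path_image (walk_curve p) \<subseteq> path_image (walk_curve P)"
      "path_image (walk_curve P') \<subseteq> path_image (walk_curve P) \<union> path_image (walk_curve q)"
      unfolding img[OF rP'] img[OF rP] wp(3) wq(3) by (auto simp: P_def P'_def)
    show "path_image (walk_curve q) \<inter> path_image (walk_curve p)
        \<subseteq> {pathstart (walk_curve p), pathfinish (walk_curve p)}"
      using meet wp(1,2) by (simp add: Int_commute)
    show "z \<in> inside (path_image (walk_curve p) \<union> path_image (walk_curve q))"
      using z by (simp add: Un_commute)
  qed (use ends[OF rP] ends[OF rP'] wp(1,2,4) wq(1,2,4) fP fQ path_image_walk_curve[OF qw] in simp_all)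
  moreover have "a - b = 1 \<longleftrightarrow> b - a = -1" for a b :: complex
    by (metis minus_diff_eq neg_equal_iff_equal)
  ultimately show ?thesis
    unfolding above_arc_def P_def[symmetric] Q_def[symmetric] by blast
qed


text \<open>Either the remainder of \<open>p\<close> after the common tail never meets
  \<open>q\<close> again: then each remainder stays on one side of the other route up to its sink,
  and the order of the two sinks decides. Or the routes meet again, and up to the next meeting point
  they bound a lens.\<close>

lemma above_dual_tail:
  assumes rp: "route i p j" and rq: "route i' q j'" and e: "e \<in> set p" and f: "f \<in> set q"
    and ef: "tail G e = tail G f" "e \<noteq> f"
  shows "above_arc q e \<longleftrightarrow> \<not> above_arc p f"
proof -
  define v where "v = tail G e"
  have ap: "awalk (s i) p (t j)" and aq: "awalk (s i') q (t j')" and lt: "j < n" "j' < n"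
    using rp rq by (auto simp: route_def)
  obtain p1 p2 where p: "p = p1 @ e # p2" using e by (auto simp: in_set_conv_decomp)
  obtain q1 q2 where q: "q = q1 @ f # q2" using f by (auto simp: in_set_conv_decomp)
  have p1: "awalk (s i) p1 v" and p2: "awalk v (e # p2) (t j)" "awalk (head G e) p2 (t j)"
    using ap by (auto simp: p v_def awalk_simps)
  have q1: "awalk (s i') q1 v" and q2: "awalk v (f # q2) (t j')" "awalk (head G f) q2 (t j')"
    using aq ef(1) by (auto simp: q v_def awalk_simps)
  have Vp: "set (awalk_verts (s i) p) = set (awalk_verts (s i) p1) \<union> set (awalk_verts (head G e) p2)"
    using set_awalk_verts_append[OF p1 p2(1)] awalk_verts_ends(2)[OF p1] unfolding p v_def by auto
  have Vq: "set (awalk_verts (s i') q) = set (awalk_verts (s i') q1) \<union> set (awalk_verts (head G f) q2)"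
    using set_awalk_verts_append[OF q1 q2(1)] awalk_verts_ends(2)[OF q1] ef(1) unfolding q v_def by auto
  have eG: "e \<in> arcs G" "f \<in> arcs G" using awalk_arcs ap aq e f by blast+
  have after_p: "\<exists>r. awalk v r w \<and> r \<noteq> []" if "w \<in> set (awalk_verts (head G e) p2)" for w
  proof -
    obtain r where "awalk (head G e) r w" using awalk_decomp[OF p2(2)] \<open>w \<in> _\<close> by blast
    then have "awalk v (e # r) w" using p2(1) by (simp add: awalk_Cons_iff)
    then show ?thesis by blast
  qed
  have after_q: "\<exists>r. awalk v r w \<and> r \<noteq> []" if "w \<in> set (awalk_verts (head G f) q2)" for w
  proof -
    obtain r where "awalk (head G f) r w" using awalk_decomp[OF q2(2)] \<open>w \<in> _\<close> by blast
    then have "awalk v (f # r) w" using q2(1) by (simp add: awalk_Cons_iff)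
    then show ?thesis by blast
  qed
  have before_p: "\<exists>r. awalk w r v" if "w \<in> set (awalk_verts (s i) p1)" for w
    using awalk_decomp[OF p1 that] by blast
  have before_q: "\<exists>r. awalk w r v" if "w \<in> set (awalk_verts (s i') q1)" for w
    using awalk_decomp[OF q1 that] by blast
  have no_loop: False if "awalk v r w" "r \<noteq> []" "awalk w r' v" for r r' w
  proof -
    have "awalk v (r @ r') v" using that by auto
    then show False using closed_awalk_Nil that(2) by blast
  qed
  show ?thesis
  proof (cases "set (awalk_verts (head G e) p2) \<inter> set (awalk_verts (s i') q) = {}")
    case True
    have disj: "set (awalk_verts (head G f) q2) \<inter> set (awalk_verts (s i) p) = {}"
      using True before_p after_q no_loop unfolding Vp Vq by blast
    have "above_arc q e \<longleftrightarrow> above_vertex q (t j)"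
      using above_arc_head[OF rq eG(1)] above_walk[OF rq p2(2) True] awalk_verts_ends[OF p2(2)] True
      by blast
    moreover have "above_arc p f \<longleftrightarrow> above_vertex p (t j')"
      using above_arc_head[OF rp eG(2)] above_walk[OF rp q2(2) disj] awalk_verts_ends[OF q2(2)] disj
      by blast
    moreover have "j \<noteq> j'"
      using True awalk_verts_ends(2)[OF p2(2)] awalk_verts_ends(2)[OF aq] by blast
    ultimately show ?thesis
      using above_vertex_t[OF rq, of j] above_vertex_t[OF rp, of j'] lt by auto
  next
    case False
    \<comment> \<open>\<open>w\<close> is the first vertex of \<open>p\<close> after
      \<open>v\<close> that lies on \<open>q\<close>.\<close>
    then obtain xs w ys where split: "awalk_verts (head G e) p2 = xs @ w # ys"
      "w \<in> set (awalk_verts (s i') q)" "\<forall>x\<in>set xs. x \<notin> set (awalk_verts (s i') q)"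
      using split_list_first_prop[of "awalk_verts (head G e) p2" "\<lambda>w. w \<in> set (awalk_verts (s i') q)"]
      by blast
    obtain a b where ab: "cas (head G e) a w" "cas w b (t j)" "p2 = a @ b"
        "awalk_verts (head G e) a = xs @ [w]" "awalk_verts w b = w # ys"
      using awalk_decomp_verts[OF _ split(1), of "t j"] p2(2) by auto
    have wG: "w \<in> verts G" using split(2) awalk_verts_in_verts[OF _ _ split(2)] aq by auto
    have pp: "awalk v (e # a) w" and b: "awalk w b (t j)"
      using ab p2(1) wG by (auto simp: awalk_def)
    \<comment> \<open>On \<open>q\<close>, too, \<open>w\<close> comes after \<open>v\<close>;
      otherwise \<open>q\<close> would lead from \<open>w\<close> back to \<open>v\<close>, closing
      a cycle.\<close>
    have w: "w \<in> set (awalk_verts (head G f) q2)"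
      using split(2) no_loop[OF pp] before_q unfolding Vq by blast
    then obtain c d where cd: "q2 = c @ d" "awalk (head G f) c w" "awalk w d (t j')"
      using awalk_decomp[OF q2(2)] by blast
    have qq: "awalk v (f # c) w"
      using cd(2) q2(1) by (auto simp: awalk_Cons_iff)
    have pe: "p = p1 @ (e # a) @ b" and qe: "q = q1 @ (f # c) @ d" using p q ab cd by auto
    have Vpp: "set (awalk_verts v (e # a)) = insert v (set xs \<union> {w})"
      using ab(4) v_def by auto
    have Vqq: "set (awalk_verts v (f # c)) \<subseteq> insert v (set (awalk_verts (head G f) q2))"
      using set_awalk_verts_append[OF cd(2,3)] ef(1) unfolding v_def cd(1) by auto
    have Vpb: "set (awalk_verts (head G e) p2) = set xs \<union> {w} \<union> set (awalk_verts w b)"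
      using split(1) ab(5) by auto
    show ?thesis
      unfolding pe qe
    proof (rule above_segment_dual[where x=v and y=w])
      show "route i (p1 @ (e # a) @ b) j" "route i' (q1 @ (f # c) @ d) j'"
        using rp rq pe qe by simp_all
      show "set (awalk_verts v (e # a)) \<inter> set (awalk_verts (s i') (q1 @ (f # c) @ d)) \<subseteq> {v, w}"
        using split(3) unfolding Vpp qe[symmetric] by blast
      \<comment> \<open>A further common vertex \<open>u\<close> on the segment of \<open>q\<close>
        lies on \<open>p\<close> only beyond \<open>w\<close>, by the choice of \<open>w\<close>.
        Then \<open>p\<close> leads from \<open>w\<close> to \<open>u\<close> and \<open>q\<close>
        from \<open>u\<close> to \<open>w\<close>, so \<open>u = w\<close>.\<close>
      show "set (awalk_verts v (f # c)) \<inter> set (awalk_verts (s i) (p1 @ (e # a) @ b)) \<subseteq> {v, w}"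
      proof
        fix u assume u: "u \<in> set (awalk_verts v (f # c)) \<inter> set (awalk_verts (s i) (p1 @ (e # a) @ b))"
        show "u \<in> {v, w}"
        proof (rule ccontr)
          assume nu: "u \<notin> {v, w}"
          have uq: "u \<in> set (awalk_verts (head G f) q2)" using u Vqq nu by blast
          have "u \<notin> set (awalk_verts (s i) p1)"
            using before_p after_q[OF uq] no_loop by blast
          then have "u \<in> set (awalk_verts (head G e) p2)"
            using u unfolding pe[symmetric] Vp by blast
          moreover have "u \<notin> set xs" using split(3) uq unfolding Vq by blast
          ultimately have "u \<in> set (awalk_verts w b)" using nu unfolding Vpb by blast
          then obtain r where "awalk w r u" using awalk_decomp[OF b] by blast
          moreover obtain r' where "awalk u r' w" using awalk_decomp[OF qq] u by blast
          ultimately show False using awalk_antisym nu by blast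
        qed
      qed
    qed (use pp qq ef in auto)
  qed
qed

text \<open>The mirror image for entering arcs: either the initial parts are disjoint and the order
  of the sources decides, or \<open>w\<close> is the last vertex of \<open>p\<close> before
  \<open>v\<close> on \<open>q\<close> and starts a lens that ends at \<open>v\<close>.\<close>

lemma above_dual_head:
  assumes rp: "route i p j" and rq: "route i' q j'" and e: "e \<in> set p" and f: "f \<in> set q"
    and ef: "head G e = head G f" "e \<noteq> f"
  shows "above_arc q e \<longleftrightarrow> \<not> above_arc p f"
proof -
  define v where "v = head G e"
  have ap: "awalk (s i) p (t j)" and aq: "awalk (s i') q (t j')" and lt: "i < n" "i' < n"
    using rp rq by (auto simp: route_def)
  obtain p1 p2 where p: "p = p1 @ e # p2" using e by (auto simp: in_set_conv_decomp)
  obtain q1 q2 where q: "q = q1 @ f # q2" using f by (auto simp: in_set_conv_decomp)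
  have p1: "awalk (s i) (p1 @ [e]) v" "awalk (s i) p1 (tail G e)" and p2: "awalk v p2 (t j)"
    using ap by (auto simp: p v_def awalk_simps)
  have q1: "awalk (s i') (q1 @ [f]) v" "awalk (s i') q1 (tail G f)" and q2: "awalk v q2 (t j')"
    using aq ef(1) by (auto simp: q v_def awalk_simps)
  have ep2: "awalk (tail G e) (e # p2) (t j)" and fq2: "awalk (tail G f) (f # q2) (t j')"
    using ap aq by (auto simp: p q awalk_simps)
  have Vp: "set (awalk_verts (s i) p) = set (awalk_verts (s i) p1) \<union> set (awalk_verts v p2)"
    using set_awalk_verts_append[OF p1(2) ep2] awalk_verts_ends(2)[OF p1(2)] unfolding p v_def by auto
  have Vq: "set (awalk_verts (s i') q) = set (awalk_verts (s i') q1) \<union> set (awalk_verts v q2)"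
    using set_awalk_verts_append[OF q1(2) fq2] awalk_verts_ends(2)[OF q1(2)] unfolding q v_def ef(1) by auto
  have eG: "e \<in> arcs G" "f \<in> arcs G" using awalk_arcs ap aq e f by blast+
  have before_p: "\<exists>r. awalk w r v \<and> r \<noteq> []" if "w \<in> set (awalk_verts (s i) p1)" for w
  proof -
    obtain r where "awalk w r (tail G e)" using awalk_decomp[OF p1(2)] \<open>w \<in> _\<close> by blast
    then have "awalk w (r @ [e]) v" using eG(1) v_def by (auto simp: awalk_simps)
    then show ?thesis by blast
  qed
  have before_q: "\<exists>r. awalk w r v \<and> r \<noteq> []" if "w \<in> set (awalk_verts (s i') q1)" for w
  proof -
    obtain r where "awalk w r (tail G f)" using awalk_decomp[OF q1(2)] \<open>w \<in> _\<close> by blast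
    then have "awalk w (r @ [f]) v" using eG(2) v_def ef(1) by (auto simp: awalk_simps)
    then show ?thesis by blast
  qed
  have after_p: "\<exists>r. awalk v r w" if "w \<in> set (awalk_verts v p2)" for w
    using awalk_decomp[OF p2 that] by blast
  have after_q: "\<exists>r. awalk v r w" if "w \<in> set (awalk_verts v q2)" for w
    using awalk_decomp[OF q2 that] by blast
  have no_loop: False if "awalk w r v" "r \<noteq> []" "awalk v r' w" for r r' w
  proof -
    have "awalk w (r @ r') w" using that by auto
    then show False using closed_awalk_Nil that(2) by blast
  qed
  show ?thesis
  proof (cases "set (awalk_verts (s i) p1) \<inter> set (awalk_verts (s i') q) = {}")
    case True
    have disj: "set (awalk_verts (s i') q1) \<inter> set (awalk_verts (s i) p) = {}"
      using True after_p before_q no_loop unfolding Vp Vq by blast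
    have "above_arc q e \<longleftrightarrow> above_vertex q (s i)"
      using above_arc_tail[OF rq eG(1)] above_walk[OF rq p1(2) True] awalk_verts_ends[OF p1(2)] True
      by blast
    moreover have "above_arc p f \<longleftrightarrow> above_vertex p (s i')"
      using above_arc_tail[OF rp eG(2)] above_walk[OF rp q1(2) disj] awalk_verts_ends[OF q1(2)] disj
      by blast
    moreover have "i \<noteq> i'"
      using True awalk_verts_ends(1)[OF p1(2)] awalk_verts_ends(1)[OF aq] by blast
    ultimately show ?thesis
      using above_vertex_s[OF rq, of i] above_vertex_s[OF rp, of i'] lt by auto
  next
    case False
    then obtain xs w ys where split: "awalk_verts (s i) p1 = xs @ w # ys"
      "w \<in> set (awalk_verts (s i') q)" "\<forall>x\<in>set ys. x \<notin> set (awalk_verts (s i') q)"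
      using split_list_last_prop[of "awalk_verts (s i) p1" "\<lambda>w. w \<in> set (awalk_verts (s i') q)"]
      by blast
    obtain b a where ab: "cas (s i) b w" "cas w a (tail G e)" "p1 = b @ a"
        "awalk_verts (s i) b = xs @ [w]" "awalk_verts w a = w # ys"
      using awalk_decomp_verts[OF _ split(1), of "tail G e"] p1(2) by auto
    have wG: "w \<in> verts G" using split(2) awalk_verts_in_verts[OF _ _ split(2)] aq by auto
    have a: "awalk w a (tail G e)" and b: "awalk (s i) b w"
      using ab p1(2) wG by (auto simp: awalk_def)
    have pp: "awalk w (a @ [e]) v" using a eG(1) v_def by (auto simp: awalk_simps)
    have w: "w \<in> set (awalk_verts (s i') q1)"
      using split(2) no_loop[OF pp] after_q unfolding Vq by blast
    then obtain d c where cd: "q1 = d @ c" "awalk (s i') d w" "awalk w c (tail G f)"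
      using awalk_decomp[OF q1(2)] by blast
    have qq: "awalk w (c @ [f]) v"
      using cd(3) eG(2) v_def ef(1) by (auto simp: awalk_simps)
    have pe: "p = b @ (a @ [e]) @ p2" and qe: "q = d @ (c @ [f]) @ q2" using p q ab cd by auto
    have Vpp: "set (awalk_verts w (a @ [e])) = insert v (set ys \<union> {w})"
      using set_awalk_verts_append[OF a, of "[e]" v] ab(5) eG(1) awalk_verts_ends(2)[OF a]
      by (auto simp: v_def awalk_simps)
    have Vqq: "set (awalk_verts w (c @ [f])) \<subseteq> insert v (set (awalk_verts (s i') q1))"
      using set_awalk_verts_append[OF cd(3), of "[f]" v] set_awalk_verts_append[OF cd(2,3)]
        eG(2) ef(1) awalk_verts_ends(2)[OF q1(2)] unfolding cd(1) by (auto simp: v_def awalk_simps)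
    have Vpb: "set (awalk_verts (s i) p1) = set ys \<union> {w} \<union> set (awalk_verts (s i) b)"
      using split(1) ab(4) by auto
    \<comment> \<open>Here \<open>e\<close> and \<open>f\<close> are the last arcs of the segments.
      A common first arc would have a head on both routes beyond \<open>w\<close>, hence equal to
      \<open>v\<close>; it would then be both \<open>e\<close> and \<open>f\<close>.\<close>
    have hd: "hd (a @ [e]) \<noteq> hd (c @ [f])"
    proof
      assume h: "hd (a @ [e]) = hd (c @ [f])"
      have hp: "hd (a @ [e]) \<in> set (a @ [e])" and hq: "hd (c @ [f]) \<in> set (c @ [f])" 
        by (rule hd_in_set, simp)+
      have "head G (hd (a @ [e])) \<in> set (awalk_verts (s i') q)"
        using awalk_arc_ends(2)[OF aq, of "hd (c @ [f])"] hq qe h by auto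
      moreover have "head G (hd (a @ [e])) \<in> insert v (set ys)"
      proof (cases a)
        case (Cons g a')
        have "awalk (head G g) a' (tail G e)" using a Cons by (auto simp: awalk_Cons_iff)
        then show ?thesis
          using ab(5) awalk_verts_ends(1)[of "head G g" a'] Cons by auto
      qed (simp add: v_def)
      ultimately have "head G (hd (a @ [e])) = v" using split(3) by blast
      then have "hd (a @ [e]) = e" "hd (c @ [f]) = f"
        using awalk_same_head[OF pp hp, of e] awalk_same_head[OF qq hq, of f] h v_def ef by auto
      then show False using h ef by simp
    qed
    show ?thesis
      unfolding pe qe
    proof (rule above_segment_dual[where x=w and y=v])
      show "route i (b @ (a @ [e]) @ p2) j" "route i' (d @ (c @ [f]) @ q2) j'"
        using rp rq pe qe by simp_all
      show "set (awalk_verts w (a @ [e])) \<inter> set (awalk_verts (s i') (d @ (c @ [f]) @ q2)) \<subseteq> {w, v}"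
        using split(3) unfolding Vpp qe[symmetric] by blast
      show "set (awalk_verts w (c @ [f])) \<inter> set (awalk_verts (s i) (b @ (a @ [e]) @ p2)) \<subseteq> {w, v}"
      proof
        fix u assume u: "u \<in> set (awalk_verts w (c @ [f])) \<inter> set (awalk_verts (s i) (b @ (a @ [e]) @ p2))"
        show "u \<in> {w, v}"
        proof (rule ccontr)
          assume nu: "u \<notin> {w, v}"
          have uq: "u \<in> set (awalk_verts (s i') q1)" using u Vqq nu by blast
          have "u \<notin> set (awalk_verts v p2)"
            using after_p before_q[OF uq] no_loop by blast
          then have "u \<in> set (awalk_verts (s i) p1)"
            using u unfolding pe[symmetric] Vp by blast
          moreover have "u \<notin> set ys" using split(3) uq unfolding Vq by blast
          ultimately have "u \<in> set (awalk_verts (s i) b)" using nu unfolding Vpb by blast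
          then obtain r where "awalk u r w" using awalk_decomp[OF b] by blast
          moreover obtain r' where "awalk w r' u" using awalk_decomp[OF qq] u by blast
          ultimately show False using awalk_antisym nu by blast
        qed
      qed
    qed (use pp qq hd in auto)
  qed
qed

text \<open>All of \<open>q\<close> lies on one side of \<open>p\<close>. Testing this at the source
  and at the sink of \<open>q\<close> gives two answers that must agree, so disjoint routes keep
  their order.\<close>

lemma disjoint_routes_above:
  assumes "route i p j" "route i' q j'"
    and "set (awalk_verts (s i) p) \<inter> set (awalk_verts (s i') q) = {}" and "v \<in> set (awalk_verts (s i') q)"
  shows "above_vertex p v \<longleftrightarrow> i' < i" "above_vertex p v \<longleftrightarrow> j' < j"
proof -
  have q: "awalk (s i') q (t j')" and p: "awalk (s i) p (t j)" and lt: "i' < n" "j' < n"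
    using assms by (auto simp: route_def)
  have "i' \<noteq> i" "j' \<noteq> j"
    using assms(3) awalk_verts_ends[OF p] awalk_verts_ends[OF q] by auto
  then show "above_vertex p v \<longleftrightarrow> i' < i" "above_vertex p v \<longleftrightarrow> j' < j"
    using above_vertex_s[OF assms(1) lt(1)] above_vertex_t[OF assms(1) lt(2)]
      above_walk[OF assms(1) q _ assms(4)] above_walk[OF assms(1) q _ awalk_verts_ends(2)[OF q]] assms(3)
    by auto
qed

end

section \<open>Flows and vertex-disjoint path families\<close>

text \<open>The symmetric difference of three sets, their sum over the two-element field, with
  membership in an odd number of them written through equality of truth values.\<close>

definition xor3 :: "'a set \<Rightarrow> 'a set \<Rightarrow> 'a set \<Rightarrow> 'a set" where
  "xor3 A B C = {x. (x \<in> A) = ((x \<in> B) = (x \<in> C))}"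

lemma xor3_cancel: "xor3 (xor3 A B C) B C = A"
  by (auto simp: xor3_def)

text \<open>On \<open>M\<close> all six sets agree. On the rest of \<open>U\<close> the primed sets
  are complements, and complementing all three inputs complements their parity.\<close>

lemma xor3_union_inter:
  assumes "A \<union> A' = U" "B \<union> B' = U" "C \<union> C' = U" "A \<inter> A' = M" "B \<inter> B' = M" "C \<inter> C' = M"
  shows "xor3 A B C \<union> xor3 A' B' C' = U" "xor3 A B C \<inter> xor3 A' B' C' = M"
  using assms unfolding xor3_def set_eq_iff Un_iff Int_iff mem_Collect_eq by blast+

context
  fixes h :: "'a \<Rightarrow> 'b" and U M :: "'a set"
begin

text \<open>\<open>h\<close> stands for \<open>tail G\<close> or \<open>head G\<close>, and
  \<open>A\<close>, \<open>A'\<close> for the two flows of a pair; \<open>U\<close> and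
  \<open>M\<close> are the data fixed by the monomial.\<close>

definition splits :: "'a set \<Rightarrow> 'a set \<Rightarrow> bool" where
  "splits A A' \<longleftrightarrow> inj_on h A \<and> inj_on h A' \<and> A \<union> A' = U \<and> A \<inter> A' = M"

lemma splits_lone:
  assumes "splits A A'" "e \<in> U" "\<And>e'. e' \<in> U \<Longrightarrow> h e' = h e \<Longrightarrow> e' = e"
  shows "h e \<in> h ` A \<longleftrightarrow> e \<in> A"
proof
  assume "h e \<in> h ` A"
  then obtain e' where "e' \<in> A" "h e' = h e" by (metis imageE)
  moreover from this have "e' = e" using assms by (auto simp: splits_def)
  ultimately show "e \<in> A" by simp
qed auto

text \<open>Neither part contains both arcs, yet each arc lies in some part, so the parts take one
  each. This is the parity condition that \<open>xor3\<close> preserves.\<close>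

lemma splits_pair:
  assumes "splits A A'" "e \<in> U" "e' \<in> U" "h e' = h e" "e' \<noteq> e"
  shows "e \<in> A \<longleftrightarrow> e' \<notin> A" "h e \<in> h ` A"
proof -
  have "\<not> (e \<in> A \<and> e' \<in> A)" "\<not> (e \<in> A' \<and> e' \<in> A')"
    using assms by (auto simp: splits_def inj_on_def)
  moreover have "e \<in> A \<or> e \<in> A'" "e' \<in> A \<or> e' \<in> A'"
    using assms by (auto simp: splits_def)
  ultimately show "e \<in> A \<longleftrightarrow> e' \<notin> A" "h e \<in> h ` A"
    using assms(4) by (auto, metis imageI)
qed

text \<open>At a vertex with a single arc of \<open>U\<close>, being covered is the same as
  containing that arc. At a vertex with two, every part covers it by exactly one of them, and so
  does the sum of three.\<close>

lemma splits_xor3: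
  assumes A: "splits A A'" and B: "splits B B'" and C: "splits C C'"
  shows "inj_on h (xor3 A B C)" "h ` xor3 A B C = xor3 (h ` A) (h ` B) (h ` C)"
proof -
  have U: "x \<in> U" if "x \<in> xor3 A B C" for x
  proof -
    have "x \<in> A \<or> x \<in> B \<or> x \<in> C" using that by (auto simp: xor3_def)
    then show ?thesis using assms unfolding splits_def by blast
  qed
  show "inj_on h (xor3 A B C)"
  proof (rule inj_onI, rule ccontr)
    fix e e' assume e: "e \<in> xor3 A B C" "e' \<in> xor3 A B C" "h e = h e'" "e \<noteq> e'"
    show False
      using splits_pair(1)[OF A U[OF e(1)] U[OF e(2)]] splits_pair(1)[OF B U[OF e(1)] U[OF e(2)]]
        splits_pair(1)[OF C U[OF e(1)] U[OF e(2)]] e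
      by (auto simp: xor3_def)
  qed
  have key: "h e \<in> h ` xor3 A B C \<longleftrightarrow> h e \<in> xor3 (h ` A) (h ` B) (h ` C)" if e: "e \<in> U" for e
  proof (cases "\<exists>e'\<in>U. h e' = h e \<and> e' \<noteq> e")
    case True
    then obtain e' where e': "e' \<in> U" "h e' = h e" "e' \<noteq> e" by blast
    note s = splits_pair[OF _ e e']
    have "e \<in> xor3 A B C \<or> e' \<in> xor3 A B C"
      using s(1)[OF A] s(1)[OF B] s(1)[OF C] by (auto simp: xor3_def)
    then have "h e \<in> h ` xor3 A B C" using e'(2) by (metis imageI)
    moreover have "h e \<in> xor3 (h ` A) (h ` B) (h ` C)"
      using s(2)[OF A] s(2)[OF B] s(2)[OF C] by (simp add: xor3_def)
    ultimately show ?thesis by simp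
  next
    case False
    then have lone: "\<And>e'. e' \<in> U \<Longrightarrow> h e' = h e \<Longrightarrow> e' = e" by blast
    note s = splits_lone[OF _ e lone]
    have "h e \<in> h ` xor3 A B C \<longleftrightarrow> e \<in> xor3 A B C"
      using lone U by (metis imageE imageI)
    then show ?thesis
      using s[OF A] s[OF B] s[OF C] by (simp add: xor3_def)
  qed
  have "\<exists>e\<in>U. v = h e" if "v \<in> h ` xor3 A B C \<or> v \<in> xor3 (h ` A) (h ` B) (h ` C)" for v
  proof -
    have "v \<in> h ` xor3 A B C \<or> v \<in> h ` A \<or> v \<in> h ` B \<or> v \<in> h ` C"
      using that by (auto simp: xor3_def)
    moreover have "A \<subseteq> U" using A unfolding splits_def by blast
    moreover have "B \<subseteq> U" using B unfolding splits_def by blast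
    moreover have "C \<subseteq> U" using C unfolding splits_def by blast
    ultimately show ?thesis using U by blast
  qed
  note ex = this
  show "h ` xor3 A B C = xor3 (h ` A) (h ` B) (h ` C)"
  proof (rule Set.set_eqI)
    fix v
    show "v \<in> h ` xor3 A B C \<longleftrightarrow> v \<in> xor3 (h ` A) (h ` B) (h ` C)"
    proof (cases "\<exists>e\<in>U. v = h e")
      case True
      then obtain e where "e \<in> U" "v = h e" by blast
      then show ?thesis using key[of e] by simp
    next
      case False
      then show ?thesis using ex[of v] by argo
    qed
  qed
qed

end

text \<open>Counting up from 0 gives \<open>a \<le> \<tau> a\<close>; counting down from
  \<open>k - 1\<close> gives the converse.\<close>

lemma strict_mono_on_lessThan_id:
  fixes \<tau> :: "nat \<Rightarrow> nat"
  assumes mono: "\<And>a b. a < b \<Longrightarrow> b < k \<Longrightarrow> \<tau> a < \<tau> b" and into: "\<And>a. a < k \<Longrightarrow> \<tau> a < k" and a: "a < k"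
  shows "\<tau> a = a"
proof -
  have "a \<le> \<tau> a" using a
  proof (induction a)
    case (Suc a)
    then show ?case using mono[of a "Suc a"] by auto
  qed simp
  moreover have "d < k \<Longrightarrow> \<tau> (k - Suc d) \<le> k - Suc d" for d
  proof (induction d)
    case 0
    then show ?case using into[of "k - 1"] by auto
  next
    case (Suc d)
    moreover from this have "k - Suc (Suc d) < k - Suc d" "k - Suc d < k" by linarith+
    ultimately show ?case using mono[of "k - Suc (Suc d)" "k - Suc d"] by linarith
  qed
  from this[of "k - Suc a"] have "\<tau> a \<le> a" using a by auto
  ultimately show ?thesis by simp
qed

section \<open>Flows with unit capacities\<close>

context planar_network
begin

text \<open>Injectivity of \<open>tail\<close> and \<open>head\<close> bounds every vertex by one
  leaving and one entering arc, so conservation reduces to an equivalence. \<open>X\<close> and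
  \<open>Y\<close> index the sources and sinks in use.\<close>

definition flow :: "nat set \<Rightarrow> nat set \<Rightarrow> 'e set \<Rightarrow> bool" where
  "flow X Y E \<longleftrightarrow> E \<subseteq> arcs G \<and> inj_on (tail G) E \<and> inj_on (head G) E \<and>
     (\<forall>v \<in> verts G - s ` {..<n} - t ` {..<n}. v \<in> head G ` E \<longleftrightarrow> v \<in> tail G ` E) \<and>
     (\<forall>i<n. s i \<in> tail G ` E \<longleftrightarrow> i \<in> X) \<and> (\<forall>j<n. t j \<in> head G ` E \<longleftrightarrow> j \<in> Y)"

lemma flow_xor3:
  assumes "flow X Y E" "flow X' Y' F" "flow X Y E0" "flow X' Y' F0" "flow X Y' E1" "flow X' Y F1"
    and "E0 \<union> F0 = E \<union> F" "E1 \<union> F1 = E \<union> F" "E0 \<inter> F0 = E \<inter> F" "E1 \<inter> F1 = E \<inter> F"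
  shows "flow X Y' (xor3 E E0 E1)"
proof -
  have t: "splits (tail G) (E \<union> F) (E \<inter> F) E F" "splits (tail G) (E \<union> F) (E \<inter> F) E0 F0"
    "splits (tail G) (E \<union> F) (E \<inter> F) E1 F1"
    using assms by (auto simp: splits_def flow_def)
  have h: "splits (head G) (E \<union> F) (E \<inter> F) E F" "splits (head G) (E \<union> F) (E \<inter> F) E0 F0"
    "splits (head G) (E \<union> F) (E \<inter> F) E1 F1"
    using assms by (auto simp: splits_def flow_def)
  have "xor3 E E0 E1 \<subseteq> arcs G"
    using assms(1,3,5) by (auto simp: flow_def xor3_def)
  \<comment> \<open>At the sinks \<open>Y\<close> occurs twice and cancels, leaving
    \<open>Y'\<close>; at the sources the sum of three copies of \<open>X\<close> is
    \<open>X\<close>.\<close>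
  moreover have "(a = (a = b)) = b" for a b :: bool by blast
  ultimately show ?thesis
    using assms(1,3,5) splits_xor3[OF t] splits_xor3[OF h]
    unfolding flow_def by (simp add: xor3_def)
qed

text \<open>Inside \<open>E\<close> every vertex has at most one continuation, so two walks from one
  vertex run together until one stops.\<close>

lemma awalk_prefix:
  assumes "inj_on (tail G) E"
  shows "awalk u p v \<Longrightarrow> awalk u q w \<Longrightarrow> set p \<subseteq> E \<Longrightarrow> set q \<subseteq> E \<Longrightarrow> (\<exists>r. q = p @ r) \<or> (\<exists>r. p = q @ r)"
proof (induction p arbitrary: u q)
  case (Cons e p)
  show ?case
  proof (cases q)
    case q: (Cons f q')
    have "e = f" using Cons.prems assms q by (auto simp: awalk_Cons_iff inj_on_def)
    then show ?thesis using Cons.IH[of "head G e" q'] Cons.prems q by (auto simp: awalk_Cons_iff)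
  qed simp
qed simp

lemma awalk_suffix:
  assumes "inj_on (head G) E"
  shows "awalk u p v \<Longrightarrow> awalk w q v \<Longrightarrow> set p \<subseteq> E \<Longrightarrow> set q \<subseteq> E \<Longrightarrow> (\<exists>r. q = r @ p) \<or> (\<exists>r. p = r @ q)"
proof (induction p arbitrary: v q rule: rev_induct)
  case (snoc e p)
  show ?case
  proof (cases q rule: rev_cases)
    case q: (snoc q' f)
    have "e = f" using snoc.prems assms q by (auto simp: awalk_simps inj_on_def)
    then show ?thesis using snoc.IH[of "tail G e" q'] snoc.prems q by (auto simp: awalk_simps)
  qed simp
qed simp

lemma awalk_sink_Nil: "j < n \<Longrightarrow> awalk (t j) p v \<Longrightarrow> p = []"
  by (cases p) (auto simp: awalk_Cons_iff dest: tail_ne_sink)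

lemma length_awalk: "awalk u p v \<Longrightarrow> length p < card (verts G)"
  using length_apath_less awalk_iff_apath by blast

lemma awalk_vertex_cases:
  assumes "awalk u p v" "w \<in> set (awalk_verts u p)"
  shows "w = v \<or> (\<exists>e\<in>set p. tail G e = w)" "w = u \<or> (\<exists>e\<in>set p. head G e = w)"
proof -
  obtain q r where qr: "p = q @ r" "awalk u q w" "awalk w r v" using awalk_decomp[OF assms] by blast
  show "w = v \<or> (\<exists>e\<in>set p. tail G e = w)"
    using qr by (cases r) (auto simp: awalk_simps)
  show "w = u \<or> (\<exists>e\<in>set p. head G e = w)"
    using qr by (cases q rule: rev_cases) (auto simp: awalk_simps)
qed

text \<open>Acyclicity bounds the length of walks, so a longest one in \<open>E\<close> from
  \<open>u\<close> exists; by conservation it can stop only at a sink.\<close>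

lemma flow_walk_to_sink:
  assumes E: "flow X Y E" and u: "u \<in> tail G ` E"
  shows "\<exists>p j. awalk u p (t j) \<and> set p \<subseteq> E \<and> p \<noteq> [] \<and> j < n \<and> j \<in> Y"
proof -
  let ?W = "\<lambda>p. p \<noteq> [] \<and> set p \<subseteq> E \<and> (\<exists>v. awalk u p v)"
  obtain e where e: "e \<in> E" "tail G e = u" using u by auto
  then have "e \<in> arcs G" using E by (auto simp: flow_def)
  then have "?W [e]" using e by (auto simp: awalk_simps)
  then obtain p where p: "?W p" and max: "\<And>q. ?W q \<Longrightarrow> length q \<le> length p"
    using ex_has_greatest_nat[of ?W "[e]" length "card (verts G)"] length_awalk
    by (metis (no_types, lifting) less_imp_le)
  then obtain v where v: "awalk u p v" by blast
  have last: "last p \<in> E" "last p \<in> arcs G" "head G (last p) = v"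
    using p v E by (cases p rule: rev_cases; auto simp: awalk_simps flow_def)+
  have "v \<notin> tail G ` E"
  proof
    assume "v \<in> tail G ` E"
    then obtain f where f: "f \<in> E" "tail G f = v" by auto
    then have "f \<in> arcs G" using E by (auto simp: flow_def)
    then have "?W (p @ [f])" using p v f by (auto simp: awalk_simps)
    from max[OF this] show False by simp
  qed
  moreover have "v \<in> head G ` E" using last by auto
  moreover have "v \<in> verts G" "v \<notin> s ` {..<n}"
    using last head_ne_source[OF last(2)] by auto
  ultimately have "v \<in> t ` {..<n}" using E unfolding flow_def by blast
  then obtain j where j: "j < n" "v = t j" by auto
  then have "j \<in> Y" using E \<open>v \<in> head G ` E\<close> by (simp add: flow_def)
  then show ?thesis using p v j by blast
qed

text \<open>Dually, a longest walk in \<open>E\<close> that ends with \<open>e\<close> cannot be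
  extended backwards, so it begins at a source. No arc of a flow is left outside its source-to-sink
  paths.\<close>

lemma flow_walk_from_source:
  assumes E: "flow X Y E" and e: "e \<in> E"
  shows "\<exists>p i. awalk (s i) p (head G e) \<and> set p \<subseteq> E \<and> e \<in> set p \<and> i < n \<and> i \<in> X"
proof -
  let ?W = "\<lambda>p. p \<noteq> [] \<and> set p \<subseteq> E \<and> e \<in> set p \<and> (\<exists>u. awalk u p (head G e))"
  have "e \<in> arcs G" using E e by (auto simp: flow_def)
  then have "?W [e]" using e by (auto simp: awalk_simps)
  then obtain p where p: "?W p" and max: "\<And>q. ?W q \<Longrightarrow> length q \<le> length p"
    using ex_has_greatest_nat[of ?W "[e]" length "card (verts G)"] length_awalk
    by (metis (no_types, lifting) less_imp_le)
  then obtain u where u: "awalk u p (head G e)" by blast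
  have hd: "hd p \<in> E" "hd p \<in> arcs G" "tail G (hd p) = u"
    using p u E by (cases p; auto simp: awalk_simps flow_def)+
  have "u \<notin> head G ` E"
  proof
    assume "u \<in> head G ` E"
    then obtain f where f: "f \<in> E" "head G f = u" by auto
    then have "f \<in> arcs G" using E by (auto simp: flow_def)
    then have "?W (f # p)" using p u f by (auto simp: awalk_simps)
    from max[OF this] show False by simp
  qed
  moreover have "u \<in> tail G ` E" using hd by auto
  moreover have "u \<in> verts G" "u \<notin> t ` {..<n}"
    using hd tail_ne_sink[OF hd(2)] by auto
  ultimately have "u \<in> s ` {..<n}" using E unfolding flow_def by blast
  then obtain i where i: "i < n" "u = s i" by auto
  then have "i \<in> X" using E \<open>u \<in> tail G ` E\<close> by (simp add: flow_def)
  then show ?thesis using p u i by blast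
qed

end

section \<open>Arc sets of vertex-disjoint families\<close>

context drawn_network
begin

definition disjoint_family :: "nat \<Rightarrow> (nat \<Rightarrow> nat) \<Rightarrow> (nat \<Rightarrow> 'e list) \<Rightarrow> bool" where
  "disjoint_family k f P \<longleftrightarrow> (\<forall>a<k. \<forall>b<k. a \<noteq> b \<longrightarrow>
     set (awalk_verts (s (f a)) (P a)) \<inter> set (awalk_verts (s (f b)) (P b)) = {})"

text \<open>The extensional function space gives every family one representative, so that
  \<open>edges k\<close> can be injective.\<close>

definition families :: "nat \<Rightarrow> (nat \<Rightarrow> nat) \<Rightarrow> (nat \<Rightarrow> nat) \<Rightarrow> (nat \<Rightarrow> 'e list) set" where
  "families k f g = {P \<in> {0..<k} \<rightarrow>\<^sub>E UNIV. (\<forall>a<k. route (f a) (P a) (g a)) \<and> disjoint_family k f P}"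

definition edges :: "nat \<Rightarrow> (nat \<Rightarrow> 'e list) \<Rightarrow> 'e set" where
  "edges k P = (\<Union>a<k. set (P a))"

lemma familiesD:
  assumes "P \<in> families k f g" "a < k"
  shows "route (f a) (P a) (g a)" "awalk (s (f a)) (P a) (t (g a))" "f a < n" "g a < n"
  using assms by (auto simp: families_def route_def)

lemma families_vertex:
  assumes "P \<in> families k f g" "a < k" "b < k"
    "v \<in> set (awalk_verts (s (f a)) (P a))" "v \<in> set (awalk_verts (s (f b)) (P b))"
  shows "a = b"
  using assms unfolding families_def disjoint_family_def by blast

lemma families_same_tail:
  assumes "P \<in> families k f g" "a < k" "b < k" "e \<in> set (P a)" "e' \<in> set (P b)" "tail G e = tail G e'"
  shows "e = e'" "a = b"
proof -
  show "a = b"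
    using families_vertex[OF assms(1-3)] awalk_arc_ends(1)[OF familiesD(2)[OF assms(1,2)] assms(4)]
      awalk_arc_ends(1)[OF familiesD(2)[OF assms(1,3)] assms(5)] assms(6) by simp
  then show "e = e'"
    using awalk_same_tail[OF familiesD(2)[OF assms(1,2)] assms(4)] assms(5,6) by simp
qed

lemma families_same_head:
  assumes "P \<in> families k f g" "a < k" "b < k" "e \<in> set (P a)" "e' \<in> set (P b)" "head G e = head G e'"
  shows "e = e'" "a = b"
proof -
  show "a = b"
    using families_vertex[OF assms(1-3)] awalk_arc_ends(2)[OF familiesD(2)[OF assms(1,2)] assms(4)]
      awalk_arc_ends(2)[OF familiesD(2)[OF assms(1,3)] assms(5)] assms(6) by simp
  then show "e = e'"
    using awalk_same_head[OF familiesD(2)[OF assms(1,2)] assms(4)] assms(5,6) by simp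
qed

lemma family_edges_flow:
  assumes P: "P \<in> families k f g"
  shows "flow (f ` {..<k}) (g ` {..<k}) (edges k P)"
  unfolding flow_def
proof (intro conjI allI impI ballI)
  let ?E = "edges k P"
  note D = familiesD[OF P]
  show "?E \<subseteq> arcs G" using awalk_arcs[OF D(2)] by (auto simp: edges_def)
  show "inj_on (tail G) ?E"
    using families_same_tail(1)[OF P] by (auto simp: edges_def inj_on_def)
  show "inj_on (head G) ?E"
    using families_same_head(1)[OF P] by (auto simp: edges_def inj_on_def)
  show "v \<in> head G ` ?E \<longleftrightarrow> v \<in> tail G ` ?E" if v: "v \<in> verts G - s ` {..<n} - t ` {..<n}" for v
  proof
    assume "v \<in> head G ` ?E"
    then obtain a e where a: "a < k" "e \<in> set (P a)" "v = head G e" by (auto simp: edges_def)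
    then have "v \<in> set (awalk_verts (s (f a)) (P a))" using awalk_arc_ends(2)[OF D(2)] by blast
    then have "\<exists>e\<in>set (P a). tail G e = v"
      using awalk_vertex_cases(1)[OF D(2)[OF a(1)]] v D(4)[OF a(1)] by blast
    then show "v \<in> tail G ` ?E" using a(1) by (auto simp: edges_def)
  next
    assume "v \<in> tail G ` ?E"
    then obtain a e where a: "a < k" "e \<in> set (P a)" "v = tail G e" by (auto simp: edges_def)
    then have "v \<in> set (awalk_verts (s (f a)) (P a))" using awalk_arc_ends(1)[OF D(2)] by blast
    then have "\<exists>e\<in>set (P a). head G e = v"
      using awalk_vertex_cases(2)[OF D(2)[OF a(1)]] v D(3)[OF a(1)] by blast
    then show "v \<in> head G ` ?E" using a(1) by (auto simp: edges_def)
  qed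
  show "s i \<in> tail G ` ?E \<longleftrightarrow> i \<in> f ` {..<k}" if i: "i < n" for i
  proof
    assume "s i \<in> tail G ` ?E"
    then obtain a e where a: "a < k" "e \<in> set (P a)" "s i = tail G e" by (auto simp: edges_def)
    then have "s i \<in> set (awalk_verts (s (f a)) (P a))"
      using awalk_arc_ends(1)[OF D(2)] by metis
    then show "i \<in> f ` {..<k}" using source_on_awalk[OF D(2)[OF a(1)] _ D(3)[OF a(1)] i] a(1) by blast
  next
    assume "i \<in> f ` {..<k}"
    then obtain a where a: "a < k" "i = f a" by auto
    then have "\<exists>e\<in>set (P a). tail G e = s i"
      using awalk_vertex_cases(1)[OF D(2)[OF a(1)] awalk_verts_ends(1)[OF D(2)[OF a(1)]]]
        s_ne_t[OF D(3,4)[OF a(1)]] by blast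
    then obtain e where "e \<in> set (P a)" "tail G e = s i" by blast
    moreover from this have "e \<in> ?E" using a(1) by (auto simp: edges_def)
    ultimately show "s i \<in> tail G ` ?E" by (metis imageI)
  qed
  show "t j \<in> head G ` ?E \<longleftrightarrow> j \<in> g ` {..<k}" if j: "j < n" for j
  proof
    assume "t j \<in> head G ` ?E"
    then obtain a e where a: "a < k" "e \<in> set (P a)" "t j = head G e" by (auto simp: edges_def)
    then have "t j \<in> set (awalk_verts (s (f a)) (P a))"
      using awalk_arc_ends(2)[OF D(2)] by metis
    then show "j \<in> g ` {..<k}" using sink_on_awalk[OF D(2)[OF a(1)] _ D(4)[OF a(1)] j] a(1) by blast
  next
    assume "j \<in> g ` {..<k}"
    then obtain a where a: "a < k" "j = g a" by auto
    then have "\<exists>e\<in>set (P a). head G e = t j"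
      using awalk_vertex_cases(2)[OF D(2)[OF a(1)] awalk_verts_ends(2)[OF D(2)[OF a(1)]]]
        s_ne_t[OF D(3,4)[OF a(1)]] by metis
    then obtain e where "e \<in> set (P a)" "head G e = t j" by blast
    moreover from this have "e \<in> ?E" using a(1) by (auto simp: edges_def)
    ultimately show "t j \<in> head G ` ?E" by (metis imageI)
  qed
qed

text \<open>The arc set dictates how to continue from each source, so corresponding paths are
  comparable by prefix; their common sink makes the surplus a closed walk, hence empty.\<close>

lemma edges_inj: "inj_on (edges k) (families k f g)"
proof (rule inj_onI)
  fix P Q assume P: "P \<in> families k f g" and Q: "Q \<in> families k f g" and eq: "edges k P = edges k Q"
  have inj: "inj_on (tail G) (edges k P)" using family_edges_flow[OF P] by (simp add: flow_def)
  have "P a = Q a" if a: "a < k" for a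
  proof -
    note p = familiesD[OF P a] and q = familiesD[OF Q a]
    have "set (P a) \<subseteq> edges k P" "set (Q a) \<subseteq> edges k P" using a eq by (auto simp: edges_def)
    then consider r where "Q a = P a @ r" | r where "P a = Q a @ r"
      using awalk_prefix[OF inj p(2) q(2)] by blast
    then show ?thesis
    proof cases
      case 1
      then have "awalk (t (g a)) r (t (g a))" using p(2) q(2) by auto
      then show ?thesis using closed_awalk_Nil 1 by simp
    next
      case 2
      then have "awalk (t (g a)) r (t (g a))" using p(2) q(2) by auto
      then show ?thesis using closed_awalk_Nil 2 by simp
    qed
  qed
  then show "P = Q"
    using P Q by (intro PiE_ext[of P "{0..<k}" "\<lambda>_. UNIV" Q]) (auto simp: families_def)
qed

text \<open>This is where planarity enters the determinant: disjoint paths cannot permute their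
  ends.\<close>

lemma disjoint_routes_mono:
  assumes "disjoint_family k f P" "\<And>a. a < k \<Longrightarrow> route (f a) (P a) (\<tau> a)"
    "\<And>a b. a < b \<Longrightarrow> b < k \<Longrightarrow> f a < f b" "a < b" "b < k"
  shows "\<tau> a < \<tau> b"
proof -
  have "a < k" using assms by simp
  have d: "set (awalk_verts (s (f a)) (P a)) \<inter> set (awalk_verts (s (f b)) (P b)) = {}"
    using assms by (simp add: disjoint_family_def)
  have "\<tau> a \<noteq> \<tau> b"
    using d awalk_verts_ends(2)[of "s (f a)" "P a" "t (\<tau> a)"] awalk_verts_ends(2)[of "s (f b)" "P b" "t (\<tau> b)"]
      assms(2)[OF \<open>a < k\<close>] assms(2)[OF \<open>b < k\<close>] by (auto simp: route_def)
  moreover have "s (f b) \<in> set (awalk_verts (s (f b)) (P b))"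
    using assms(2)[OF \<open>b < k\<close>] awalk_verts_ends(1) by (auto simp: route_def)
  then have "f b < f a \<longleftrightarrow> \<tau> b < \<tau> a"
    using disjoint_routes_above[OF assms(2)[OF \<open>a < k\<close>] assms(2)[OF \<open>b < k\<close>] d] by blast
  ultimately show ?thesis using assms(3)[OF assms(4,5)] by auto
qed

text \<open>Following \<open>E\<close> from each source yields paths to some sinks
  \<open>g (\<tau> a)\<close>. They are disjoint, so \<open>\<tau>\<close> is increasing and
  therefore the identity; tracing arcs back to sources shows that they exhaust
  \<open>E\<close>.\<close>

lemma flow_is_family:
  assumes f: "\<And>a b. a < b \<Longrightarrow> b < k \<Longrightarrow> f a < f b" and g: "\<And>a b. a < b \<Longrightarrow> b < k \<Longrightarrow> g a < g b"
    and fn: "\<And>a. a < k \<Longrightarrow> f a < n" and gn: "\<And>a. a < k \<Longrightarrow> g a < n"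
    and E: "flow (f ` {..<k}) (g ` {..<k}) E"
  shows "E \<in> edges k ` families k f g"
proof -
  have "\<exists>p b. route (f a) p (g b) \<and> set p \<subseteq> E \<and> b < k" if a: "a < k" for a
  proof -
    have "s (f a) \<in> tail G ` E" using E a fn[OF a] by (auto simp: flow_def)
    then obtain p j where "awalk (s (f a)) p (t j)" "set p \<subseteq> E" "j < n" "j \<in> g ` {..<k}"
      using flow_walk_to_sink[OF E] by blast
    then show ?thesis using fn[OF a] by (auto simp: route_def)
  qed
  then obtain P0 \<tau> where P0: "\<And>a. a < k \<Longrightarrow> route (f a) (P0 a) (g (\<tau> a)) \<and> set (P0 a) \<subseteq> E \<and> \<tau> a < k"
    by metis
  define P where "P = restrict P0 {0..<k}"
  have P: "route (f a) (P a) (g (\<tau> a))" "set (P a) \<subseteq> E" "\<tau> a < k" if "a < k" for a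
    using P0[OF that] that by (auto simp: P_def)
  have W: "awalk (s (f a)) (P a) (t (g (\<tau> a)))" if "a < k" for a
    using P(1)[OF that] by (simp add: route_def)
  have ht: "inj_on (head G) E" "inj_on (tail G) E" using E by (auto simp: flow_def)
  have eqI: "a = b" if "f a = f b" "a < k" "b < k" for a b
    using f[of a b] f[of b a] that by (cases a b rule: linorder_cases) auto
  have dis: "disjoint_family k f P"
    unfolding disjoint_family_def
  proof (intro allI impI, rule ccontr)
    fix a b assume ab: "a < k" "b < k" "a \<noteq> b"
      and "set (awalk_verts (s (f a)) (P a)) \<inter> set (awalk_verts (s (f b)) (P b)) \<noteq> {}"
    then obtain v where v: "v \<in> set (awalk_verts (s (f a)) (P a))" "v \<in> set (awalk_verts (s (f b)) (P b))"
      by blast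
    obtain p p' where p: "P a = p @ p'" "awalk (s (f a)) p v" using awalk_decomp[OF W[OF ab(1)] v(1)] by blast
    obtain q q' where q: "P b = q @ q'" "awalk (s (f b)) q v" using awalk_decomp[OF W[OF ab(2)] v(2)] by blast
    have "set p \<subseteq> E" "set q \<subseteq> E" using P(2)[OF ab(1)] P(2)[OF ab(2)] p q by auto
    \<comment> \<open>Backwards from a common vertex \<open>E\<close> leaves no choice, so one walk
      is a final piece of the other. A longer walk would have to enter a source.\<close>
    then consider r where "q = r @ p" | r where "p = r @ q"
      using awalk_suffix[OF ht(1) p(2) q(2)] by blast
    then have "f a = f b"
    proof cases
      case 1
      have "awalk (s (f b)) r (s (f a))"
        using q(2) p(2) 1 awalk_ends[OF _ p(2)] 
        by (metis awalk_append_iff awalk_Nil_iff append_Nil2)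
      then show ?thesis
        using source_on_awalk[of "f b" r "s (f a)" "f a"] awalk_verts_ends(2) fn ab by metis
    next
      case 2
      have "awalk (s (f a)) r (s (f b))"
        using q(2) p(2) 2 awalk_ends[OF _ q(2)] 
        by (metis awalk_append_iff awalk_Nil_iff append_Nil2)
      then show ?thesis
        using source_on_awalk[of "f a" r "s (f b)" "f b"] awalk_verts_ends(2) fn ab by metis
    qed
    then show False using eqI ab by blast
  qed
  have "\<tau> a < \<tau> b" if "a < b" "b < k" for a b
  proof -
    have "g (\<tau> a) < g (\<tau> b)"
      by (rule disjoint_routes_mono[OF dis _ f that]) (use P in auto)
    then show ?thesis
      using g[of "\<tau> b" "\<tau> a"] P(3) that by (metis less_trans linorder_neqE_nat order_less_imp_not_less)
  qed
  then have id: "\<tau> a = a" if "a < k" for a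
    using strict_mono_on_lessThan_id[of k \<tau> a] P(3) that by blast
  have fam: "P \<in> families k f g"
    unfolding families_def using dis P(1) id by (auto simp: P_def)
  have "edges k P = E"
  proof
    show "edges k P \<subseteq> E" using P(2) by (auto simp: edges_def)
    \<comment> \<open>A walk in \<open>E\<close> from a source through \<open>e\<close> is
      comparable with the path from that source, and it cannot continue past the sink.\<close>
    show "E \<subseteq> edges k P"
    proof
      fix e assume e: "e \<in> E"
      obtain q a where q: "awalk (s (f a)) q (head G e)" "set q \<subseteq> E" "e \<in> set q" "a < k"
        using flow_walk_from_source[OF E e] by blast
      consider r where "q = P a @ r" | r where "P a = q @ r"
        using awalk_prefix[OF ht(2) W[OF q(4)] q(1) P(2)[OF q(4)] q(2)] by blast
      then have "e \<in> set (P a)"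
      proof cases
        case 1
        then have "awalk (t (g (\<tau> a))) r (head G e)"
          using q(1) W[OF q(4)] by auto
        then have "r = []" using awalk_sink_Nil gn P(3) q(4) by blast
        then show ?thesis using 1 q(3) by simp
      qed (use q in auto)
      then show "e \<in> edges k P" using q(4) by (auto simp: edges_def)
    qed
  qed
  then show ?thesis using fam by blast
qed

end

section \<open>Envelopes of two path families\<close>

context drawn_network
begin

text \<open>The union of the upper envelopes of \<open>P a\<close> and \<open>Q a\<close>. Arcs on
  both are kept outright, since a side relative to a path containing the arc has no meaning.\<close>

definition envelope ::
  "nat \<Rightarrow> (nat \<Rightarrow> 'e list) \<Rightarrow> (nat \<Rightarrow> 'e list) \<Rightarrow> (nat \<Rightarrow> 'e \<Rightarrow> bool) \<Rightarrow> (nat \<Rightarrow> 'e \<Rightarrow> bool) \<Rightarrow> 'e set" where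
  "envelope k P Q aP aQ = {e. \<exists>a<k. e \<in> set (P a) \<and> (e \<in> set (Q a) \<or> aQ a e)} \<union>
     {e. \<exists>a<k. e \<in> set (Q a) \<and> e \<notin> set (P a) \<and> aP a e}"

lemma envelopeE:
  assumes "e \<in> envelope k P Q aP aQ"
  obtains (1) a where "a < k" "e \<in> set (P a)" "e \<in> set (Q a) \<or> aQ a e"
    | (2) a where "a < k" "e \<in> set (Q a)" "e \<notin> set (P a)" "aP a e"
  using assms unfolding envelope_def by blast

text \<open>
  The predicates are abstract because the lower envelope is the upper envelope for the negated
  predicates with the two families exchanged.
\<close>

lemma envelope_flow:
  fixes aP aQ :: "nat \<Rightarrow> 'e \<Rightarrow> bool" and vP vQ :: "nat \<Rightarrow> 'v \<Rightarrow> bool"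
  assumes P: "P \<in> families k f g'" and Q: "Q \<in> families k f' g"
    and locP: "\<And>h a e. h \<in> {tail G, head G} \<Longrightarrow> a < k \<Longrightarrow> e \<in> arcs G \<Longrightarrow>
      h e \<notin> set (awalk_verts (s (f a)) (P a)) \<Longrightarrow> aP a e \<longleftrightarrow> vP a (h e)"
    and locQ: "\<And>h a e. h \<in> {tail G, head G} \<Longrightarrow> a < k \<Longrightarrow> e \<in> arcs G \<Longrightarrow>
      h e \<notin> set (awalk_verts (s (f' a)) (Q a)) \<Longrightarrow> aQ a e \<longleftrightarrow> vQ a (h e)"
    and dual: "\<And>h a e e'. h \<in> {tail G, head G} \<Longrightarrow> a < k \<Longrightarrow> e \<in> set (P a) \<Longrightarrow> e' \<in> set (Q a) \<Longrightarrow>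
      h e = h e' \<Longrightarrow> e \<noteq> e' \<Longrightarrow> aQ a e \<longleftrightarrow> \<not> aP a e'"
    and cross: "\<And>a b. a < k \<Longrightarrow> b < k \<Longrightarrow> a \<noteq> b \<Longrightarrow>
      (\<forall>v \<in> set (awalk_verts (s (f' b)) (Q b)). \<not> vQ a v) \<or> (\<forall>v \<in> set (awalk_verts (s (f a)) (P a)). \<not> vP b v)"
    and src: "\<And>a. a < k \<Longrightarrow> f a \<noteq> f' a \<Longrightarrow> vQ a (s (f a)) \<and> \<not> vP a (s (f' a))"
    and snk: "\<And>a. a < k \<Longrightarrow> g a \<noteq> g' a \<Longrightarrow> \<not> vQ a (t (g' a)) \<and> vP a (t (g a))"
  shows "flow (f ` {..<k}) (g ` {..<k}) (envelope k P Q aP aQ)"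
proof -
  let ?E = "envelope k P Q aP aQ" and ?H = "{tail G, head G}"
  let ?VP = "\<lambda>a. set (awalk_verts (s (f a)) (P a))" and ?VQ = "\<lambda>a. set (awalk_verts (s (f' a)) (Q a))"
  note DP = familiesD[OF P] and DQ = familiesD[OF Q]
  have I1: "e \<in> ?E" if "a < k" "e \<in> set (P a)" "e \<in> set (Q a) \<or> aQ a e" for a e
    using that unfolding envelope_def by blast
  have I2: "e \<in> ?E" if "a < k" "e \<in> set (Q a)" "e \<notin> set (P a)" "aP a e" for a e
    using that unfolding envelope_def by blast
  have endP: "h e \<in> ?VP a" if "h \<in> ?H" "a < k" "e \<in> set (P a)" for h a e
    using awalk_arc_ends[OF DP(2)[OF that(2)] that(3)] that(1) by blast
  have endQ: "h e \<in> ?VQ a" if "h \<in> ?H" "a < k" "e \<in> set (Q a)" for h a e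
    using awalk_arc_ends[OF DQ(2)[OF that(2)] that(3)] that(1) by blast
  have sameP: "e = e'" if "h \<in> ?H" "a < k" "b < k" "e \<in> set (P a)" "e' \<in> set (P b)" "h e = h e'" for h a b e e'
    using families_same_tail(1)[OF P that(2-5)] families_same_head(1)[OF P that(2-5)] that(1,6) by blast
  have sameQ: "e = e'" if "h \<in> ?H" "a < k" "b < k" "e \<in> set (Q a)" "e' \<in> set (Q b)" "h e = h e'" for h a b e e'
    using families_same_tail(1)[OF Q that(2-5)] families_same_head(1)[OF Q that(2-5)] that(1,6) by blast
  have arcP: "e \<in> arcs G" if "a < k" "e \<in> set (P a)" for a e
    using awalk_arcs[OF DP(2)] that by blast
  have arcQ: "e \<in> arcs G" if "a < k" "e \<in> set (Q a)" for a e
    using awalk_arcs[OF DQ(2)] that by blast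
  \<comment> \<open>Kept arcs of different origin with a common end coincide. For
    \<open>a = b\<close>, duality forbids that each is above the other path. For
    \<open>a \<noteq> b\<close>, the common vertex of \<open>P a\<close> and \<open>Q b\<close>
    would be above both \<open>Q a\<close> and \<open>P b\<close>, against
    \<open>cross\<close>.\<close>
  have clash: "e = e'" if h: "h \<in> ?H" and a: "a < k" "e \<in> set (P a)" "e \<in> set (Q a) \<or> aQ a e"
    and b: "b < k" "e' \<in> set (Q b)" "e' \<notin> set (P b)" "aP b e'" and eq: "h e = h e'" for h a b e e'
  proof (cases "e \<in> set (Q a)")
    case True
    then show ?thesis using sameQ[OF h a(1) b(1) True b(2) eq] by simp
  next
    case False
    then have ae: "aQ a e" using a(3) by simp
    show ?thesis
    proof (cases "a = b")
      case True
      then show ?thesis using dual[OF h a(1,2) _ eq] b ae by blast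
    next
      case ab: False
      have v: "h e \<in> ?VP a" "h e \<in> ?VQ b" using endP[OF h a(1,2)] endQ[OF h b(1,2)] eq by auto
      have "h e \<notin> ?VQ a" using families_vertex[OF Q a(1) b(1) _ v(2)] ab by blast
      then have "vQ a (h e)" using locQ[OF h a(1) arcP[OF a(1,2)]] ae by blast
      moreover have "h e' \<notin> ?VP b" using families_vertex[OF P a(1) b(1) v(1)] ab eq by metis
      then have "vP b (h e)" using locP[OF h b(1) arcQ[OF b(1,2)]] b(4) eq by metis
      ultimately show ?thesis using cross[OF a(1) b(1) ab] v by blast
    qed
  qed
  have inj: "inj_on h ?E" if h: "h \<in> ?H" for h
  proof (rule inj_onI)
    fix e e' assume e: "e \<in> ?E" and e': "e' \<in> ?E" and eq: "h e = h e'"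
    show "e = e'"
      using e
    proof (cases rule: envelopeE)
      case (1 a)
      show ?thesis using e'
      proof (cases rule: envelopeE)
        case (1 b)
        then show ?thesis using sameP[OF h _ _ _ _ eq] \<open>a < k\<close> \<open>e \<in> set (P a)\<close> by blast
      next
        case (2 b)
        then show ?thesis using clash[OF h 1 2 eq] by blast
      qed
    next
      case (2 a)
      show ?thesis using e'
      proof (cases rule: envelopeE)
        case (1 b)
        then show ?thesis using clash[OF h 1 2 eq[symmetric]] by simp
      next
        case (2 b)
        then show ?thesis using sameQ[OF h _ _ _ _ eq] \<open>a < k\<close> \<open>e \<in> set (Q a)\<close> by blast
      qed
    qed
  qed
  \<comment> \<open>At a vertex on both \<open>P a\<close> and \<open>Q a\<close>, duality keeps one
    of the two arcs; this is how the envelope changes from one path to the other.\<close>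
  have common: "v \<in> h ` ?E" if h: "h \<in> ?H" and a: "a < k" and e: "e \<in> set (P a)" "h e = v"
    and e': "e' \<in> set (Q a)" "h e' = v" for h a e e' v
  proof (cases "e = e'")
    case True
    then have "e \<in> ?E" using I1[OF a e(1)] e'(1) by simp
    then show ?thesis using e(2) by (metis imageI)
  next
    case False
    then have "e' \<notin> set (P a)" using sameP[OF h a a e(1)] e(2) e'(2) by metis
    moreover have "aQ a e \<longleftrightarrow> \<not> aP a e'" using dual[OF h a e(1) e'(1)] e(2) e'(2) False by simp
    ultimately have "e \<in> ?E \<or> e' \<in> ?E" using I1[OF a e(1)] I2[OF a e'(1)] by argo
    then show ?thesis using e(2) e'(2) by (metis imageI)
  qed
  \<comment> \<open>\<open>h\<close> and \<open>h'\<close> are the two end maps in either order, so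
    one argument covers both directions of conservation. Off the other path the side belongs to the
    vertex and passes from one arc to the next.\<close>
  have conserve: "v \<in> h' ` ?E" if h: "h \<in> ?H" "h' \<in> ?H" and v: "v \<in> h ` ?E"
    and nextP: "\<And>a. a < k \<Longrightarrow> v \<in> ?VP a \<Longrightarrow> \<exists>e\<in>set (P a). h' e = v"
    and nextQ: "\<And>a. a < k \<Longrightarrow> v \<in> ?VQ a \<Longrightarrow> \<exists>e\<in>set (Q a). h' e = v" for v h h'
  proof -
    obtain e where e: "e \<in> ?E" "h e = v" using v by blast
    from e(1) show ?thesis
    proof (cases rule: envelopeE)
      case (1 a)
      have vP: "v \<in> ?VP a" using endP[OF h(1) 1(1,2)] e(2) by simp
      obtain e2 where e2: "e2 \<in> set (P a)" "h' e2 = v" using nextP[OF 1(1) vP] by blast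
      show ?thesis
      proof (cases "v \<in> ?VQ a")
        case True
        then show ?thesis using nextQ[OF 1(1)] common[OF h(2) 1(1) e2] by blast
      next
        case False
        then have "e \<notin> set (Q a)" using endQ[OF h(1) 1(1)] e(2) by blast
        then have "vQ a v" using locQ[OF h(1) 1(1) arcP[OF 1(1,2)]] 1(3) e(2) False by blast
        then have "aQ a e2" using locQ[OF h(2) 1(1) arcP[OF 1(1) e2(1)]] e2(2) False by blast
        then have "e2 \<in> ?E" using I1[OF 1(1) e2(1)] by blast
        then show ?thesis using e2(2) by (metis imageI)
      qed
    next
      case (2 a)
      have vQ: "v \<in> ?VQ a" using endQ[OF h(1) 2(1,2)] e(2) by simp
      obtain e2 where e2: "e2 \<in> set (Q a)" "h' e2 = v" using nextQ[OF 2(1) vQ] by blast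
      show ?thesis
      proof (cases "v \<in> ?VP a")
        case True
        then show ?thesis using nextP[OF 2(1)] common[OF h(2) 2(1) _ _ e2] by blast
      next
        case False
        then have "vP a v" using locP[OF h(1) 2(1) arcQ[OF 2(1,2)]] 2(4) e(2) by blast
        then have "aP a e2" using locP[OF h(2) 2(1) arcQ[OF 2(1) e2(1)]] e2(2) False by blast
        moreover have "e2 \<notin> set (P a)" using endP[OF h(2) 2(1)] e2(2) False by blast
        ultimately have "e2 \<in> ?E" using I2[OF 2(1) e2(1)] by blast
        then show ?thesis using e2(2) by (metis imageI)
      qed
    qed
  qed
  have tH: "tail G \<in> ?H" and hH: "head G \<in> ?H" by auto
  show ?thesis
    unfolding flow_def
  proof (intro conjI allI impI ballI)
    show "?E \<subseteq> arcs G" using arcP arcQ by (auto elim: envelopeE)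
    show "inj_on (tail G) ?E" "inj_on (head G) ?E" using inj[OF tH] inj[OF hH] .
    show "v \<in> head G ` ?E \<longleftrightarrow> v \<in> tail G ` ?E" if v: "v \<in> verts G - s ` {..<n} - t ` {..<n}" for v
    proof
      assume "v \<in> head G ` ?E"
      then show "v \<in> tail G ` ?E"
      proof (rule conserve[OF hH tH])
        show "\<exists>e\<in>set (P a). tail G e = v" if "a < k" "v \<in> ?VP a" for a
          using awalk_vertex_cases(1)[OF DP(2)[OF that(1)] that(2)] v DP(4)[OF that(1)] by blast
        show "\<exists>e\<in>set (Q a). tail G e = v" if "a < k" "v \<in> ?VQ a" for a
          using awalk_vertex_cases(1)[OF DQ(2)[OF that(1)] that(2)] v DQ(4)[OF that(1)] by blast
      qed
    next
      assume "v \<in> tail G ` ?E"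
      then show "v \<in> head G ` ?E"
      proof (rule conserve[OF tH hH])
        show "\<exists>e\<in>set (P a). head G e = v" if "a < k" "v \<in> ?VP a" for a
          using awalk_vertex_cases(2)[OF DP(2)[OF that(1)] that(2)] v DP(3)[OF that(1)] by blast
        show "\<exists>e\<in>set (Q a). head G e = v" if "a < k" "v \<in> ?VQ a" for a
          using awalk_vertex_cases(2)[OF DQ(2)[OF that(1)] that(2)] v DQ(3)[OF that(1)] by blast
      qed
    qed
    have firstP: "\<exists>e\<in>set (P a). tail G e = s (f a)" if a: "a < k" for a
      using awalk_vertex_cases(1)[OF DP(2)[OF a] awalk_verts_ends(1)[OF DP(2)[OF a]]] s_ne_t[OF DP(3,4)[OF a]]
      by blast
    have firstQ: "\<exists>e\<in>set (Q a). tail G e = s (f' a)" if a: "a < k" for a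
      using awalk_vertex_cases(1)[OF DQ(2)[OF a] awalk_verts_ends(1)[OF DQ(2)[OF a]]] s_ne_t[OF DQ(3,4)[OF a]]
      by blast
    have lastP: "\<exists>e\<in>set (P a). head G e = t (g' a)" if a: "a < k" for a
      using awalk_vertex_cases(2)[OF DP(2)[OF a] awalk_verts_ends(2)[OF DP(2)[OF a]]] s_ne_t[OF DP(3,4)[OF a]]
      by metis
    have lastQ: "\<exists>e\<in>set (Q a). head G e = t (g a)" if a: "a < k" for a
      using awalk_vertex_cases(2)[OF DQ(2)[OF a] awalk_verts_ends(2)[OF DQ(2)[OF a]]] s_ne_t[OF DQ(3,4)[OF a]]
      by metis
    show "s i \<in> tail G ` ?E \<longleftrightarrow> i \<in> f ` {..<k}" if i: "i < n" for i
    proof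
      assume "s i \<in> tail G ` ?E"
      then obtain e where e: "e \<in> ?E" "tail G e = s i" by (metis imageE)
      from e(1) show "i \<in> f ` {..<k}"
      proof (cases rule: envelopeE)
        case (1 a)
        then have "s i \<in> ?VP a" using endP[OF tH 1(1,2)] e(2) by simp
        then show ?thesis using source_on_awalk[OF DP(2)[OF 1(1)] _ DP(3)[OF 1(1)] i] 1(1) by blast
      next
        case (2 a)
        then have "s i \<in> ?VQ a" using endQ[OF tH 2(1,2)] e(2) by simp
        then have i': "i = f' a" using source_on_awalk[OF DQ(2)[OF 2(1)] _ DQ(3)[OF 2(1)] i] by blast
        show ?thesis
        \<comment> \<open>If the sources differ, the one of \<open>Q a\<close> is not above
          \<open>P a\<close>, so the first arc of \<open>Q a\<close> is not kept.\<close>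
        proof (cases "f a = f' a")
          case False
          have "s i \<notin> ?VP a"
            using source_on_awalk[OF DP(2)[OF 2(1)] _ DP(3)[OF 2(1)] i] i' False by metis
          then have "vP a (s (f' a))" using locP[OF tH 2(1) arcQ[OF 2(1,2)]] e(2) 2(4) i' by metis
          then show ?thesis using src[OF 2(1) False] by blast
        qed (use i' 2(1) in \<open>metis imageI lessThan_iff\<close>)
      qed
    next
      assume "i \<in> f ` {..<k}"
      then obtain a where a: "a < k" "i = f a" by auto
      obtain e where e: "e \<in> set (P a)" "tail G e = s (f a)" using firstP[OF a(1)] by blast
      show "s i \<in> tail G ` ?E"
      proof (cases "f a = f' a")
        case True
        then show ?thesis using firstQ[OF a(1)] common[OF tH a(1) e] a(2) by auto
      next
        case False
        have "s (f a) \<notin> ?VQ a"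
          using source_on_awalk[OF DQ(2)[OF a(1)] _ DQ(3)[OF a(1)] DP(3)[OF a(1)]] False by metis
        then have "aQ a e" using locQ[OF tH a(1) arcP[OF a(1) e(1)]] e(2) src[OF a(1) False] by metis
        then have "e \<in> ?E" using I1[OF a(1) e(1)] by blast
        then show ?thesis using e(2) a(2) by (metis imageI)
      qed
    qed
    show "t j \<in> head G ` ?E \<longleftrightarrow> j \<in> g ` {..<k}" if j: "j < n" for j
    proof
      assume "t j \<in> head G ` ?E"
      then obtain e where e: "e \<in> ?E" "head G e = t j" by (metis imageE)
      from e(1) show "j \<in> g ` {..<k}"
      proof (cases rule: envelopeE)
        case (2 a)
        then have "t j \<in> ?VQ a" using endQ[OF hH 2(1,2)] e(2) by simp
        then show ?thesis using sink_on_awalk[OF DQ(2)[OF 2(1)] _ DQ(4)[OF 2(1)] j] 2(1) by blast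
      next
        case (1 a)
        then have "t j \<in> ?VP a" using endP[OF hH 1(1,2)] e(2) by simp
        then have j': "j = g' a" using sink_on_awalk[OF DP(2)[OF 1(1)] _ DP(4)[OF 1(1)] j] by blast
        show ?thesis
        proof (cases "g a = g' a")
          case False
          have nv: "t j \<notin> ?VQ a"
            using sink_on_awalk[OF DQ(2)[OF 1(1)] _ DQ(4)[OF 1(1)] j] j' False by metis
          then have "e \<notin> set (Q a)" using endQ[OF hH 1(1)] e(2) by metis
          then have "vQ a (t (g' a))" using locQ[OF hH 1(1) arcP[OF 1(1,2)]] e(2) 1(3) j' nv by metis
          then show ?thesis using snk[OF 1(1) False] by blast
        qed (use j' 1(1) in \<open>metis imageI lessThan_iff\<close>)
      qed
    next
      assume "j \<in> g ` {..<k}"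
      then obtain a where a: "a < k" "j = g a" by auto
      obtain e where e: "e \<in> set (Q a)" "head G e = t (g a)" using lastQ[OF a(1)] by blast
      show "t j \<in> head G ` ?E"
      proof (cases "g a = g' a")
        case True
        then show ?thesis using lastP[OF a(1)] common[OF hH a(1) _ _ e] a(2) by auto
      next
        case False
        have nv: "t (g a) \<notin> ?VP a"
          using sink_on_awalk[OF DP(2)[OF a(1)] _ DP(4)[OF a(1)] DQ(4)[OF a(1)]] False by metis
        then have "aP a e" using locP[OF hH a(1) arcQ[OF a(1) e(1)]] e(2) snk[OF a(1) False] by metis
        moreover have "e \<notin> set (P a)" using nv endP[OF hH a(1)] e(2) by metis
        ultimately have "e \<in> ?E" using I2[OF a(1) e(1)] by blast
        then show ?thesis using e(2) a(2) by (metis imageI)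
      qed
    qed
  qed
qed

text \<open>The upper envelope gets the smaller indices at both ends, the lower envelope the larger
  ones. Together they use each arc as often as \<open>P\<close> and \<open>Q\<close> do.\<close>

lemma uncross:
  assumes P: "P \<in> families k f g'" and Q: "Q \<in> families k f' g"
    and f: "\<And>a b. a < b \<Longrightarrow> b < k \<Longrightarrow> f a < f b" and f': "\<And>a b. a < b \<Longrightarrow> b < k \<Longrightarrow> f' a < f' b"
    and ff: "\<And>a. a < k \<Longrightarrow> f a \<le> f' a" and gg: "\<And>a. a < k \<Longrightarrow> g a \<le> g' a"
  obtains E F where "flow (f ` {..<k}) (g ` {..<k}) E" "flow (f' ` {..<k}) (g' ` {..<k}) F"
    "E \<union> F = edges k P \<union> edges k Q" "E \<inter> F = edges k P \<inter> edges k Q"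
proof -
  define aP aQ where "aP a = above_arc (P a)" and "aQ a = above_arc (Q a)" for a
  define vP vQ where "vP a = above_vertex (P a)" and "vQ a = above_vertex (Q a)" for a
  let ?VP = "\<lambda>a. set (awalk_verts (s (f a)) (P a))" and ?VQ = "\<lambda>a. set (awalk_verts (s (f' a)) (Q a))"
  let ?H = "{tail G, head G}"
  note DP = familiesD[OF P] and DQ = familiesD[OF Q]
  have disjP: "?VP a \<inter> ?VP b = {}" if "a < k" "b < k" "a \<noteq> b" for a b
    using P that by (simp add: families_def disjoint_family_def)
  have disjQ: "?VQ a \<inter> ?VQ b = {}" if "a < k" "b < k" "a \<noteq> b" for a b
    using Q that by (simp add: families_def disjoint_family_def)
  have locP: "aP a e \<longleftrightarrow> vP a (h e)" if "h \<in> ?H" "a < k" "e \<in> arcs G" "h e \<notin> ?VP a" for h a e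
    using above_arc_tail[OF DP(1)[OF that(2)] that(3)] above_arc_head[OF DP(1)[OF that(2)] that(3)] that
    by (auto simp: aP_def vP_def)
  have locQ: "aQ a e \<longleftrightarrow> vQ a (h e)" if "h \<in> ?H" "a < k" "e \<in> arcs G" "h e \<notin> ?VQ a" for h a e
    using above_arc_tail[OF DQ(1)[OF that(2)] that(3)] above_arc_head[OF DQ(1)[OF that(2)] that(3)] that
    by (auto simp: aQ_def vQ_def)
  have dual: "aQ a e \<longleftrightarrow> \<not> aP a e'"
    if "h \<in> ?H" "a < k" "e \<in> set (P a)" "e' \<in> set (Q a)" "h e = h e'" "e \<noteq> e'" for h a e e'
    using above_dual_tail[OF DP(1)[OF that(2)] DQ(1)[OF that(2)] that(3,4)]
      above_dual_head[OF DP(1)[OF that(2)] DQ(1)[OF that(2)] that(3,4)] that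
    by (auto simp: aP_def aQ_def)
  have lt: "b < a" if "f b < f a \<or> f' b < f' a" "a < k" "b < k" for a b
    using that f[of a b] f'[of a b] by (metis less_asym linorder_neqE_nat)
  have VV: "vP b v \<longleftrightarrow> a < b" if "a < k" "b < k" "a \<noteq> b" "v \<in> ?VP a" for a b v
    using disjoint_routes_above(1)[OF DP(1)[OF that(2)] DP(1)[OF that(1)] disjP[OF that(2,1)] that(4)]
      that lt[of a b] f[of a b] by (auto simp: vP_def)
  have WW: "vQ b v \<longleftrightarrow> a < b" if "a < k" "b < k" "a \<noteq> b" "v \<in> ?VQ a" for a b v
    using disjoint_routes_above(1)[OF DQ(1)[OF that(2)] DQ(1)[OF that(1)] disjQ[OF that(2,1)] that(4)]
      that lt[of a b] f'[of a b] by (auto simp: vQ_def)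
  have src: "vQ a (s (f a)) \<and> \<not> vP a (s (f' a))" if "a < k" "f a \<noteq> f' a" for a
    using above_vertex_s[OF DQ(1)[OF that(1)] DP(3)[OF that(1)]]
      above_vertex_s[OF DP(1)[OF that(1)] DQ(3)[OF that(1)]] ff[OF that(1)] that(2)
    by (auto simp: vP_def vQ_def)
  have snk: "\<not> vQ a (t (g' a)) \<and> vP a (t (g a))" if "a < k" "g a \<noteq> g' a" for a
    using above_vertex_t[OF DQ(1)[OF that(1)] DP(4)[OF that(1)]]
      above_vertex_t[OF DP(1)[OF that(1)] DQ(4)[OF that(1)]] gg[OF that(1)] that(2)
    by (auto simp: vP_def vQ_def)
  define E where "E = envelope k P Q aP aQ"
  define F where "F = envelope k Q P (\<lambda>a e. \<not> aQ a e) (\<lambda>a e. \<not> aP a e)"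
  have "flow (f ` {..<k}) (g ` {..<k}) E"
    unfolding E_def
  proof (rule envelope_flow[OF P Q, where vP = vP and vQ = vQ])
    \<comment> \<open>Larger indices lie lower: for \<open>a < b\<close> the path \<open>Q b\<close>
      is below \<open>Q a\<close>, and for \<open>b < a\<close> the path \<open>P a\<close> is below
      \<open>P b\<close>.\<close>
    show "(\<forall>v\<in>?VQ b. \<not> vQ a v) \<or> (\<forall>v\<in>?VP a. \<not> vP b v)" if "a < k" "b < k" "a \<noteq> b" for a b
      using VV[of a b] WW[of b a] that by (cases "a < b") auto
  qed (fact locP locQ dual src snk)+
  moreover have "flow (f' ` {..<k}) (g' ` {..<k}) F"
    unfolding F_def
  proof (rule envelope_flow[OF Q P, where vP = "\<lambda>a v. \<not> vQ a v" and vQ = "\<lambda>a v. \<not> vP a v"])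
    show "(\<forall>v\<in>?VP b. \<not> \<not> vP a v) \<or> (\<forall>v\<in>?VQ a. \<not> \<not> vQ b v)" if "a < k" "b < k" "a \<noteq> b" for a b
      using VV[of b a] WW[of a b] that by (cases "a < b") auto
    show "(\<not> aP a e) = (\<not> \<not> aQ a e')"
      if "h \<in> ?H" "a < k" "e \<in> set (Q a)" "e' \<in> set (P a)" "h e = h e'" "e \<noteq> e'" for h a e e'
      using dual[OF that(1,2,4,3)] that by auto
    show "\<not> vP a (s (f' a)) \<and> \<not> \<not> vQ a (s (f a))" if "a < k" "f' a \<noteq> f a" for a
      using src[OF that(1)] that(2) by metis
    show "\<not> \<not> vP a (t (g a)) \<and> \<not> vQ a (t (g' a))" if "a < k" "g' a \<noteq> g a" for a
      using snk[OF that(1)] that(2) by metis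
    show "(\<not> aQ a e) = (\<not> vQ a (h e))" if "h \<in> ?H" "a < k" "e \<in> arcs G" "h e \<notin> ?VQ a" for h a e
      using locQ[OF that] by simp
    show "(\<not> aP a e) = (\<not> vP a (h e))" if "h \<in> ?H" "a < k" "e \<in> arcs G" "h e \<notin> ?VP a" for h a e
      using locP[OF that] by simp
  qed
  moreover have sub: "x \<in> edges k P \<union> edges k Q" if "x \<in> E \<or> x \<in> F" for x
    using that unfolding E_def F_def envelope_def edges_def by blast
  have cover: "x \<in> E \<or> x \<in> F" if "x \<in> edges k P \<union> edges k Q" for x
    using that unfolding E_def F_def envelope_def edges_def by blast
  \<comment> \<open>The delicate case is an arc of \<open>P a\<close> and \<open>Q b\<close> with
    \<open>a \<noteq> b\<close>. For \<open>a < b\<close> it is above \<open>P b\<close>, so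
    \<open>E\<close> keeps it as an arc of \<open>Q b\<close>; it is below \<open>Q a\<close>, so
    \<open>F\<close> keeps it as an arc of \<open>P a\<close>. For \<open>b < a\<close> the roles
    are reversed.\<close>
  have both: "x \<in> E \<and> x \<in> F" if a: "a < k" "x \<in> set (P a)" and b: "b < k" "x \<in> set (Q b)" for x a b
  proof (cases "a = b")
    case True
    then show ?thesis using a b unfolding E_def F_def envelope_def by blast
  next
    case False
    have v: "tail G x \<in> ?VP a" "tail G x \<in> ?VQ b"
      using awalk_arc_ends(1)[OF DP(2)[OF a(1)] a(2)] awalk_arc_ends(1)[OF DQ(2)[OF b(1)] b(2)] .
    have xG: "x \<in> arcs G" using awalk_arcs[OF DP(2)[OF a(1)] a(2)] .
    have nv: "tail G x \<notin> ?VP b" "tail G x \<notin> ?VQ a"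
      using v disjP[OF a(1) b(1) False] disjQ[OF a(1) b(1) False] by blast+
    then have n: "x \<notin> set (P b)" "x \<notin> set (Q a)"
      using awalk_arc_ends(1)[OF DP(2)[OF b(1)]] awalk_arc_ends(1)[OF DQ(2)[OF a(1)]] by blast+
    have "aP b x \<longleftrightarrow> a < b"
      using locP[of "tail G" b x] VV[OF a(1) b(1) False v(1)] nv b(1) xG by simp
    moreover have "aQ a x \<longleftrightarrow> b < a"
      using locQ[of "tail G" a x] WW[OF b(1) a(1) _ v(2)] nv a(1) xG False by simp
    ultimately have "a < b \<and> aP b x \<and> \<not> aQ a x \<or> b < a \<and> \<not> aP b x \<and> aQ a x" using False by auto
    then show ?thesis
      using a b n unfolding E_def F_def envelope_def by blast
  qed
  have uniqP: "a = b" if "a < k" "b < k" "x \<in> set (P a)" "x \<in> set (P b)" for a b x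
    using families_same_tail(2)[OF P that refl] .
  have uniqQ: "a = b" if "a < k" "b < k" "x \<in> set (Q a)" "x \<in> set (Q b)" for a b x
    using families_same_tail(2)[OF Q that refl] .
  \<comment> \<open>An arc of one family only has a single index, and there the two envelopes ask
    for opposite sides.\<close>
  have excl: "x \<in> edges k P \<and> x \<in> edges k Q" if xE: "x \<in> E" and xF: "x \<in> F" for x
  proof (rule ccontr)
    assume n: "\<not> ?thesis"
    show False
      using xE unfolding E_def
    proof (cases rule: envelopeE)
      case (1 a)
      have nq: "\<And>b. b < k \<Longrightarrow> x \<notin> set (Q b)" using n 1 by (auto simp: edges_def)
      show False using xF unfolding F_def
        by (cases rule: envelopeE) (use nq uniqP[OF 1(1) _ 1(2)] 1 in blast)+
    next
      case (2 a)
      have nq: "\<And>b. b < k \<Longrightarrow> x \<notin> set (P b)" using n 2 by (auto simp: edges_def)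
      show False using xF unfolding F_def
        by (cases rule: envelopeE) (use nq uniqQ[OF 2(1) _ 2(2)] 2 in blast)+
    qed
  qed
  have "E \<union> F = edges k P \<union> edges k Q" using sub cover by blast
  moreover have "E \<inter> F = edges k P \<inter> edges k Q"
    using both excl unfolding edges_def by blast
  ultimately show ?thesis using that by blast
qed

end

section \<open>The Lindstroem--Gessel--Viennot lemma\<close>

context planar_network
begin

definition before :: "'v \<Rightarrow> 'e list \<Rightarrow> 'e list" where
  "before v p = takeWhile (\<lambda>e. tail G e \<noteq> v) p"

definition after :: "'v \<Rightarrow> 'e list \<Rightarrow> 'e list" where
  "after v p = dropWhile (\<lambda>e. tail G e \<noteq> v) p"

text \<open>No arc of \<open>q\<close> leaves \<open>v\<close>, since that would close a cycle; the
  first arc with tail \<open>v\<close> is therefore the first of \<open>r\<close>, if there is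
  one.\<close>

lemma before_after_append:
  assumes "awalk u q v" "awalk v r w"
  shows "before v (q @ r) = q" "after v (q @ r) = r"
proof -
  have q: "tail G e \<noteq> v" if e: "e \<in> set q" for e
  proof
    assume "tail G e = v"
    moreover obtain q1 q2 where "q = q1 @ e # q2" using e by (auto simp: in_set_conv_decomp)
    ultimately have "awalk v (e # q2) v" using assms(1) by (auto simp: awalk_simps)
    then show False using closed_awalk_Nil by blast
  qed
  have r: "r = [] \<or> tail G (hd r) = v"
    using assms(2) by (cases r) (auto simp: awalk_simps)
  show "before v (q @ r) = q" unfolding before_def
    using q r by (cases r) (auto simp: takeWhile_append)
  show "after v (q @ r) = r" unfolding after_def
    using q r by (cases r) (auto simp: dropWhile_append)
qed

lemma split_at_vertex:
  assumes "awalk u p w" "v \<in> set (awalk_verts u p)"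
  shows "awalk u (before v p) v" "awalk v (after v p) w"
proof -
  obtain q r where "p = q @ r" "awalk u q v" "awalk v r w" using awalk_decomp[OF assms] by blast
  then show "awalk u (before v p) v" "awalk v (after v p) w"
    using before_after_append by auto
qed

lemma before_append_after: "before v p @ after v p = p"
  by (simp add: before_def after_def)

end

lemma path_weight_append: "path_weight (p @ q) = path_weight p * path_weight q"
  by (simp add: path_weight_def)

text \<open>Integer coefficients have no 2-torsion, so a sum that an involution turns into its
  negative vanishes.\<close>

lemma int_mpoly_eq_neg_zero:
  fixes x :: "'a int_mpoly"
  assumes "x = - x"
  shows "x = 0"
proof (rule poly_mapping_eqI)
  fix m
  have "Poly_Mapping.lookup x m = - Poly_Mapping.lookup x m"
    using assms by (metis lookup_uminus)
  then show "Poly_Mapping.lookup x m = Poly_Mapping.lookup 0 m" by simp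
qed

lemma prod_remove_two:
  assumes "finite S" "a \<in> S" "b \<in> S" "a \<noteq> b"
  shows "prod F S = F a * F b * (prod F (S - {a, b}) :: 'a :: comm_monoid_mult)"
proof -
  have "prod F S = F a * prod F (S - {a})" using assms by (simp add: prod.remove)
  also have "prod F (S - {a}) = F b * prod F (S - {a} - {b})" using assms by (simp add: prod.remove)
  also have "S - {a} - {b} = S - {a, b}" by auto
  finally show ?thesis by (simp add: mult.assoc)
qed

section \<open>Cancellation by exchanging tails\<close>

context drawn_network
begin

context
  fixes k :: nat and f g :: "nat \<Rightarrow> nat"
  assumes f: "\<And>a b. a < b \<Longrightarrow> b < k \<Longrightarrow> f a < f b" and g: "\<And>a b. a < b \<Longrightarrow> b < k \<Longrightarrow> g a < g b"
    and fn: "\<And>a. a < k \<Longrightarrow> f a < n" and gn: "\<And>a. a < k \<Longrightarrow> g a < n"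
begin

definition systems :: "(nat \<Rightarrow> nat) \<Rightarrow> (nat \<Rightarrow> 'e list) set" where
  "systems \<sigma> = PiE {0..<k} (\<lambda>a. {p. apath (s (f a)) p (t (g (\<sigma> a)))})"

definition on_path :: "(nat \<Rightarrow> 'e list) \<Rightarrow> nat \<Rightarrow> 'v set" where
  "on_path P a = set (awalk_verts (s (f a)) (P a))"

definition doubled :: "(nat \<Rightarrow> 'e list) \<Rightarrow> 'v set" where
  "doubled P = {v. \<exists>c<k. \<exists>d<k. c \<noteq> d \<and> v \<in> on_path P c \<inter> on_path P d}"

definition swap_tails :: "'v \<Rightarrow> nat \<Rightarrow> nat \<Rightarrow> (nat \<Rightarrow> 'e list) \<Rightarrow> nat \<Rightarrow> 'e list" where
  "swap_tails v a b P = (\<lambda>c\<in>{0..<k}. if c = a then before v (P a) @ after v (P b)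
     else if c = b then before v (P b) @ after v (P a) else P c)"

lemma systemsD:
  assumes "P \<in> systems \<sigma>" "c < k"
  shows "awalk (s (f c)) (P c) (t (g (\<sigma> c)))"
  using assms by (auto simp: systems_def PiE_iff apath_def)

text \<open>An initial part and a final part, of the same or of different paths, meet only in
  \<open>v\<close>. Hence the exchange preserves both the union and the intersection of the two
  vertex sets, and with them all data on which the choice of the exchange depends.\<close>

lemma swap_tails:
  assumes P: "P \<in> systems \<sigma>" and ab: "a < k" "b < k" "a \<noteq> b"
    and v: "v \<in> on_path P a" "v \<in> on_path P b"
  defines "P' \<equiv> swap_tails v a b P"
  shows "P' \<in> systems (\<sigma> \<circ> Transposition.transpose a b)"
    and "{c. c < k \<and> v \<in> on_path P' c} = {c. c < k \<and> v \<in> on_path P c}"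
    and "doubled P' = doubled P"
    and "swap_tails v a b P' = P"
    and "(\<Prod>c=0..<k. path_weight (P' c)) = (\<Prod>c=0..<k. path_weight (P c))"
proof -
  note W = systemsD[OF P]
  note wa = split_at_vertex[OF W[OF ab(1)], of v] and wb = split_at_vertex[OF W[OF ab(2)], of v]
  have va: "v \<in> set (awalk_verts (s (f a)) (P a))" and vb: "v \<in> set (awalk_verts (s (f b)) (P b))"
    using v by (auto simp: on_path_def)
  have P'a: "P' a = before v (P a) @ after v (P b)" and P'b: "P' b = before v (P b) @ after v (P a)"
    and P'c: "\<And>c. c < k \<Longrightarrow> c \<noteq> a \<Longrightarrow> c \<noteq> b \<Longrightarrow> P' c = P c"
    using ab by (auto simp: P'_def swap_tails_def)
  have Wa: "awalk (s (f a)) (P' a) (t (g (\<sigma> b)))" and Wb: "awalk (s (f b)) (P' b) (t (g (\<sigma> a)))"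
    using wa[OF va] wb[OF vb] unfolding P'a P'b by auto
  have "apath (s (f c)) (P' c) (t (g ((\<sigma> \<circ> Transposition.transpose a b) c)))" if "c < k" for c
    unfolding awalk_iff_apath[symmetric]
    using Wa Wb W[OF that] P'c[OF that] by (cases "c = a"; cases "c = b") auto
  then show "P' \<in> systems (\<sigma> \<circ> Transposition.transpose a b)"
    unfolding systems_def by (auto simp: PiE_iff P'_def swap_tails_def)
  define Ha Ta Hb Tb where "Ha = set (awalk_verts (s (f a)) (before v (P a)))"
    and "Ta = set (awalk_verts v (after v (P a)))"
    and "Hb = set (awalk_verts (s (f b)) (before v (P b)))"
    and "Tb = set (awalk_verts v (after v (P b)))"
  have V: "on_path P a = Ha \<union> Ta" "on_path P b = Hb \<union> Tb"
    using set_awalk_verts_append[OF wa[OF va]] set_awalk_verts_append[OF wb[OF vb]]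
    by (simp_all add: on_path_def Ha_def Ta_def Hb_def Tb_def before_append_after)
  have V': "on_path P' a = Ha \<union> Tb" "on_path P' b = Hb \<union> Ta"
    using set_awalk_verts_append[OF wa(1)[OF va] wb(2)[OF vb]] set_awalk_verts_append[OF wb(1)[OF vb] wa(2)[OF va]]
    by (simp_all add: on_path_def Ha_def Ta_def Hb_def Tb_def P'a P'b)
  have Vc: "on_path P' c = on_path P c" if "c < k" "c \<noteq> a" "c \<noteq> b" for c
    using P'c[OF that] by (simp add: on_path_def)
  have pre: "\<exists>r. awalk w r v" if "w \<in> Ha \<or> w \<in> Hb" for w
    using that awalk_decomp[OF wa(1)[OF va]] awalk_decomp[OF wb(1)[OF vb]] unfolding Ha_def Hb_def by blast
  have post: "\<exists>r. awalk v r w" if "w \<in> Ta \<or> w \<in> Tb" for w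
    using that awalk_decomp[OF wa(2)[OF va]] awalk_decomp[OF wb(2)[OF vb]] unfolding Ta_def Tb_def by blast
  \<comment> \<open>A vertex both before and after \<open>v\<close> would lie on a cycle unless it
    is \<open>v\<close> itself.\<close>
  have HT: "w = v" if "w \<in> Ha \<or> w \<in> Hb" "w \<in> Ta \<or> w \<in> Tb" for w
    using pre[OF that(1)] post[OF that(2)] awalk_antisym by blast
  have vin: "v \<in> Ha" "v \<in> Hb" "v \<in> Ta" "v \<in> Tb"
    using awalk_verts_ends[OF wa(1)[OF va]] awalk_verts_ends[OF wb(1)[OF vb]]
      awalk_verts_ends[OF wa(2)[OF va]] awalk_verts_ends[OF wb(2)[OF vb]]
    by (simp_all add: Ha_def Ta_def Hb_def Tb_def)
  have inter: "w \<in> on_path P' a \<and> w \<in> on_path P' b \<longleftrightarrow> w \<in> on_path P a \<and> w \<in> on_path P b" for w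
    unfolding V V' using HT[of w] vin by auto
  have union: "w \<in> on_path P' a \<or> w \<in> on_path P' b \<longleftrightarrow> w \<in> on_path P a \<or> w \<in> on_path P b" for w
    unfolding V V' by auto
  show "{c. c < k \<and> v \<in> on_path P' c} = {c. c < k \<and> v \<in> on_path P c}"
    using Vc v inter[of v] by (metis (no_types, lifting))
  \<comment> \<open>Stated for arbitrary \<open>R\<close> and \<open>R'\<close>, so that both
    inclusions follow from one argument on how many of the two indices lie in
    \<open>{a, b}\<close>.\<close>
  have dd: "w \<in> doubled R" if dbl: "w \<in> doubled R'" and Rc: "\<And>c. c < k \<Longrightarrow> c \<noteq> a \<Longrightarrow> c \<noteq> b \<Longrightarrow> on_path R' c = on_path R c"
    and Ri: "w \<in> on_path R' a \<and> w \<in> on_path R' b \<longleftrightarrow> w \<in> on_path R a \<and> w \<in> on_path R b"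
    and Ru: "w \<in> on_path R' a \<or> w \<in> on_path R' b \<longleftrightarrow> w \<in> on_path R a \<or> w \<in> on_path R b" for R R' w
  proof -
    obtain c d where cd: "c < k" "d < k" "c \<noteq> d" "w \<in> on_path R' c" "w \<in> on_path R' d"
      using dbl unfolding doubled_def by blast
    have D: "w \<in> doubled R" if "c < k" "d < k" "c \<noteq> d" "w \<in> on_path R c" "w \<in> on_path R d" for c d
      using that unfolding doubled_def by blast
    have one: "w \<in> doubled R" if "c \<in> {a, b}" "d \<notin> {a, b}" "d < k" "w \<in> on_path R' c" "w \<in> on_path R' d" for c d
    proof -
      have "w \<in> on_path R d" using Rc[of d] that by auto
      moreover have "w \<in> on_path R a \<or> w \<in> on_path R b" using Ru that by auto
      ultimately show ?thesis using D[of a d] D[of b d] ab that by auto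
    qed
    consider "c \<in> {a, b}" "d \<in> {a, b}" | "c \<in> {a, b}" "d \<notin> {a, b}" | "c \<notin> {a, b}" "d \<in> {a, b}"
      | "c \<notin> {a, b}" "d \<notin> {a, b}" by blast
    then show ?thesis
    proof cases
      case 1
      then have "w \<in> on_path R' a \<and> w \<in> on_path R' b" using cd by auto
      then show ?thesis using Ri D[OF ab] by blast
    next
      case 2
      then show ?thesis using one[of c d] cd by blast
    next
      case 3
      then show ?thesis using one[of d c] cd by blast
    next
      case 4
      then show ?thesis using D[of c d] Rc[of c] Rc[of d] cd by auto
    qed
  qed
  show "doubled P' = doubled P"
  proof (rule subset_antisym; rule subsetI)
    show "w \<in> doubled P" if "w \<in> doubled P'" for w
      by (rule dd[OF that Vc inter union])
    show "w \<in> doubled P'" if "w \<in> doubled P" for w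
      by (rule dd[OF that Vc[symmetric] inter[symmetric] union[symmetric]])
  qed
  have ba: "before v (P' a) = before v (P a)" "after v (P' a) = after v (P b)"
    unfolding P'a using before_after_append[OF wa(1)[OF va] wb(2)[OF vb]] .
  have bb: "before v (P' b) = before v (P b)" "after v (P' b) = after v (P a)"
    unfolding P'b using before_after_append[OF wb(1)[OF vb] wa(2)[OF va]] .
  show "swap_tails v a b P' = P"
  proof
    fix c
    show "swap_tails v a b P' c = P c"
    proof (cases "c < k")
      case True
      then show ?thesis
        using P'c[OF True] ab by (simp add: swap_tails_def ba bb before_append_after)
    next
      case False
      then show ?thesis
        using PiE_arb[OF P[unfolded systems_def], of c] by (simp add: swap_tails_def)
    qed
  qed
  have two: "a \<in> {0..<k}" "b \<in> {0..<k}" using ab by auto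
  have "(\<Prod>c\<in>{0..<k} - {a, b}. path_weight (P' c)) = (\<Prod>c\<in>{0..<k} - {a, b}. path_weight (P c))"
    using P'c by (intro prod.cong) auto
  moreover have "path_weight (P' a) * path_weight (P' b) = path_weight (P a) * path_weight (P b)"
  proof -
    have "path_weight (P a) = path_weight (before v (P a)) * path_weight (after v (P a))"
      "path_weight (P b) = path_weight (before v (P b)) * path_weight (after v (P b))"
      by (simp_all add: path_weight_append[symmetric] before_append_after)
    then show ?thesis by (simp add: P'a P'b path_weight_append ac_simps)
  qed
  ultimately show "(\<Prod>c=0..<k. path_weight (P' c)) = (\<Prod>c=0..<k. path_weight (P c))"
    using prod_remove_two[OF _ two ab(3), of "\<lambda>c. path_weight (P' c)"]
      prod_remove_two[OF _ two ab(3), of "\<lambda>c. path_weight (P c)"] by simp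
qed

text \<open>
  The doubled vertices, and the indices of the paths through any one of them, are not changed by the
  exchange of tails. Choices that depend on these sets only therefore make \<open>switch\<close> an involution.
\<close>

definition first_index :: "'v \<Rightarrow> (nat \<Rightarrow> 'e list) \<Rightarrow> nat" where
  "first_index v P = Min {c. c < k \<and> v \<in> on_path P c}"

definition second_index :: "'v \<Rightarrow> (nat \<Rightarrow> 'e list) \<Rightarrow> nat" where
  "second_index v P = Min ({c. c < k \<and> v \<in> on_path P c} - {first_index v P})"

definition switch :: "(nat \<Rightarrow> nat) \<times> (nat \<Rightarrow> 'e list) \<Rightarrow> (nat \<Rightarrow> nat) \<times> (nat \<Rightarrow> 'e list)" where
  "switch = (\<lambda>(\<sigma>, P). let v = SOME v. v \<in> doubled P; a = first_index v P; b = second_index v P in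
     (\<sigma> \<circ> Transposition.transpose a b, swap_tails v a b P))"

definition signed_weight :: "(nat \<Rightarrow> nat) \<times> (nat \<Rightarrow> 'e list) \<Rightarrow> 'e int_mpoly" where
  "signed_weight = (\<lambda>(\<sigma>, P). signof \<sigma> * (\<Prod>c=0..<k. path_weight (P c)))"

lemma indices:
  assumes "v \<in> doubled P"
  shows "first_index v P < k" "second_index v P < k" "first_index v P \<noteq> second_index v P"
    "v \<in> on_path P (first_index v P)" "v \<in> on_path P (second_index v P)"
proof -
  let ?S = "{c. c < k \<and> v \<in> on_path P c}"
  obtain c d where cd: "c < k" "d < k" "c \<noteq> d" "v \<in> on_path P c" "v \<in> on_path P d"
    using assms unfolding doubled_def by blast
  have fin: "finite ?S" by simp
  have 1: "first_index v P \<in> ?S"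
    unfolding first_index_def by (rule Min_in[OF fin]) (use cd in blast)
  have 2: "second_index v P \<in> ?S - {first_index v P}"
    unfolding second_index_def
  proof (rule Min_in)
    show "?S - {first_index v P} \<noteq> {}" using cd by (cases "c = first_index v P") blast+
  qed (use fin in blast)
  show "first_index v P < k" "second_index v P < k" "first_index v P \<noteq> second_index v P"
    "v \<in> on_path P (first_index v P)" "v \<in> on_path P (second_index v P)"
    using 1 2 by auto
qed

lemma switch_props:
  assumes P: "P \<in> systems \<sigma>" and \<sigma>: "\<sigma> permutes {0..<k}" and d: "doubled P \<noteq> {}"
  obtains \<sigma>' P' where "switch (\<sigma>, P) = (\<sigma>', P')" "P' \<in> systems \<sigma>'" "\<sigma>' permutes {0..<k}" "doubled P' \<noteq> {}"
    "switch (\<sigma>', P') = (\<sigma>, P)" "signed_weight (\<sigma>', P') = - signed_weight (\<sigma>, P)"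
proof -
  define v where "v = (SOME v. v \<in> doubled P)"
  define a where "a = first_index v P"
  define b where "b = second_index v P"
  define \<sigma>' where "\<sigma>' = \<sigma> \<circ> Transposition.transpose a b"
  define P' where "P' = swap_tails v a b P"
  have v: "v \<in> doubled P" using d unfolding v_def by (rule some_in_eq[THEN iffD2])
  note ab = indices[OF v, folded a_def b_def]
  note S = swap_tails[OF P ab, folded \<sigma>'_def P'_def]
  have sw: "switch (\<sigma>, P) = (\<sigma>', P')"
    by (simp add: switch_def Let_def \<sigma>'_def P'_def a_def b_def v_def)
  have v': "(SOME v. v \<in> doubled P') = v" using S(3) by (simp add: v_def)
  have a': "first_index v P' = a" using S(2) by (simp add: first_index_def a_def)
  have b': "second_index v P' = b" using S(2) a' by (simp add: second_index_def b_def a_def)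
  have "\<sigma>' \<circ> Transposition.transpose a b = \<sigma>"
    by (simp add: \<sigma>'_def comp_assoc)
  then have sw': "switch (\<sigma>', P') = (\<sigma>, P)"
    using S(4) by (simp add: switch_def Let_def v' a' b')
  have tr: "Transposition.transpose a b permutes {0..<k}"
    using ab by (intro permutes_swap_id) auto
  have perm: "\<sigma>' permutes {0..<k}"
    unfolding \<sigma>'_def using tr \<sigma> by (rule permutes_compose)
  have "signof \<sigma>' = - (signof \<sigma> :: 'e int_mpoly)"
    unfolding \<sigma>'_def using signof_compose[OF \<sigma> tr, where 'a = "'e int_mpoly"] ab(3)
    by (simp add: sign_swap_id)
  then have "signed_weight (\<sigma>', P') = - signed_weight (\<sigma>, P)"
    using S(5) by (simp add: signed_weight_def)
  then show ?thesis using that sw S(1,3) perm sw' d by metis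
qed

text \<open>Without common vertices the paths keep the order of their ends, so the permutation is
  increasing and hence the identity.\<close>

lemma systems_good:
  assumes \<sigma>: "\<sigma> permutes {0..<k}"
  shows "P \<in> systems \<sigma> \<and> doubled P = {} \<longleftrightarrow> \<sigma> = id \<and> P \<in> families k f g"
proof
  assume P: "P \<in> systems \<sigma> \<and> doubled P = {}"
  have sk: "\<sigma> a < k" if "a < k" for a
    using permutes_in_image[OF \<sigma>, of a] that by simp
  have r: "route (f a) (P a) (g (\<sigma> a))" if "a < k" for a
    using systemsD[of P \<sigma> a] P that fn gn sk by (auto simp: route_def)
  have dis: "disjoint_family k f P"
    using P unfolding disjoint_family_def doubled_def on_path_def by blast
  have "\<sigma> a < \<sigma> b" if "a < b" "b < k" for a b
  proof -
    have "g (\<sigma> a) < g (\<sigma> b)"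
      by (rule disjoint_routes_mono[OF dis _ f that]) (use r in auto)
    then show ?thesis
      using g[of "\<sigma> b" "\<sigma> a"] sk that by (metis less_trans linorder_neqE_nat order_less_imp_not_less)
  qed
  then have "\<sigma> a = a" if "a < k" for a
    using strict_mono_on_lessThan_id[of k \<sigma> a] sk that by blast
  moreover have "\<sigma> a = a" if "\<not> a < k" for a
    using permutes_not_in[OF \<sigma>, of a] that by simp
  ultimately have "\<sigma> = id" by (auto simp: fun_eq_iff)
  moreover have "P \<in> families k f g"
    using P r dis \<open>\<sigma> = id\<close> by (auto simp: families_def systems_def PiE_iff)
  ultimately show "\<sigma> = id \<and> P \<in> families k f g" by simp
next
  assume P: "\<sigma> = id \<and> P \<in> families k f g"
  then have "P \<in> systems \<sigma>"
    using awalk_iff_apath by (auto simp: families_def systems_def PiE_iff route_def)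
  moreover have "doubled P = {}"
    using P unfolding families_def disjoint_family_def doubled_def on_path_def by blast
  ultimately show "P \<in> systems \<sigma> \<and> doubled P = {}" by simp
qed

lemma finite_systems: "finite (systems \<sigma>)"
  unfolding systems_def by (intro finite_PiE ballI apaths_finite) simp

lemma det_eq_sum_families:
  "Determinant.det (mat k k (\<lambda>(a, b). weight_matrix G n s t $$ (f a, g b)))
     = (\<Sum>P\<in>families k f g. \<Prod>c=0..<k. path_weight (P c))"
proof -
  let ?perms = "{\<sigma>. \<sigma> permutes {0..<k}}"
  let ?\<Omega> = "Sigma ?perms systems"
  let ?B = "{x \<in> ?\<Omega>. doubled (snd x) \<noteq> {}}"
  let ?M = "mat k k (\<lambda>(a, b). weight_matrix G n s t $$ (f a, g b))"
  have fin: "finite ?\<Omega>" using finite_permutations[of "{0..<k}"] finite_systems by auto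
  have "Determinant.det ?M = (\<Sum>\<sigma>\<in>?perms. signof \<sigma> * (\<Prod>a=0..<k. ?M $$ (a, \<sigma> a)))"
    by (simp add: Determinant.det_def)
  also have "\<dots> = (\<Sum>\<sigma>\<in>?perms. \<Sum>P\<in>systems \<sigma>. signed_weight (\<sigma>, P))"
  proof (rule sum.cong[OF refl])
    fix \<sigma> assume "\<sigma> \<in> ?perms"
    then have \<sigma>: "\<sigma> permutes {0..<k}" by simp
    have "?M $$ (a, \<sigma> a) = (\<Sum>p | apath (s (f a)) p (t (g (\<sigma> a))). path_weight p)" if "a \<in> {0..<k}" for a
      using that permutes_in_image[OF \<sigma>, of a] fn gn by (simp add: weight_matrix_def)
    then have "(\<Prod>a=0..<k. ?M $$ (a, \<sigma> a)) =
        (\<Prod>a=0..<k. \<Sum>p | apath (s (f a)) p (t (g (\<sigma> a))). path_weight p)"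
      by (intro prod.cong) auto
    also have "\<dots> = (\<Sum>P\<in>systems \<sigma>. \<Prod>a=0..<k. path_weight (P a))"
      unfolding systems_def by (rule prod_sum_PiE) (auto intro: apaths_finite)
    finally show "signof \<sigma> * (\<Prod>a=0..<k. ?M $$ (a, \<sigma> a)) = (\<Sum>P\<in>systems \<sigma>. signed_weight (\<sigma>, P))"
      by (simp add: signed_weight_def sum_distrib_left)
  qed
  also have "\<dots> = (\<Sum>x\<in>?\<Omega>. signed_weight x)"
    using finite_permutations[of "{0..<k}"] finite_systems by (simp add: sum.Sigma)
  also have "\<dots> = (\<Sum>x\<in>?B. signed_weight x) + (\<Sum>x\<in>?\<Omega> - ?B. signed_weight x)"
    using fin by (subst add.commute, intro sum.subset_diff) auto
  \<comment> \<open>Reindexing by the sign-reversing involution \<open>switch\<close> shows that the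
    sum over systems with a doubled vertex equals its own negative.\<close>
  also have "(\<Sum>x\<in>?B. signed_weight x) = 0"
  proof (rule int_mpoly_eq_neg_zero)
    have sw: "switch x \<in> ?B \<and> switch (switch x) = x \<and> signed_weight (switch x) = - signed_weight x"
      if x: "x \<in> ?B" for x
    proof -
      obtain \<sigma> P where x': "x = (\<sigma>, P)" by (cases x)
      then have "\<sigma> permutes {0..<k}" "P \<in> systems \<sigma>" "doubled P \<noteq> {}" using x by simp_all
      then obtain \<sigma>' P' where *: "switch (\<sigma>, P) = (\<sigma>', P')" "P' \<in> systems \<sigma>'"
        "\<sigma>' permutes {0..<k}" "doubled P' \<noteq> {}" "switch (\<sigma>', P') = (\<sigma>, P)"
        "signed_weight (\<sigma>', P') = - signed_weight (\<sigma>, P)"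
        by (blast elim: switch_props)
      show ?thesis unfolding x' *(1) using *(2-6) by simp
    qed
    have "(\<Sum>x\<in>?B. signed_weight x) = (\<Sum>x\<in>?B. - signed_weight x)"
      by (rule sum.reindex_bij_witness[of _ switch switch]) (use sw in auto)
    then show "(\<Sum>x\<in>?B. signed_weight x) = - (\<Sum>x\<in>?B. signed_weight x)"
      by (simp add: sum_negf)
  qed
  also have "?\<Omega> - ?B = {id} \<times> families k f g"
  proof -
    have "(\<sigma>, P) \<in> ?\<Omega> - ?B \<longleftrightarrow> (\<sigma>, P) \<in> {id} \<times> families k f g" for \<sigma> P
      using systems_good[of \<sigma> P] permutes_id[of "{0..<k}"] by auto
    from this[of "fst x" "snd x" for x] show ?thesis
      by (intro Set.set_eqI) (simp only: prod.collapse)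
  qed
  also have "(\<Sum>x\<in>{id} \<times> families k f g. signed_weight x) = (\<Sum>P\<in>families k f g. \<Prod>c=0..<k. path_weight (P c))"
    by (rule sum.reindex_cong[of "Pair id"]) (auto simp: inj_on_def signed_weight_def)
  finally show ?thesis by simp
qed

text \<open>No arc is repeated within a path or shared between paths, so the weight is the
  squarefree monomial of the arc set.\<close>

lemma family_weight:
  assumes P: "P \<in> families k f g"
  shows "(\<Prod>c=0..<k. path_weight (P c)) = (\<Prod>e\<in>edges k P. indet e)"
proof -
  have "path_weight (P c) = (\<Prod>e\<in>set (P c). indet e)" if "c < k" for c
    using awalk_distinct(2)[OF familiesD(2)[OF P that]]
    by (simp add: path_weight_def prod.distinct_set_conv_list)
  then have "(\<Prod>c=0..<k. path_weight (P c)) = (\<Prod>c<k. \<Prod>e\<in>set (P c). indet e)"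
    by (simp add: atLeast0LessThan)
  also have "\<dots> = (\<Prod>e\<in>edges k P. indet e)"
    unfolding edges_def
  proof (rule prod.UNION_disjoint[symmetric])
    show "\<forall>i\<in>{..<k}. \<forall>j\<in>{..<k}. i \<noteq> j \<longrightarrow> set (P i) \<inter> set (P j) = {}"
      using families_same_tail(2)[OF P] by blast
  qed auto
  finally show ?thesis .
qed

lemma flows_eq: "{E. flow (f ` {..<k}) (g ` {..<k}) E} = edges k ` families k f g"
proof
  show "{E. flow (f ` {..<k}) (g ` {..<k}) E} \<subseteq> edges k ` families k f g"
    by (intro subsetI flow_is_family f g fn gn) simp_all
  show "edges k ` families k f g \<subseteq> {E. flow (f ` {..<k}) (g ` {..<k}) E}"
    using family_edges_flow by blast
qed

lemma det_eq_sum_flows: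
  "Determinant.det (mat k k (\<lambda>(a, b). weight_matrix G n s t $$ (f a, g b)))
     = (\<Sum>E | flow (f ` {..<k}) (g ` {..<k}) E. \<Prod>e\<in>E. indet e)"
  unfolding det_eq_sum_families flows_eq
  by (subst sum.reindex[OF edges_inj]) (simp add: family_weight)

end

end

section \<open>Two-by-two minors\<close>

definition expo :: "'e set \<Rightarrow> 'e \<Rightarrow>\<^sub>0 nat" where
  "expo E = (\<Sum>e\<in>E. Poly_Mapping.single e 1)"

lemma prod_indet: "finite E \<Longrightarrow> (\<Prod>e\<in>E. indet e) = Poly_Mapping.single (expo E) 1"
  by (induction E rule: finite_induct) (simp_all add: expo_def indet_def mult_single)

lemma lookup_expo: "finite E \<Longrightarrow> Poly_Mapping.lookup (expo E) e = of_bool (e \<in> E)"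
  by (induction E rule: finite_induct) (auto simp: expo_def lookup_add lookup_single)

text \<open>The exponent is 2 on the intersection, 1 on the rest of the union and 0 elsewhere, so it
  determines both sets and nothing more.\<close>

lemma expo_add_eq_iff:
  assumes "finite E" "finite F" "finite E'" "finite F'"
  shows "expo E + expo F = expo E' + expo F' \<longleftrightarrow> E \<union> F = E' \<union> F' \<and> E \<inter> F = E' \<inter> F'"
proof
  assume eq: "expo E + expo F = expo E' + expo F'"
  have "of_bool (e \<in> E) + of_bool (e \<in> F) = (of_bool (e \<in> E') + of_bool (e \<in> F') :: nat)" for e
    using arg_cong[OF eq, of "\<lambda>m. Poly_Mapping.lookup m e"] assms by (simp add: lookup_add lookup_expo)
  then have "(e \<in> E \<union> F \<longleftrightarrow> e \<in> E' \<union> F') \<and> (e \<in> E \<inter> F \<longleftrightarrow> e \<in> E' \<inter> F')" for e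
    by (cases "e \<in> E"; cases "e \<in> F"; cases "e \<in> E'"; cases "e \<in> F'") (force dest: spec[of _ e])+
  then show "E \<union> F = E' \<union> F' \<and> E \<inter> F = E' \<inter> F'" by blast
next
  assume "E \<union> F = E' \<union> F' \<and> E \<inter> F = E' \<inter> F'"
  then have "of_bool (e \<in> E) + of_bool (e \<in> F) = (of_bool (e \<in> E') + of_bool (e \<in> F') :: nat)" for e
    by (cases "e \<in> E"; cases "e \<in> F"; cases "e \<in> E'"; cases "e \<in> F'") auto
  then show "expo E + expo F = expo E' + expo F'"
    using assms by (intro poly_mapping_eqI) (simp add: lookup_add lookup_expo)
qed

lemma lookup_sum_single:
  fixes \<phi> :: "'a \<Rightarrow> 'b"
  assumes "finite S"
  shows "Poly_Mapping.lookup (\<Sum>x\<in>S. Poly_Mapping.single (\<phi> x) (1::int)) m = int (card {x \<in> S. \<phi> x = m})"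
proof -
  have "Poly_Mapping.lookup (\<Sum>x\<in>S. Poly_Mapping.single (\<phi> x) (1::int)) m = (\<Sum>x\<in>S. if \<phi> x = m then 1 else 0)"
    by (auto simp: lookup_sum lookup_single when_def intro!: sum.cong)
  also have "\<dots> = int (card {x \<in> S. \<phi> x = m})"
    using assms by (simp add: sum.If_cases Int_def)
  finally show ?thesis .
qed

lemma det_2x2:
  fixes M :: "'a :: comm_ring_1 mat"
  assumes "dim_row M = 2" "dim_col M = 2"
  shows "Determinant.det M = M $$ (0, 0) * M $$ (1, 1) - M $$ (0, 1) * M $$ (1, 0)"
proof -
  have "{p. p permutes {0..<2::nat}} = {id, Transposition.transpose 0 1}"
    by (auto simp: permutes_doubleton_iff numeral_2_eq_2 atLeast0_lessThan_Suc insert_commute)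
  moreover have "id \<noteq> Transposition.transpose 0 (1::nat)"
    by (metis id_apply transpose_apply_first zero_neq_one)
  ultimately show ?thesis
    using assms by (simp add: Determinant.det_def sign_swap_id numeral_2_eq_2 atLeast0_lessThan_Suc)
qed

text \<open>\<open>pick\<close> selects an element by the number of smaller ones, and translation
  preserves that number.\<close>

lemma pick_translate:
  assumes "finite A" "a < card A"
  shows "pick ((+) i ` A) a = i + pick A a"
proof -
  let ?x = "pick A a"
  have x: "?x \<in> A" "card {y \<in> A. y < ?x} = a"
    using assms by (auto intro: pick_in_set card_pick)
  have "{y \<in> (+) i ` A. y < i + ?x} = (+) i ` {y \<in> A. y < ?x}" by auto
  then have "card {y \<in> (+) i ` A. y < i + ?x} = a"
    using x(2) by (simp add: card_image)
  then show ?thesis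
    using pick_card_in_set[of "i + ?x" "(+) i ` A"] x(1) by simp
qed

text \<open>\<open>submatrix\<close> ignores indices out of range. The bounds with
  \<open>Max\<close> keep both translated sets inside \<open>W\<close>, so all \<open>k\<close> rows
  and columns survive.\<close>

lemma submatrix_translate:
  assumes "A \<subseteq> {..<dim_row W}" "B \<subseteq> {..<dim_col W}" "card A = k" "card B = k" "k \<ge> 1"
    and "i < dim_row W - Max A" "j < dim_col W - Max B"
  shows "submatrix W ((+) i ` A) ((+) j ` B) = mat k k (\<lambda>(a, b). W $$ (i + pick A a, j + pick B b))"
proof -
  have fin: "finite A" "finite B" using assms(3-5) by (auto intro: card_ge_0_finite)
  have "{r. r < dim_row W \<and> r \<in> (+) i ` A} = (+) i ` A"
    using assms(6) Max_ge[OF fin(1)] by fastforce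
  moreover have "{r. r < dim_col W \<and> r \<in> (+) j ` B} = (+) j ` B"
    using assms(7) Max_ge[OF fin(2)] by fastforce
  ultimately show ?thesis
    using assms(3,4) fin unfolding submatrix_def
    by (intro eq_matI) (auto simp: card_image pick_translate)
qed

section \<open>Comparison of coefficients\<close>

context drawn_network
begin

lemma finite_flows: "finite {E. flow X Y E}"
  by (rule finite_subset[of _ "Pow (arcs G)"]) (auto simp: flow_def)

lemma flow_finite: "flow X Y E \<Longrightarrow> finite E"
  using finite_subset[of E "arcs G"] by (auto simp: flow_def)

lemma flow_pairs_product:
  "(\<Sum>E | flow X Y E. \<Prod>e\<in>E. indet e) * (\<Sum>F | flow X' Y' F. \<Prod>e\<in>F. indet e)
     = (\<Sum>(E, F)\<in>{E. flow X Y E} \<times> {F. flow X' Y' F}. Poly_Mapping.single (expo E + expo F) 1)"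
  unfolding sum_product sum.cartesian_product
  by (rule sum.cong) (auto simp: prod_indet flow_finite mult_single)

text \<open>With one negative pair \<open>(E0, F0)\<close> and one uncrossed pair
  \<open>(E1, F1)\<close> of the same monomial, adding their symmetric difference maps negative
  pairs injectively to positive ones. If there is no negative pair, the inequality is
  trivial.\<close>

lemma flow_pairs_le:
  fixes k :: nat and f f' g g' :: "nat \<Rightarrow> nat"
  assumes f: "\<And>a b. a < b \<Longrightarrow> b < k \<Longrightarrow> f a < f b" and f': "\<And>a b. a < b \<Longrightarrow> b < k \<Longrightarrow> f' a < f' b"
    and g: "\<And>a b. a < b \<Longrightarrow> b < k \<Longrightarrow> g a < g b" and g': "\<And>a b. a < b \<Longrightarrow> b < k \<Longrightarrow> g' a < g' b"
    and ff: "\<And>a. a < k \<Longrightarrow> f a \<le> f' a" and gg: "\<And>a. a < k \<Longrightarrow> g a \<le> g' a"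
    and fn: "\<And>a. a < k \<Longrightarrow> f' a < n" and gn: "\<And>a. a < k \<Longrightarrow> g' a < n"
  defines "X \<equiv> f ` {..<k}" and "X' \<equiv> f' ` {..<k}" and "Y \<equiv> g ` {..<k}" and "Y' \<equiv> g' ` {..<k}"
  shows "card {(E, F). flow X Y' E \<and> flow X' Y F \<and> expo E + expo F = m}
    \<le> card {(E, F). flow X Y E \<and> flow X' Y' F \<and> expo E + expo F = m}" (is "card ?old \<le> card ?new")
proof (cases "?old = {}")
  case True
  show ?thesis by (subst True) simp
next
  case False
  then obtain E0 F0 where 0: "flow X Y' E0" "flow X' Y F0" "expo E0 + expo F0 = m" by blast
  have fn': "f a < n" and gn': "g a < n" if "a < k" for a
    using fn[OF that] gn[OF that] ff[OF that] gg[OF that] by auto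
  have "E0 \<in> edges k ` families k f g'" "F0 \<in> edges k ` families k f' g"
    using 0 by (auto simp: X_def X'_def Y_def Y'_def intro!: flow_is_family f f' g g' fn gn fn' gn')
  then obtain P Q where PQ: "P \<in> families k f g'" "Q \<in> families k f' g" "E0 = edges k P" "F0 = edges k Q"
    by blast
  obtain E1 F1 where 1: "flow X Y E1" "flow X' Y' F1" "E1 \<union> F1 = E0 \<union> F0" "E1 \<inter> F1 = E0 \<inter> F0"
    using uncross[OF PQ(1,2) f f' ff gg] unfolding PQ(3,4) X_def X'_def Y_def Y'_def by blast
  let ?\<phi> = "\<lambda>(E, F). (xor3 E E0 E1, xor3 F F0 F1)"
  have img: "?\<phi> ` ?old \<subseteq> ?new"
  proof safe
    fix E F assume EF: "flow X Y' E" "flow X' Y F" "m = expo E + expo F"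
    have eq: "E0 \<union> F0 = E \<union> F" "E0 \<inter> F0 = E \<inter> F"
      using 0(3) EF(3) expo_add_eq_iff[of E0 F0 E F] 0(1,2) EF(1,2) flow_finite by auto
    show new: "flow X Y (xor3 E E0 E1)"
      by (rule flow_xor3[OF EF(1,2) 0(1,2) 1(1,2)]) (use eq 1 in auto)
    \<comment> \<open>The same lemma with the two members of each pair exchanged.\<close>
    show new': "flow X' Y' (xor3 F F0 F1)"
      by (rule flow_xor3[OF EF(2,1) 0(2,1) 1(2,1)]) (use eq 1 in auto)
    have "xor3 E E0 E1 \<union> xor3 F F0 F1 = E \<union> F" "xor3 E E0 E1 \<inter> xor3 F F0 F1 = E \<inter> F"
      using xor3_union_inter[of E F "E \<union> F" E0 F0 E1 F1 "E \<inter> F"] eq 1 by auto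
    then show "expo (xor3 E E0 E1) + expo (xor3 F F0 F1) = expo E + expo F"
      using expo_add_eq_iff[of "xor3 E E0 E1" "xor3 F F0 F1" E F] new new' EF flow_finite by auto
  qed
  have inj: "inj_on ?\<phi> ?old"
  proof (rule inj_onI, clarify)
    fix E F E' F'
    assume "xor3 E E0 E1 = xor3 E' E0 E1" "xor3 F F0 F1 = xor3 F' F0 F1"
    then show "E = E' \<and> F = F'" using xor3_cancel by metis
  qed
  have "finite ?new"
    by (rule finite_subset[of _ "{E. flow X Y E} \<times> {F. flow X' Y' F}"]) (auto simp: finite_flows)
  then show ?thesis by (rule card_inj_on_le[OF inj img])
qed

text \<open>The coefficient of a monomial is the number of positive pairs of flows minus the number
  of negative ones with that exponent.\<close>

lemma minor_difference_nonneg: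
  fixes k :: nat and f f' g g' :: "nat \<Rightarrow> nat"
  assumes f: "\<And>a b. a < b \<Longrightarrow> b < k \<Longrightarrow> f a < f b" and f': "\<And>a b. a < b \<Longrightarrow> b < k \<Longrightarrow> f' a < f' b"
    and g: "\<And>a b. a < b \<Longrightarrow> b < k \<Longrightarrow> g a < g b" and g': "\<And>a b. a < b \<Longrightarrow> b < k \<Longrightarrow> g' a < g' b"
    and ff: "\<And>a. a < k \<Longrightarrow> f a \<le> f' a" and gg: "\<And>a. a < k \<Longrightarrow> g a \<le> g' a"
    and fn: "\<And>a. a < k \<Longrightarrow> f' a < n" and gn: "\<And>a. a < k \<Longrightarrow> g' a < n"
  defines "minor \<equiv> (\<lambda>f g. Determinant.det (mat k k (\<lambda>(a, b). weight_matrix G n s t $$ (f a, g b))))"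
  shows "nonneg_polynomial_in (arcs G) (minor f g * minor f' g' - minor f g' * minor f' g)"
proof -
  let ?X = "f ` {..<k}" and ?X' = "f' ` {..<k}" and ?Y = "g ` {..<k}" and ?Y' = "g' ` {..<k}"
  let ?pairs = "\<lambda>X Y X' Y'. {E. flow X Y E} \<times> {F. flow X' Y' F}"
  let ?cnt = "\<lambda>X Y X' Y' m. card {(E, F). flow X Y E \<and> flow X' Y' F \<and> expo E + expo F = m}"
  have fn': "f a < n" and gn': "g a < n" if "a < k" for a
    using fn[OF that] gn[OF that] ff[OF that] gg[OF that] by auto
  have minors: "minor f g = (\<Sum>E | flow ?X ?Y E. \<Prod>e\<in>E. indet e)"
    "minor f g' = (\<Sum>E | flow ?X ?Y' E. \<Prod>e\<in>E. indet e)"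
    "minor f' g = (\<Sum>E | flow ?X' ?Y E. \<Prod>e\<in>E. indet e)"
    "minor f' g' = (\<Sum>E | flow ?X' ?Y' E. \<Prod>e\<in>E. indet e)"
    unfolding minor_def by (intro det_eq_sum_flows f f' g g' fn gn fn' gn'; assumption)+
  have cnt: "Poly_Mapping.lookup (\<Sum>(E, F)\<in>?pairs X Y X' Y'. Poly_Mapping.single (expo E + expo F) (1::int)) m
      = int (?cnt X Y X' Y' m)" for X Y X' Y' m
  proof -
    have "{x \<in> ?pairs X Y X' Y'. (case x of (E, F) \<Rightarrow> expo E + expo F) = m}
        = {(E, F). flow X Y E \<and> flow X' Y' F \<and> expo E + expo F = m}" by auto
    then show ?thesis
      using lookup_sum_single[of "?pairs X Y X' Y'" "\<lambda>(E, F). expo E + expo F" m] finite_flows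
      by (simp add: case_prod_unfold)
  qed
  define D where "D = minor f g * minor f' g' - minor f g' * minor f' g"
  have D: "Poly_Mapping.lookup D m = int (?cnt ?X ?Y ?X' ?Y' m) - int (?cnt ?X ?Y' ?X' ?Y m)" for m
    unfolding D_def minors flow_pairs_product lookup_minus cnt ..
  have "Poly_Mapping.keys m \<subseteq> arcs G" if "m \<in> Poly_Mapping.keys D" for m
  proof -
    \<comment> \<open>A monomial that occurs comes from some pair of flows, whose arcs are arcs of
      \<open>G\<close>.\<close>
    have "Poly_Mapping.lookup D m \<noteq> 0" using that by (simp add: in_keys_iff)
    then have "?cnt ?X ?Y ?X' ?Y' m \<noteq> 0 \<or> ?cnt ?X ?Y' ?X' ?Y m \<noteq> 0" unfolding D by auto
    then obtain E F where EF: "E \<subseteq> arcs G" "F \<subseteq> arcs G" "m = expo E + expo F"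
      by (force simp: card_eq_0_iff flow_def)
    have "finite E" "finite F" using EF finite_subset[OF _ finite_arcs] by blast+
    then show ?thesis
      using EF by (auto simp: in_keys_iff lookup_add lookup_expo)
  qed
  moreover have "0 \<le> Poly_Mapping.lookup D m" for m
    unfolding D using flow_pairs_le[of k f f' g g' m, OF f f' g g' ff gg fn gn] by simp
  ultimately show ?thesis
    unfolding nonneg_polynomial_in_def D_def by blast
qed

end

theorem theorem1p6:
  fixes G :: "('v, 'e) pre_digraph"
    and s t :: "nat \<Rightarrow> 'v"
    and n k :: nat
    and A B I J :: "nat set"
    and T :: "'e int_mpoly mat"
  assumes "planar_network G n s t"
    and "k \<ge> 1"
    and "A \<subseteq> {..<n}" and "card A = k"
    and "B \<subseteq> {..<n}" and "card B = k"
    and "T = minor_matrix (weight_matrix G n s t) A B"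
    and "I \<subseteq> {..<dim_row T}" and "card I = 2"
    and "J \<subseteq> {..<dim_col T}" and "card J = 2"
  shows "nonneg_polynomial_in (arcs G) (Determinant.det (submatrix T I J))"
proof -
  let ?W = "weight_matrix G n s t"
  obtain pos curve where "plane_drawing G pos curve" "boundary_order n s t pos"
    using planar_network.planar[OF assms(1)] by blast
  then interpret drawn_network G n s t pos curve
    using assms(1) by (simp add: drawn_network_def drawn_network_axioms_def)
  have dimW: "dim_row ?W = n" "dim_col ?W = n" by (simp_all add: weight_matrix_def)
  have dimT: "dim_row T = n - Max A" "dim_col T = n - Max B"
    using assms(7) dimW by (simp_all add: minor_matrix_def)
  define i i' j j' where "i = pick I 0" and "i' = pick I 1" and "j = pick J 0" and "j' = pick J 1"
  have I: "i < i'" "i' < n - Max A" and J: "j < j'" "j' < n - Max B"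
    using pick_mono[of 1 I 0] pick_mono[of 1 J 0] pick_in_set[of 1 I] pick_in_set[of 1 J] assms(8-11) dimT
    by (auto simp: i_def i'_def j_def j'_def)
  \<comment> \<open>\<open>r x\<close> and \<open>c y\<close> enumerate \<open>x + A\<close> and
    \<open>y + B\<close> in increasing order. They also increase with \<open>x\<close> and
    \<open>y\<close>, which puts each path of a negative pair above its partner at the start and
    below it at the end.\<close>
  define r where "r x a = x + pick A a" for x a
  define c where "c y b = y + pick B b" for y b
  define minor where "minor f g = Determinant.det (mat k k (\<lambda>(a, b). ?W $$ (f a, g b)))" for f g
  have T: "T $$ (x, y) = minor (r x) (c y)" if "x < n - Max A" "y < n - Max B" for x y
    using that assms(7) submatrix_translate[of A ?W B k x y] assms(2-6) dimW
    by (simp add: minor_matrix_def minor_def r_def c_def)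
  have "{a. a < dim_row T \<and> a \<in> I} = I" "{a. a < dim_col T \<and> a \<in> J} = J"
    using assms(8,10) by auto
  then have "Determinant.det (submatrix T I J) =
      T $$ (i, j) * T $$ (i', j') - T $$ (i, j') * T $$ (i', j)"
    using assms(9,11)
    by (subst det_2x2) (simp_all add: submatrix_def i_def i'_def j_def j'_def)
  also have "\<dots> = minor (r i) (c j) * minor (r i') (c j') - minor (r i) (c j') * minor (r i') (c j)"
    using T I J by simp
  finally have eq: "Determinant.det (submatrix T I J) =
      minor (r i) (c j) * minor (r i') (c j') - minor (r i) (c j') * minor (r i') (c j)" .
  have fin: "finite A" "finite B" using assms(3,5) finite_subset by blast+
  have mono: "r x a < r x b" "c x a < c x b" if "a < b" "b < k" for x a b
    using that assms(4,6) pick_mono[of b A a] pick_mono[of b B a] by (auto simp: r_def c_def)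
  have "pick A a \<le> Max A" "pick B a \<le> Max B" if "a < k" for a
    using that assms(4,6) fin by (auto intro!: Max_ge pick_in_set)
  then have bound: "r i' a < n" "c j' a < n" if "a < k" for a
    using that I(2) J(2) by (fastforce simp: r_def c_def)+
  show ?thesis
    unfolding eq minor_def
    by (rule minor_difference_nonneg)
       (use mono bound I(1) J(1) in \<open>auto simp: r_def c_def\<close>)
qed

end
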